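(* Let $(S,\Sigma)$ be a measurable space, $\mu$ a probability measure on $(S,\Sigma)$, and let $X$ be a Banach space with cotype $2$. If the countably additive vector measure $F:\Sigma\to X$ has bounded $\gamma$-variation with respect to $\mu$, there exists a function $\phi\in L^2(\mu;X)$ such that $$F(A)=\int_A\phi\,d\mu,\quad A\in\Sigma.$$ Moreover, $$\|\phi\|_{L^2(\mu;X)}\le\|F\|_{V_\gamma(\mu;X)}.$$ If $\dim L^2(\mu)=\infty$, this property characterises the cotype $2$ property of $X$.
   Context: Integrals of $X$-valued functions in $L^2(\mu;X)$ are Bochner integrals. Let $(\gamma_n)_{n\ge 1}$ be a sequence of independent standard Gaussian random variables on a probability space $(\Omega,\mathscr{F},\mathbb{P})$, with expectation $\mathbb{E}$. Bounded $\gamma$-variation: a countably additive vector measure $F:\Sigma\to X$ has bounded $\gamma$-variation with respect to $\mu$ if $\|F\|_{V_\gamma(\mu;X)}<\infty$, where $$\|F\|_{V_\gamma(\mu;X)}:=\sup\Big(\mathbb{E}\Big\|\sum_{n=1}^N\gamma_n\frac{F(A_n)}{\sqrt{\mu(A_n)}}\Big\|^2\Big)^{1/2},$$ the supremum being taken over all finite collections of disjoint sets $A_1,\dots,A_N\in\Sigma$ such that $\mu(A_n)>0$ for all $n=1,\dots,N$. Cotype $2$: $X$ has cotype $2$ if there is a constant $C$ such that $\sum_{n=1}^N\|x_n\|^2\le C^2\,\mathbb{E}\|\sum_{n=1}^N r_nx_n\|^2$ for all $N\ge 1$ and $x_1,\dots,x_N\in X$, where $(r_n)_{n\ge 1}$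 is a sequence of independent random variables with $\mathbb{P}(r_n=\pm1)=\frac12$.
   Formalization: The norm bound is proved as ‖φ‖ ≤ C‖F‖ for every cotype 2 constant C of X (constant 1 fails for R² with the max norm), and existence of φ assumes dim L²(μ)=∞ or that F vanishes on μ-null sets (it fails for μ=δ_b, F=δ_a). *)

theory Defs
  imports "HOL-Probability.Probability"
begin

section \<open>Strong measurability, Bochner integral and Bochner-Lebesgue spaces\<close>

text \<open>
  The library relation \<open>has_bochner_integral\<close> requires a second countable target.
  Here the target is an arbitrary normed space, so strong measurability (being an almost everywhere
  limit of simple functions) has to be demanded explicitly. For separable targets the two integrals
  coincide, see \<open>has_strong_bochner_integral_iff\<close> below.
\<close>

definition strongly_measurable :: "'s measure \<Rightarrow> ('s \<Rightarrow> 'x::real_normed_vector) \<Rightarrow> bool" where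
  "strongly_measurable M f \<longleftrightarrow>
     (\<exists>s :: nat \<Rightarrow> 's \<Rightarrow> 'x. (\<forall>i. simple_function M (s i)) \<and>
        (AE x in M. (\<lambda>i. s i x) \<longlonglongrightarrow> f x))"

definition has_strong_bochner_integral ::
    "'s measure \<Rightarrow> ('s \<Rightarrow> 'x::real_normed_vector) \<Rightarrow> 'x \<Rightarrow> bool" where
  "has_strong_bochner_integral M f I \<longleftrightarrow>
     strongly_measurable M f \<and>
     (\<exists>s. (\<forall>i. Bochner_Integration.simple_bochner_integrable M (s i)) \<and>
        (\<lambda>i. \<integral>\<^sup>+x. ennreal (norm (f x - s i x)) \<partial>M) \<longlonglongrightarrow> 0 \<and>
        (\<lambda>i. Bochner_Integration.simple_bochner_integral M (s i)) \<longlonglongrightarrow> I)"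

lemma borel_measurable_imp_strongly_measurable:
  fixes f :: "'s \<Rightarrow> 'x::{real_normed_vector, second_countable_topology}"
  assumes "f \<in> borel_measurable M"
  shows "strongly_measurable M f"
proof -
  obtain s where s: "\<And>i. simple_function M (s i)"
      "\<And>x. x \<in> space M \<Longrightarrow> (\<lambda>i. s i x) \<longlonglongrightarrow> f x"
    using borel_measurable_implies_sequence_metric[OF assms, of 0] by blast
  then show ?thesis
    unfolding strongly_measurable_def by (intro exI[of _ s]) auto
qed

lemma has_strong_bochner_integral_iff:
  fixes f :: "'s \<Rightarrow> 'x::{real_normed_vector, second_countable_topology}"
  assumes "f \<in> borel_measurable M"
  shows "has_strong_bochner_integral M f I \<longleftrightarrow> has_bochner_integral M f I"
  using assms borel_measurable_imp_strongly_measurable[OF assms]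
  by (auto simp: has_strong_bochner_integral_def has_bochner_integral.simps)

text \<open>
  Functions are not identified up to almost everywhere equality: \<open>bochner_L2 M\<close> is the
  set of representatives of the elements of the space $L^2(M; X)$.
\<close>

definition bochner_L2 :: "'s measure \<Rightarrow> ('s \<Rightarrow> 'x::real_normed_vector) set" where
  "bochner_L2 M =
     {f. strongly_measurable M f \<and> (\<integral>\<^sup>+x. ennreal ((norm (f x))\<^sup>2) \<partial>M) < \<infinity>}"

definition bochner_L2_norm :: "'s measure \<Rightarrow> ('s \<Rightarrow> 'x::real_normed_vector) \<Rightarrow> real" where
  "bochner_L2_norm M f = sqrt (enn2real (\<integral>\<^sup>+x. ennreal ((norm (f x))\<^sup>2) \<partial>M))"

text \<open>
  Infinite dimension of the scalar space $L^2(M)$: there are arbitrarily long finite families which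
  are linearly independent modulo almost everywhere equality.
\<close>

definition infinite_dim_L2 :: "'s measure \<Rightarrow> bool" where
  "infinite_dim_L2 M \<longleftrightarrow>
     (\<forall>n. \<exists>f :: nat \<Rightarrow> 's \<Rightarrow> real. (\<forall>i<n. f i \<in> bochner_L2 M) \<and>
        (\<forall>c :: nat \<Rightarrow> real. (AE x in M. (\<Sum>i<n. c i * f i x) = 0) \<longrightarrow> (\<forall>i<n. c i = 0)))"

section \<open>Gaussian and Rademacher sequences, cotype 2\<close>

definition gaussian_sequence :: "'w measure \<Rightarrow> (nat \<Rightarrow> 'w \<Rightarrow> real) \<Rightarrow> bool" where
  "gaussian_sequence P \<gamma> \<longleftrightarrow>
     prob_space P \<and> prob_space.indep_vars P (\<lambda>_. borel) \<gamma> UNIV \<and>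
     (\<forall>n. distributed P lborel (\<gamma> n) std_normal_density)"

definition rademacher_sequence :: "'w measure \<Rightarrow> (nat \<Rightarrow> 'w \<Rightarrow> real) \<Rightarrow> bool" where
  "rademacher_sequence Q r \<longleftrightarrow>
     prob_space Q \<and> prob_space.indep_vars Q (\<lambda>_. borel) r UNIV \<and>
     (\<forall>n. measure Q {\<omega> \<in> space Q. r n \<omega> = 1} = 1 / 2 \<and>
          measure Q {\<omega> \<in> space Q. r n \<omega> = - 1} = 1 / 2)"

text \<open>
  The following notions are meant for a Rademacher sequence \<open>r\<close> on \<open>Q\<close>; they then depend
  only on the space \<open>'x\<close>. Sequences are indexed from 0.
\<close>

definition cotype2_constant ::
    "'w measure \<Rightarrow> (nat \<Rightarrow> 'w \<Rightarrow> real) \<Rightarrow> 'x::real_normed_vector itself \<Rightarrow> real \<Rightarrow> bool" where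
  "cotype2_constant Q r X C \<longleftrightarrow> 0 \<le> C \<and>
     (\<forall>N. \<forall>x :: nat \<Rightarrow> 'x. (\<Sum>n<N. (norm (x n))\<^sup>2) \<le>
        C\<^sup>2 * (\<integral>\<omega>. (norm (\<Sum>n<N. r n \<omega> *\<^sub>R x n))\<^sup>2 \<partial>Q))"

definition cotype2 ::
    "'w measure \<Rightarrow> (nat \<Rightarrow> 'w \<Rightarrow> real) \<Rightarrow> 'x::real_normed_vector itself \<Rightarrow> bool" where
  "cotype2 Q r X \<longleftrightarrow> (\<exists>C. cotype2_constant Q r X C)"

section \<open>Vector measures and \<open>\<gamma>\<close>-variation\<close>

text \<open>Only the values of \<open>F\<close> on \<open>sets M\<close> matter.\<close>

definition vector_measure :: "'s measure \<Rightarrow> ('s set \<Rightarrow> 'x::real_normed_vector) \<Rightarrow> bool" where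
  "vector_measure M F \<longleftrightarrow>
     (\<forall>A :: nat \<Rightarrow> 's set. range A \<subseteq> sets M \<longrightarrow> disjoint_family A \<longrightarrow>
        (\<lambda>n. F (A n)) sums F (\<Union>n. A n))"

text \<open>
  The \<open>\<gamma>\<close>-variation defined below only sees sets of positive measure. If there are sets of
  arbitrarily small positive measure, as is the case when $L^2(M)$ is infinite-dimensional, then
  bounded \<open>\<gamma>\<close>-variation forces \<open>F\<close> to vanish on null sets. If \<open>M\<close> has only finitely many
  atoms and no diffuse part, it does not: take \<open>M\<close> and \<open>F\<close> to be Dirac measures at
  different points.
\<close>

definition vanishes_on_null_sets :: "'s measure \<Rightarrow> ('s set \<Rightarrow> 'x::real_normed_vector) \<Rightarrow> bool" where
  "vanishes_on_null_sets M F \<longleftrightarrow> (\<forall>A \<in> null_sets M. F A = 0)"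

text \<open>
  For a Gaussian sequence the integrands below are integrable, so that the (real) Bochner integral
  is the expectation. The supremum is taken in the extended nonnegative reals.
\<close>

definition gamma_variation ::
    "'w measure \<Rightarrow> (nat \<Rightarrow> 'w \<Rightarrow> real) \<Rightarrow> 's measure \<Rightarrow> ('s set \<Rightarrow> 'x::real_normed_vector) \<Rightarrow> ennreal"
where
  "gamma_variation P \<gamma> M F =
     (SUP (N, A) \<in> {(N :: nat, A :: nat \<Rightarrow> 's set). disjoint_family_on A {..<N} \<and>
                      (\<forall>n<N. A n \<in> sets M \<and> measure M (A n) > 0)}.
        ennreal (sqrt (\<integral>\<omega>. (norm (\<Sum>n<N. \<gamma> n \<omega> *\<^sub>R (F (A n) /\<^sub>R sqrt (measure M (A n)))))\<^sup>2 \<partial>P)))"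

definition bounded_gamma_variation ::
    "'w measure \<Rightarrow> (nat \<Rightarrow> 'w \<Rightarrow> real) \<Rightarrow> 's measure \<Rightarrow> ('s set \<Rightarrow> 'x::real_normed_vector) \<Rightarrow> bool"
where
  "bounded_gamma_variation P \<gamma> M F \<longleftrightarrow> gamma_variation P \<gamma> M F < \<infinity>"

definition represents ::
    "'s measure \<Rightarrow> ('s \<Rightarrow> 'x::real_normed_vector) \<Rightarrow> ('s set \<Rightarrow> 'x) \<Rightarrow> bool" where
  "represents M \<phi> F \<longleftrightarrow>
     (\<forall>A \<in> sets M. has_strong_bochner_integral M (\<lambda>x. indicator A x *\<^sub>R \<phi> x) (F A))"

end

theory Submission
  imports Defs
begin

text \<open>
  For a finite measurable partition let \<open>\<phi>\<close> be the function with value \<open>F A / \<mu> A\<close> on each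
  cell \<open>A\<close>. Along a chain of refinements these functions form a martingale. Replacing cells by
  independent Gaussian variables turns its differences into independent symmetric vectors, so two
  applications of cotype 2 bound the sum of the squared \<open>L\<^sup>2\<close> norms of the differences by a constant
  times the squared \<open>\<gamma>\<close>-variation. Hence the net of the functions \<open>\<phi>\<close> is Cauchy in \<open>L\<^sup>2\<close>, and
  its limit is the density; no Radon-Nikodym property is needed. The constant \<open>C\<close> in the norm
  estimate comes from applying cotype 2 to a single partition.

  Conversely, if Gaussian cotype 2 fails, blocks of vectors with squared norms summing to 1 and
  geometrically small Gaussian means are placed on disjoint sets of positive measure; the resulting
  vector measure has bounded \<open>\<gamma>\<close>-variation, but a density would have infinite \<open>L\<^sup>2\<close> norm. Finally,
  Gaussian cotype 2 implies Rademacher cotype 2: a Gaussian sum is decomposed into the layers where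
  a coefficient exceeds \<open>2 k\<close>, and Gaussian cotype shows that passing to a random subset which
  contains each index with probability \<open>1 / m\<close> reduces the Rademacher mean by a factor of order
  \<open>m\<close> to the power \<open>-1/2\<close>.
\<close>

section \<open>Gaussian means\<close>

text \<open>The space need not be separable, so vector-valued sums are handled only through norms of
  finite linear combinations with measurable real coefficients, and densities only through simple
  functions. Hence Gaussian means are \<open>ennreal\<close> integrals, and their symmetries are
  proved by integrating out one or two coordinates at a time.

  The symmetry behind the martingale argument is this: if E is the conditional expectation given a
  coarser partition, then id - 2 E is an orthogonal reflection in the coordinates scaled by square
  roots of cell measures, and orthogonal maps preserve Gaussian means. Averaging the identity with
  minus this reflection shows that E is a contraction; composing such reflections produces all signs
  of the differences.

  The constant \<open>C\<close> cannot be dropped in general. In the plane with the l1 norm, (1/2,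
  1/2) and (1/2, -1/2) have squared norms with sum 2, while their Gaussian mean is E max(g1^2, g2^2)
  = 1 + 2/pi. The step density built from them on two cells has squared norm 2 and squared
  \<gamma>-variation at most 1 + 2/pi.\<close>

lemma borel_measurable_norm_lincomb:
  fixes x :: "'i \<Rightarrow> 'x::real_normed_vector"
  assumes "finite I" "\<And>i. i \<in> I \<Longrightarrow> f i \<in> borel_measurable M"
  shows "(\<lambda>\<omega>. norm (u + (\<Sum>i\<in>I. f i \<omega> *\<^sub>R x i))) \<in> borel_measurable M"
proof -
  obtain h where h: "bij_betw h {..<card I} I"
    using ex_bij_betw_nat_finite[OF assms(1)] by (auto simp: atLeast0LessThan)
  \<comment> \<open>Measurability into a topological product is available for countable index types,
    so \<open>I\<close> is enumerated by natural numbers; coefficients from \<open>card I\<close> on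
    are 0.\<close>
  define g where "g \<omega> n = (if n < card I then f (h n) \<omega> else 0)" for \<omega> n
  have "(\<lambda>\<omega>. g \<omega> n) \<in> borel_measurable M" for n
    using assms(2) bij_betwE[OF h] by (cases "n < card I") (auto simp: g_def)
  then have "g \<in> borel_measurable M"
    by (rule measurable_coordinatewise_then_product)
  moreover have "continuous_on UNIV (\<lambda>t. norm (u + (\<Sum>n<card I. (t n :: real) *\<^sub>R x (h n))))"
    by (intro continuous_intros continuous_on_product_then_coordinatewise[of _ "\<lambda>t. t"])
  then have "(\<lambda>t. norm (u + (\<Sum>n<card I. (t n :: real) *\<^sub>R x (h n)))) \<in> borel_measurable borel"
    by (rule borel_measurable_continuous_onI)
  ultimately have "(\<lambda>\<omega>. norm (u + (\<Sum>n<card I. g \<omega> n *\<^sub>R x (h n)))) \<in> borel_measurable M"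
    by (rule measurable_compose)
  moreover have "(\<Sum>n<card I. g \<omega> n *\<^sub>R x (h n)) = (\<Sum>i\<in>I. f i \<omega> *\<^sub>R x i)" for \<omega>
    by (subst sum.reindex_bij_betw[OF h, symmetric]) (simp add: g_def)
  ultimately show ?thesis by simp
qed

abbreviation std_normal :: "real measure" where
  "std_normal \<equiv> density lborel (\<lambda>x. ennreal (std_normal_density x))"

lemma prob_space_std_normal: "prob_space std_normal"
  using prob_space_normal_density[of 1 0] by simp

interpretation std_normal: prob_space std_normal
  by (rule prob_space_std_normal)

interpretation PiM_std_normal: product_prob_space "\<lambda>_. std_normal" UNIV
  by unfold_locales

lemma prob_space_PiM_std_normal: "prob_space (PiM I (\<lambda>_. std_normal))"
  by (rule prob_space_PiM) (rule prob_space_std_normal)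

text \<open>The offset \<open>u\<close> is there for inductions over \<open>I\<close>: integrating out one coordinate moves its
  contribution into the offset.\<close>

definition gauss_mean :: "'i set \<Rightarrow> ('i \<Rightarrow> 'x::real_normed_vector) \<Rightarrow> 'x \<Rightarrow> ennreal" where
  "gauss_mean I x u =
     (\<integral>\<^sup>+t. ennreal ((norm (u + (\<Sum>i\<in>I. t i *\<^sub>R x i)))\<^sup>2) \<partial>PiM I (\<lambda>_. std_normal))"

lemma measurable_PiM_std_normal_component:
  "i \<in> I \<Longrightarrow> (\<lambda>t. t i) \<in> borel_measurable (PiM I (\<lambda>_. std_normal))"
  using measurable_component_singleton[of i I "\<lambda>_. std_normal"] by simp

lemma borel_measurable_gauss_integrand:
  assumes "finite I"
  shows "(\<lambda>t. norm (u + (\<Sum>i\<in>I. t i *\<^sub>R x i))) \<in> borel_measurable (PiM I (\<lambda>_. std_normal))"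
  by (rule borel_measurable_norm_lincomb[OF assms]) (rule measurable_PiM_std_normal_component)

lemma gauss_mean_cong:
  assumes "\<And>i. i \<in> I \<Longrightarrow> x i = y i" "u = v"
  shows "gauss_mean I x u = gauss_mean I y v"
  using assms unfolding gauss_mean_def by simp

lemma gauss_mean_empty: "gauss_mean {} x u = ennreal ((norm u)\<^sup>2)"
  by (simp add: gauss_mean_def PiM_empty nn_integral_count_space_finite)

lemma gauss_mean_insert:
  assumes "finite I" "i \<notin> I"
  shows "gauss_mean (insert i I) x u = (\<integral>\<^sup>+a. gauss_mean I x (u + a *\<^sub>R x i) \<partial>std_normal)"
proof -
  have "(\<lambda>t. ennreal ((norm (u + (\<Sum>i\<in>insert i I. t i *\<^sub>R x i)))\<^sup>2))
      \<in> borel_measurable (PiM (insert i I) (\<lambda>_. std_normal))"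
    using borel_measurable_gauss_integrand[of "insert i I" u x] assms by simp
  then have "gauss_mean (insert i I) x u =
    (\<integral>\<^sup>+a. \<integral>\<^sup>+t. ennreal ((norm (u + (\<Sum>j\<in>insert i I. (t(i := a)) j *\<^sub>R x j)))\<^sup>2)
       \<partial>PiM I (\<lambda>_. std_normal) \<partial>std_normal)"
    unfolding gauss_mean_def
    by (subst PiM_std_normal.product_nn_integral_insert_rev[OF assms]) auto
  moreover have "(\<Sum>j\<in>insert i I. (t(i := a)) j *\<^sub>R x j) = a *\<^sub>R x i + (\<Sum>j\<in>I. t j *\<^sub>R x j)"
    for a and t :: "'a \<Rightarrow> real"
    using assms by (subst sum.insert) (auto intro!: sum.cong)
  ultimately show ?thesis
    by (simp add: gauss_mean_def add.assoc)
qed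

lemma borel_measurable_gauss_mean:
  assumes "finite I" "finite K" "\<And>k. k \<in> K \<Longrightarrow> g k \<in> borel_measurable M"
  shows "(\<lambda>\<omega>. gauss_mean I x (u + (\<Sum>k\<in>K. g k \<omega> *\<^sub>R y k))) \<in> borel_measurable M"
proof -
  interpret P: prob_space "PiM I (\<lambda>_. std_normal)" by (rule prob_space_PiM_std_normal)
  \<comment> \<open>The disjoint sum of the index sets lets one linear combination carry both the
    integration variables and the parameters \<open>g k\<close>.\<close>
  let ?J = "Inl ` I \<union> Inr ` K"
  let ?f = "\<lambda>j (p::'c \<times> ('a \<Rightarrow> real)). case j of Inl i \<Rightarrow> snd p i | Inr k \<Rightarrow> g k (fst p)"
  have "(\<lambda>p. norm (u + (\<Sum>j\<in>?J. ?f j p *\<^sub>R (case j of Inl i \<Rightarrow> x i | Inr k \<Rightarrow> y k))))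
      \<in> borel_measurable (M \<Otimes>\<^sub>M PiM I (\<lambda>_. std_normal))"
  proof (rule borel_measurable_norm_lincomb)
    fix j assume j: "j \<in> ?J"
    show "?f j \<in> borel_measurable (M \<Otimes>\<^sub>M PiM I (\<lambda>_. std_normal))"
    proof (cases j)
      case (Inl i)
      then have "i \<in> I" using j by auto
      then have "(\<lambda>p. snd p i) \<in> borel_measurable (M \<Otimes>\<^sub>M PiM I (\<lambda>_. std_normal))"
        by (intro measurable_compose[OF measurable_snd] measurable_PiM_std_normal_component)
      then show ?thesis using Inl by simp
    next
      case (Inr k)
      then have "k \<in> K" using j by auto
      then have "(\<lambda>p. g k (fst p)) \<in> borel_measurable (M \<Otimes>\<^sub>M PiM I (\<lambda>_. std_normal))"
        by (intro measurable_compose[OF measurable_fst] assms)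
      then show ?thesis using Inr by simp
    qed
  qed (use assms in simp)
  moreover have "(\<Sum>j\<in>?J. ?f j p *\<^sub>R (case j of Inl i \<Rightarrow> x i | Inr k \<Rightarrow> y k)) =
      (\<Sum>k\<in>K. g k (fst p) *\<^sub>R y k) + (\<Sum>i\<in>I. snd p i *\<^sub>R x i)" for p
    using assms(1,2) by (subst sum.union_disjoint) (auto simp: sum.reindex)
  ultimately have "(\<lambda>p. ennreal ((norm (u + (\<Sum>k\<in>K. g k (fst p) *\<^sub>R y k) + (\<Sum>i\<in>I. snd p i *\<^sub>R x i)))\<^sup>2))
      \<in> borel_measurable (M \<Otimes>\<^sub>M PiM I (\<lambda>_. std_normal))"
    by (simp add: add.assoc)
  from P.borel_measurable_nn_integral_fst[OF this] show ?thesis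
    by (simp add: gauss_mean_def)
qed

section \<open>Rotation invariance of the Gaussian measure in the plane\<close>

lemma nn_integral_std_normal:
  assumes "f \<in> borel_measurable borel"
  shows "(\<integral>\<^sup>+a. f a \<partial>std_normal) = (\<integral>\<^sup>+a. ennreal (std_normal_density a) * f a \<partial>lborel)"
  using assms by (subst nn_integral_density) auto

lemma nn_integral_std_normal_uminus:
  assumes "f \<in> borel_measurable borel"
  shows "(\<integral>\<^sup>+a. f (- a) \<partial>std_normal) = (\<integral>\<^sup>+a. f a \<partial>std_normal)"
proof -
  have "(\<integral>\<^sup>+a. f a \<partial>std_normal) = (\<integral>\<^sup>+a. ennreal (std_normal_density a) * f a \<partial>lborel)"
    by (rule nn_integral_std_normal[OF assms])
  also have "\<dots> = (\<integral>\<^sup>+a. ennreal (std_normal_density (-a)) * f (-a) \<partial>lborel)"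
    using assms by (subst nn_integral_real_affine[where c = "-1" and t = 0]) auto
  also have "\<dots> = (\<integral>\<^sup>+a. f (- a) \<partial>std_normal)"
    using assms by (subst nn_integral_std_normal) (auto simp: std_normal_density_def)
  finally show ?thesis by simp
qed

lemma nn_integral_lborel_shift:
  fixes f :: "real \<Rightarrow> ennreal"
  assumes "f \<in> borel_measurable borel"
  shows "(\<integral>\<^sup>+a. f (a + c) \<partial>lborel) = (\<integral>\<^sup>+a. f a \<partial>lborel)"
  using nn_integral_real_affine[OF assms, of 1 c] by (simp add: add.commute)

lemma nn_integral_shear:
  fixes f :: "real \<Rightarrow> real \<Rightarrow> ennreal"
  assumes "(\<lambda>(a, b). f a b) \<in> borel_measurable (borel \<Otimes>\<^sub>M borel)"
  shows "(\<integral>\<^sup>+a. \<integral>\<^sup>+b. f (a + s * b) b \<partial>lborel \<partial>lborel) = (\<integral>\<^sup>+a. \<integral>\<^sup>+b. f a b \<partial>lborel \<partial>lborel)"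
    and "(\<integral>\<^sup>+a. \<integral>\<^sup>+b. f a (b + s * a) \<partial>lborel \<partial>lborel) = (\<integral>\<^sup>+a. \<integral>\<^sup>+b. f a b \<partial>lborel \<partial>lborel)"
proof -
  note [measurable] = assms
  have "(\<integral>\<^sup>+a. \<integral>\<^sup>+b. f (a + s * b) b \<partial>lborel \<partial>lborel) = (\<integral>\<^sup>+b. \<integral>\<^sup>+a. f (a + s * b) b \<partial>lborel \<partial>lborel)"
    by (rule lborel_pair.Fubini'[symmetric]) measurable
  also have "\<dots> = (\<integral>\<^sup>+b. \<integral>\<^sup>+a. f a b \<partial>lborel \<partial>lborel)"
    by (intro nn_integral_cong nn_integral_lborel_shift) measurable
  also have "\<dots> = (\<integral>\<^sup>+a. \<integral>\<^sup>+b. f a b \<partial>lborel \<partial>lborel)"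
    by (rule lborel_pair.Fubini') measurable
  finally show "(\<integral>\<^sup>+a. \<integral>\<^sup>+b. f (a + s * b) b \<partial>lborel \<partial>lborel) = (\<integral>\<^sup>+a. \<integral>\<^sup>+b. f a b \<partial>lborel \<partial>lborel)" .
  show "(\<integral>\<^sup>+a. \<integral>\<^sup>+b. f a (b + s * a) \<partial>lborel \<partial>lborel) = (\<integral>\<^sup>+a. \<integral>\<^sup>+b. f a b \<partial>lborel \<partial>lborel)"
    by (intro nn_integral_cong nn_integral_lborel_shift) measurable
qed

text \<open>A plane rotation by an angle that is not a multiple of $\pi$ is a product of three shears.\<close>

lemma nn_integral_rotation:
  fixes f :: "real \<Rightarrow> real \<Rightarrow> ennreal"
  assumes [measurable]: "(\<lambda>(a, b). f a b) \<in> borel_measurable (borel \<Otimes>\<^sub>M borel)"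
    and cs: "c\<^sup>2 + s\<^sup>2 = 1" and "s \<noteq> 0"
  shows "(\<integral>\<^sup>+a. \<integral>\<^sup>+b. f (c * a - s * b) (s * a + c * b) \<partial>lborel \<partial>lborel) = (\<integral>\<^sup>+a. \<integral>\<^sup>+b. f a b \<partial>lborel \<partial>lborel)"
proof -
  \<comment> \<open>For an angle with cosine \<open>c\<close> and sine \<open>s\<close> this is the
    tangent of half the angle. It is the slope of the two outer shears; the middle one has slope
    \<open>s\<close>.\<close>
  define t where "t = (1 - c) / s"
  have st: "s * t = 1 - c" using \<open>s \<noteq> 0\<close> by (simp add: t_def)
  have "s * (t * (1 + c)) = (s * t) * (1 + c)" by (simp add: mult.assoc)
  also have "\<dots> = 1 - c\<^sup>2" by (simp add: st algebra_simps power2_eq_square)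
  also have "\<dots> = s * s" using cs by (simp add: power2_eq_square)
  finally have "s * (t * (1 + c)) = s * s" .
  then have t2: "t * (1 + c) = s" using \<open>s \<noteq> 0\<close> by simp
  let ?f1 = "\<lambda>a b. f (a - t * b) b"
  let ?f2 = "\<lambda>a b. ?f1 a (b + s * a)"
  have m1: "(\<lambda>(a, b). ?f1 a b) \<in> borel_measurable (borel \<Otimes>\<^sub>M borel)" by measurable
  have m2: "(\<lambda>(a, b). ?f2 a b) \<in> borel_measurable (borel \<Otimes>\<^sub>M borel)" by measurable
  have "?f2 (a + (- t) * b) b = f (c * a - s * b) (s * a + c * b)" for a b
  proof -
    have "b + s * (a + (- t) * b) = s * a + (1 - s * t) * b" by (simp add: algebra_simps)
    then have e1: "b + s * (a + (- t) * b) = s * a + c * b" by (simp only: st) simp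
    have "a + (- t) * b - t * (s * a + c * b) = (1 - s * t) * a - (t * (1 + c)) * b"
      by (simp add: algebra_simps)
    then have e2: "a + (- t) * b - t * (s * a + c * b) = c * a - s * b"
      using st t2 by simp
    show ?thesis by (simp only: e1 e2)
  qed
  then have "(\<integral>\<^sup>+a. \<integral>\<^sup>+b. f (c * a - s * b) (s * a + c * b) \<partial>lborel \<partial>lborel)
      = (\<integral>\<^sup>+a. \<integral>\<^sup>+b. ?f2 (a + (- t) * b) b \<partial>lborel \<partial>lborel)" by simp
  also have "\<dots> = (\<integral>\<^sup>+a. \<integral>\<^sup>+b. ?f2 a b \<partial>lborel \<partial>lborel)"
    by (rule nn_integral_shear(1)[OF m2])
  also have "\<dots> = (\<integral>\<^sup>+a. \<integral>\<^sup>+b. ?f1 a b \<partial>lborel \<partial>lborel)"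
    by (rule nn_integral_shear(2)[OF m1])
  also have "\<dots> = (\<integral>\<^sup>+a. \<integral>\<^sup>+b. f a b \<partial>lborel \<partial>lborel)"
    using nn_integral_shear(1)[of f "- t"] by simp
  finally show ?thesis .
qed

text \<open>The product of the two densities depends only on \<open>a\<^sup>2 + b\<^sup>2\<close>,
  so the rotation invariance of plane Lebesgue measure carries over.\<close>

lemma nn_integral_std_normal_rotation:
  fixes f :: "real \<Rightarrow> real \<Rightarrow> ennreal"
  assumes [measurable]: "(\<lambda>(a, b). f a b) \<in> borel_measurable (borel \<Otimes>\<^sub>M borel)"
    and cs: "c\<^sup>2 + s\<^sup>2 = 1" and "s \<noteq> 0"
  shows "(\<integral>\<^sup>+a. \<integral>\<^sup>+b. f (c * a - s * b) (s * a + c * b) \<partial>std_normal \<partial>std_normal)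
       = (\<integral>\<^sup>+a. \<integral>\<^sup>+b. f a b \<partial>std_normal \<partial>std_normal)"
proof -
  let ?d = std_normal_density
  have *: "(\<integral>\<^sup>+a. \<integral>\<^sup>+b. g a b \<partial>std_normal \<partial>std_normal)
      = (\<integral>\<^sup>+a. \<integral>\<^sup>+b. ennreal (?d a * ?d b) * g a b \<partial>lborel \<partial>lborel)"
    if [measurable]: "(\<lambda>(a, b). g a b) \<in> borel_measurable (borel \<Otimes>\<^sub>M borel)" for g :: "real \<Rightarrow> real \<Rightarrow> ennreal"
  proof -
    have "(\<integral>\<^sup>+a. \<integral>\<^sup>+b. g a b \<partial>std_normal \<partial>std_normal)
        = (\<integral>\<^sup>+a. \<integral>\<^sup>+b. ennreal (?d b) * g a b \<partial>lborel \<partial>std_normal)"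
      by (intro nn_integral_cong nn_integral_std_normal) measurable
    also have "\<dots> = (\<integral>\<^sup>+a. ennreal (?d a) * (\<integral>\<^sup>+b. ennreal (?d b) * g a b \<partial>lborel) \<partial>lborel)"
      by (rule nn_integral_std_normal) measurable
    finally show ?thesis
      by (simp add: nn_integral_cmult[symmetric] ennreal_mult mult.assoc)
  qed
  have "?d (c * a - s * b) * ?d (s * a + c * b) = ?d a * ?d b" for a b
  proof -
    have "(c * a - s * b)\<^sup>2 + (s * a + c * b)\<^sup>2 = (c\<^sup>2 + s\<^sup>2) * (a\<^sup>2 + b\<^sup>2)" by algebra
    then have "(c * a - s * b)\<^sup>2 / 2 + (s * a + c * b)\<^sup>2 / 2 = a\<^sup>2 / 2 + b\<^sup>2 / 2"
      using cs by (simp add: add_divide_distrib[symmetric])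
    then show ?thesis
      unfolding std_normal_density_def
      by (simp add: mult.commute mult.left_commute exp_add[symmetric] minus_add_distrib[symmetric]
               del: minus_add_distrib)
  qed
  then show ?thesis
    using nn_integral_rotation[OF _ cs \<open>s \<noteq> 0\<close>, of "\<lambda>a b. ennreal (?d a * ?d b) * f a b"]
    by (subst (1 2) *) simp_all
qed

section \<open>Orthogonal invariance of Gaussian means\<close>

lemma borel_measurable_gauss_mean_pair:
  assumes "finite I"
  shows "(\<lambda>(a, b). gauss_mean I x (u + a *\<^sub>R y + b *\<^sub>R z)) \<in> borel_measurable (borel \<Otimes>\<^sub>M (borel :: real measure))"
proof -
  have "(\<lambda>\<omega>. gauss_mean I x (u + (\<Sum>k\<in>UNIV. (if k then fst \<omega> else snd \<omega>) *\<^sub>R (if k then y else z))))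
      \<in> borel_measurable (borel \<Otimes>\<^sub>M (borel :: real measure))"
    by (rule borel_measurable_gauss_mean[OF assms]) auto
  then show ?thesis by (simp add: UNIV_bool add.assoc split_beta' add.commute[of "snd _ *\<^sub>R z"])
qed

lemma borel_measurable_gauss_mean_line:
  assumes "finite I"
  shows "(\<lambda>a. gauss_mean I x (u + a *\<^sub>R y)) \<in> borel_measurable borel"
  using borel_measurable_gauss_mean[OF assms, of "{()}" "\<lambda>_ a. a" borel x u "\<lambda>_. y"] by simp

lemma gauss_mean_insert_zero:
  assumes "finite I" "i \<notin> I" "x i = 0"
  shows "gauss_mean (insert i I) x u = gauss_mean I x u"
  using std_normal.emeasure_space_1 by (simp add: gauss_mean_insert assms)

lemma gauss_mean_insert2:
  assumes "finite I" "i \<notin> I" "j \<notin> I" "i \<noteq> j"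
  shows "gauss_mean (insert i (insert j I)) x u =
    (\<integral>\<^sup>+a. \<integral>\<^sup>+b. gauss_mean I x (u + a *\<^sub>R x i + b *\<^sub>R x j) \<partial>std_normal \<partial>std_normal)"
  using assms by (simp add: gauss_mean_insert)

text \<open>Collecting the coefficients of \<open>x i\<close> and \<open>x j\<close> turns the
  rotation of the two vectors into a rotation of their pair of Gaussian coefficients.\<close>

lemma gauss_mean_rotation:
  assumes "finite I" "i \<in> I" "j \<in> I" "i \<noteq> j" "c\<^sup>2 + s\<^sup>2 = 1" "s \<noteq> 0"
  shows "gauss_mean I (x(i := c *\<^sub>R x i + s *\<^sub>R x j, j := c *\<^sub>R x j - s *\<^sub>R x i)) u = gauss_mean I x u"
proof -
  define J where "J = I - {i, j}"
  have J: "finite J" "i \<notin> J" "j \<notin> J" "I = insert i (insert j J)"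
    using assms by (auto simp: J_def)
  let ?y = "x(i := c *\<^sub>R x i + s *\<^sub>R x j, j := c *\<^sub>R x j - s *\<^sub>R x i)"
  have "gauss_mean I ?y u = (\<integral>\<^sup>+a. \<integral>\<^sup>+b. gauss_mean J x (u + (c * a - s * b) *\<^sub>R x i + (s * a + c * b) *\<^sub>R x j)
      \<partial>std_normal \<partial>std_normal)"
    unfolding J(4) gauss_mean_insert2[OF J(1-3) \<open>i \<noteq> j\<close>]
    using J \<open>i \<noteq> j\<close> by (intro nn_integral_cong gauss_mean_cong) (auto simp: algebra_simps)
  also have "\<dots> = gauss_mean I x u"
    unfolding J(4) gauss_mean_insert2[OF J(1-3) \<open>i \<noteq> j\<close>]
    by (rule nn_integral_std_normal_rotation[OF borel_measurable_gauss_mean_pair[OF J(1)]]) (use assms in auto)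
  finally show ?thesis .
qed

lemma gauss_mean_flip:
  assumes "finite I" "i \<in> I"
  shows "gauss_mean I (x(i := - x i)) u = gauss_mean I x u"
proof -
  define J where "J = I - {i}"
  have J: "finite J" "i \<notin> J" "I = insert i J"
    using assms by (auto simp: J_def)
  have "gauss_mean I (x(i := - x i)) u = (\<integral>\<^sup>+a. gauss_mean J x (u + (- a) *\<^sub>R x i) \<partial>std_normal)"
    unfolding J(3) gauss_mean_insert[OF J(1,2)]
    using J by (intro nn_integral_cong gauss_mean_cong) auto
  also have "\<dots> = gauss_mean I x u"
    unfolding J(3) gauss_mean_insert[OF J(1,2)]
    by (rule nn_integral_std_normal_uminus) (rule borel_measurable_gauss_mean_line[OF J(1)])
  finally show ?thesis .
qed

lemma gauss_mean_sign:
  assumes "finite I" "\<And>i. i \<in> I \<Longrightarrow> e i \<in> {1, -1}"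
  shows "gauss_mean I (\<lambda>i. e i *\<^sub>R x i) u = gauss_mean I x u"
proof -
  have "gauss_mean I (\<lambda>i. if i \<in> J then e i *\<^sub>R x i else x i) u = gauss_mean I x u" if "finite J" "J \<subseteq> I" for J
    using that
  proof (induction J)
    case (insert j J)
    let ?y = "\<lambda>i. if i \<in> J then e i *\<^sub>R x i else x i"
    have "gauss_mean I (\<lambda>i. if i \<in> insert j J then e i *\<^sub>R x i else x i) u = gauss_mean I ?y u"
    proof (cases "e j = 1")
      case False
      then have "e j = -1" using assms(2) insert by auto
      then have "(\<lambda>i. if i \<in> insert j J then e i *\<^sub>R x i else x i) = ?y(j := - ?y j)"
        using insert by auto
      then show ?thesis using gauss_mean_flip[OF assms(1), of j ?y] insert by auto
    qed (auto intro!: gauss_mean_cong)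
    then show ?case using insert by auto
  qed simp
  from this[OF assms(1) order_refl] show ?thesis
    by (simp cong: gauss_mean_cong)
qed

text \<open>Induction on the number of nonzero \<open>v i\<close>: rotating the plane of two of them so that one
  becomes 0 conjugates the reflection to one with smaller support.\<close>

lemma gauss_mean_householder:
  assumes "finite I" "(\<Sum>i\<in>I. (v i)\<^sup>2) = 1"
  shows "gauss_mean I (\<lambda>i. x i - (2 * v i) *\<^sub>R (\<Sum>m\<in>I. v m *\<^sub>R x m)) u = gauss_mean I x u"
  using assms(2)
proof (induction "card {i \<in> I. v i \<noteq> 0}" arbitrary: v x rule: less_induct)
  case less
  have "{i \<in> I. v i \<noteq> 0} \<noteq> {}"
  proof
    assume "{i \<in> I. v i \<noteq> 0} = {}"
    then have "(\<Sum>i\<in>I. (v i)\<^sup>2) = 0" by (intro sum.neutral) auto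
    then show False using less.prems by simp
  qed
  then obtain i where i: "i \<in> I" "v i \<noteq> 0" by auto
  show ?case
  proof (cases "\<exists>j\<in>I. v j \<noteq> 0 \<and> j \<noteq> i")
    case False
    then have v0: "v m = 0" if "m \<in> I" "m \<noteq> i" for m using that by auto
    have "(\<Sum>m\<in>I. (v m)\<^sup>2) = (v i)\<^sup>2"
      using i v0 by (subst sum.remove[OF assms(1), of i]) (auto intro!: sum.neutral)
    then have "v i * v i = 1" using less.prems by (simp add: power2_eq_square)
    moreover have "(\<Sum>m\<in>I. v m *\<^sub>R x m) = v i *\<^sub>R x i"
      using i v0 by (subst sum.remove[OF assms(1), of i]) (auto intro!: sum.neutral)
    ultimately have "gauss_mean I (\<lambda>i. x i - (2 * v i) *\<^sub>R (\<Sum>m\<in>I. v m *\<^sub>R x m)) u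
        = gauss_mean I (x(i := - x i)) u"
      using v0 by (intro gauss_mean_cong) (auto simp: scaleR_2 mult.assoc)
    then show ?thesis using gauss_mean_flip[OF assms(1) i(1), of x u] by simp
  next
    case True
    then obtain j where j: "j \<in> I" "v j \<noteq> 0" "j \<noteq> i" by auto
    define \<rho> c s where "\<rho> = sqrt ((v i)\<^sup>2 + (v j)\<^sup>2)" and "c = v i / \<rho>" and "s = v j / \<rho>"
    have rho: "\<rho> > 0" "\<rho>\<^sup>2 = (v i)\<^sup>2 + (v j)\<^sup>2"
      using i by (auto simp: \<rho>_def sum_power2_gt_zero_iff)
    have cs: "c\<^sup>2 + s\<^sup>2 = 1" "s \<noteq> 0" "v i = \<rho> * c" "v j = \<rho> * s"
      using rho j by (auto simp: c_def s_def power_divide add_divide_distrib[symmetric])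
    \<comment> \<open>The same rotation takes the pair of \<open>v i\<close> and \<open>v j\<close>
      to \<rho> and 0. Since it is orthogonal, applying it to the coefficients and to the vectors
      together leaves \<open>\<Sum>m\<in>I. v m *\<^sub>R x m\<close> unchanged.\<close>
    define G where "G y = y(i := c *\<^sub>R y i + s *\<^sub>R y j, j := c *\<^sub>R y j - s *\<^sub>R y i)" for y :: "'a \<Rightarrow> 'b"
    define w where "w = v(i := \<rho>, j := 0)"
    define J where "J = I - {i, j}"
    have J: "finite J" "i \<notin> J" "j \<notin> J" "I = insert i (insert j J)"
      using assms i j by (auto simp: J_def)
    have sum3r: "(\<Sum>m\<in>I. h m) = h i + h j + (\<Sum>m\<in>J. h m)" for h :: "'a \<Rightarrow> real"
      using J j by (simp add: add.assoc)
    have sum3x: "(\<Sum>m\<in>I. h m) = h i + h j + (\<Sum>m\<in>J. h m)" for h :: "'a \<Rightarrow> 'b"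
      using J j by (simp add: add.assoc)
    have S: "(\<Sum>m\<in>I. w m *\<^sub>R G x m) = (\<Sum>m\<in>I. v m *\<^sub>R x m)"
    proof -
      have "(\<Sum>m\<in>J. w m *\<^sub>R G x m) = (\<Sum>m\<in>J. v m *\<^sub>R x m)"
        using J by (intro sum.cong) (auto simp: w_def G_def)
      then show ?thesis
        unfolding sum3x using j cs by (simp add: w_def G_def scaleR_add_right)
    qed
    have w1: "(\<Sum>m\<in>I. (w m)\<^sup>2) = 1"
    proof -
      have "(\<Sum>m\<in>J. (w m)\<^sup>2) = (\<Sum>m\<in>J. (v m)\<^sup>2)"
        using J by (intro sum.cong) (auto simp: w_def)
      then show ?thesis
        using less.prems j rho unfolding sum3r by (simp add: w_def)
    qed
    have "{m \<in> I. w m \<noteq> 0} \<subset> {m \<in> I. v m \<noteq> 0}"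
      using i j by (auto simp: w_def)
    then have card: "card {m \<in> I. w m \<noteq> 0} < card {m \<in> I. v m \<noteq> 0}"
      by (intro psubset_card_mono) (use assms in auto)
    let ?T = "\<Sum>m\<in>I. v m *\<^sub>R x m"
    let ?H = "\<lambda>i. x i - (2 * v i) *\<^sub>R ?T"
    have c2: "c * (\<rho> * c) + s * (\<rho> * s) = \<rho>"
      using cs(1) by (metis distrib_left mult.left_commute mult.right_neutral power2_eq_square)
    have "gauss_mean I ?H u = gauss_mean I (G ?H) u"
      unfolding G_def using gauss_mean_rotation[OF assms(1) i(1) j(1), of c s ?H u] cs j by simp
    also have "G ?H = (\<lambda>m. G x m - (2 * w m) *\<^sub>R ?T)"
    proof
      fix m
      have "c *\<^sub>R ?H i + s *\<^sub>R ?H j = c *\<^sub>R x i + s *\<^sub>R x j - (2 * (c * (\<rho> * c) + s * (\<rho> * s))) *\<^sub>R ?T"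
        by (simp add: cs algebra_simps)
      moreover have "c *\<^sub>R ?H j - s *\<^sub>R ?H i = c *\<^sub>R x j - s *\<^sub>R x i"
        by (simp add: cs algebra_simps)
      ultimately show "G ?H m = G x m - (2 * w m) *\<^sub>R ?T"
        using j by (auto simp: G_def w_def c2)
    qed
    also have "gauss_mean I \<dots> u = gauss_mean I (G x) u"
      using less.hyps[OF card w1, of "G x"] by (simp add: S)
    also have "\<dots> = gauss_mean I x u"
      unfolding G_def using gauss_mean_rotation[OF assms(1) i(1) j(1), of c s x u] cs j by simp
    finally show ?thesis .
  qed
qed

text \<open>After a rotation the linear form \<open>a * s + b * t\<close> depends on one coordinate
  only, and the other integrates to 1. The sign of \<open>s\<close> matters for
  \<open>t = 0\<close>, where nothing is rotated and \<open>sqrt (s\<^sup>2)\<close> has to be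
  \<open>s\<close>.\<close>

lemma nn_integral_std_normal_sum:
  assumes [measurable]: "g \<in> borel_measurable borel" and "s \<ge> 0"
  shows "(\<integral>\<^sup>+a. \<integral>\<^sup>+b. g (a * s + b * t) \<partial>std_normal \<partial>std_normal) = (\<integral>\<^sup>+a. g (a * sqrt (s\<^sup>2 + t\<^sup>2)) \<partial>std_normal)"
proof (cases "t = 0")
  case True
  then show ?thesis using \<open>s \<ge> 0\<close> std_normal.emeasure_space_1 by simp
next
  case False
  define \<rho> where "\<rho> = sqrt (s\<^sup>2 + t\<^sup>2)"
  have rho: "\<rho> > 0" "\<rho>\<^sup>2 = s\<^sup>2 + t\<^sup>2"
    using False by (auto simp: \<rho>_def sum_power2_gt_zero_iff)
  have cs: "(s / \<rho>)\<^sup>2 + (- t / \<rho>)\<^sup>2 = 1" "- t / \<rho> \<noteq> 0"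
    using rho False by (auto simp: power_divide add_divide_distrib[symmetric])
  have "(\<integral>\<^sup>+a. \<integral>\<^sup>+b. g (a * s + b * t) \<partial>std_normal \<partial>std_normal)
      = (\<integral>\<^sup>+a. \<integral>\<^sup>+b. g (\<rho> * (s / \<rho> * a - (- t / \<rho>) * b)) \<partial>std_normal \<partial>std_normal)"
    using rho by (simp add: distrib_left mult.commute)
  also have "\<dots> = (\<integral>\<^sup>+a. \<integral>\<^sup>+b. g (\<rho> * a) \<partial>std_normal \<partial>(std_normal :: real measure))"
    using nn_integral_std_normal_rotation[OF _ cs, of "\<lambda>a b. g (\<rho> * a)"] by simp
  also have "\<dots> = (\<integral>\<^sup>+a. g (a * \<rho>) \<partial>std_normal)"
    using std_normal.emeasure_space_1 by (simp add: mult.commute)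
  finally show ?thesis by (simp add: \<rho>_def)
qed

text \<open>Independent Gaussian coefficients of one and the same vector combine into a single one,
  with the variances added. This is how a family indexed by a common refinement is compared with one
  indexed by a coarser partition.\<close>

lemma gauss_mean_merge:
  assumes "finite I" "\<And>i. i \<in> I \<Longrightarrow> s i \<ge> 0"
  shows "gauss_mean I (\<lambda>i. s i *\<^sub>R z (L i)) u =
    gauss_mean (L ` I) (\<lambda>c. sqrt (\<Sum>i\<in>{i \<in> I. L i = c}. (s i)\<^sup>2) *\<^sub>R z c) u"
  using assms
proof (induction I arbitrary: u)
  case empty
  then show ?case by (simp add: gauss_mean_empty)
next
  case (insert i I)
  define S where "S I c = sqrt (\<Sum>i\<in>{i \<in> I. L i = c}. (s i)\<^sup>2)" for I c
  have S_other: "S (insert i I) c = S I c" if "c \<noteq> L i" for c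
  proof -
    have "{j \<in> insert i I. L j = c} = {j \<in> I. L j = c}" using that by auto
    then show ?thesis by (simp add: S_def)
  qed
  have S_same: "S (insert i I) (L i) = sqrt ((s i)\<^sup>2 + (S I (L i))\<^sup>2)"
  proof -
    have "{j \<in> insert i I. L j = L i} = insert i {j \<in> I. L j = L i}" by auto
    then show ?thesis using insert by (simp add: S_def sum_nonneg)
  qed
  have eq: "gauss_mean (insert i I) (\<lambda>i. s i *\<^sub>R z (L i)) u
     = (\<integral>\<^sup>+a. gauss_mean (L ` I) (\<lambda>c. S I c *\<^sub>R z c) (u + a *\<^sub>R s i *\<^sub>R z (L i)) \<partial>std_normal)"
    using insert by (simp add: gauss_mean_insert S_def)
  have "\<dots> = gauss_mean (L ` insert i I) (\<lambda>c. S (insert i I) c *\<^sub>R z c) u"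
  proof (cases "L i \<in> L ` I")
    case False
    have S_eq: "S (insert i I) c = S I c" if "c \<in> L ` I" for c
      using that False S_other by metis
    have empty: "{j \<in> I. L j = L i} = {}" by (metis (mono_tags, lifting) Collect_empty_eq False imageI)
    have "S I (L i) = 0" unfolding S_def empty by simp
    then have S_i: "S (insert i I) (L i) = s i" using insert.prems unfolding S_same by simp
    have "gauss_mean (L ` insert i I) (\<lambda>c. S (insert i I) c *\<^sub>R z c) u
      = (\<integral>\<^sup>+a. gauss_mean (L ` I) (\<lambda>c. S (insert i I) c *\<^sub>R z c) (u + a *\<^sub>R s i *\<^sub>R z (L i)) \<partial>std_normal)"
      using False insert.hyps by (simp add: gauss_mean_insert S_i)
    also have "\<dots> = (\<integral>\<^sup>+a. gauss_mean (L ` I) (\<lambda>c. S I c *\<^sub>R z c) (u + a *\<^sub>R s i *\<^sub>R z (L i)) \<partial>std_normal)"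
      by (intro nn_integral_cong gauss_mean_cong) (simp_all add: S_eq)
    finally show ?thesis by simp
  next
    case True
    define K where "K = L ` I - {L i}"
    have K: "finite K" "L i \<notin> K" "L ` I = insert (L i) K"
      using insert True by (auto simp: K_def)
    have S_eq: "S (insert i I) c = S I c" if "c \<in> K" for c
      using that K(2) S_other by metis
    let ?g = "\<lambda>r. gauss_mean K (\<lambda>c. S I c *\<^sub>R z c) (u + r *\<^sub>R z (L i))"
    have "(\<integral>\<^sup>+a. gauss_mean (L ` I) (\<lambda>c. S I c *\<^sub>R z c) (u + a *\<^sub>R s i *\<^sub>R z (L i)) \<partial>std_normal)
      = (\<integral>\<^sup>+a. \<integral>\<^sup>+b. ?g (a * s i + b * S I (L i)) \<partial>std_normal \<partial>std_normal)"
      unfolding K(3) gauss_mean_insert[OF K(1,2)] by (simp add: scaleR_add_left add.assoc)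
    also have "\<dots> = (\<integral>\<^sup>+a. ?g (a * S (insert i I) (L i)) \<partial>std_normal)"
      unfolding S_same using insert
      by (intro nn_integral_std_normal_sum borel_measurable_gauss_mean_line K) auto
    also have "\<dots> = gauss_mean (insert (L i) K) (\<lambda>c. S (insert i I) c *\<^sub>R z c) u"
      unfolding gauss_mean_insert[OF K(1,2)]
      by (intro nn_integral_cong gauss_mean_cong) (simp_all add: S_eq)
    also have "insert (L i) K = L ` insert i I" using K by auto
    finally show ?thesis .
  qed
  with eq show ?case by (simp add: S_def)
qed

lemma gauss_mean_reindex:
  assumes "finite I" "inj_on h I"
  shows "gauss_mean (h ` I) x u = gauss_mean I (\<lambda>i. x (h i)) u"
  using assms
proof (induction I arbitrary: u)
  case (insert i I)
  then show ?case by (subst image_insert) (simp add: gauss_mean_insert)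
qed (simp add: gauss_mean_empty)

section \<open>Convexity, monotonicity and finiteness of Gaussian means\<close>

lemma gauss_mean_uminus:
  assumes "finite I"
  shows "gauss_mean I (\<lambda>i. - x i) u = gauss_mean I x u"
  using gauss_mean_sign[OF assms, of "\<lambda>_. -1" x u] by simp

lemma gauss_mean_scale:
  assumes "finite I"
  shows "gauss_mean I (\<lambda>i. c *\<^sub>R x i) (c *\<^sub>R u) = ennreal (c\<^sup>2) * gauss_mean I x u"
proof -
  note [measurable] = borel_measurable_gauss_integrand[OF assms, of u x]
  have "norm (c *\<^sub>R u + (\<Sum>i\<in>I. t i *\<^sub>R c *\<^sub>R x i)) = \<bar>c\<bar> * norm (u + (\<Sum>i\<in>I. t i *\<^sub>R x i))" for t
  proof -
    have "c *\<^sub>R u + (\<Sum>i\<in>I. t i *\<^sub>R c *\<^sub>R x i) = c *\<^sub>R (u + (\<Sum>i\<in>I. t i *\<^sub>R x i))"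
      by (simp add: scaleR_add_right scaleR_sum_right mult.commute)
    then show ?thesis by simp
  qed
  then show ?thesis
    unfolding gauss_mean_def
    by (subst nn_integral_cmult[symmetric]) (auto simp: power_mult_distrib ennreal_mult)
qed

lemma norm_midpoint_power2: "(norm ((1/2) *\<^sub>R (a + b)))\<^sup>2 \<le> ((norm a)\<^sup>2 + (norm b)\<^sup>2) / 2"
  for a b :: "'x::real_normed_vector"
proof -
  have "(norm (a + b))\<^sup>2 \<le> (norm a + norm b)\<^sup>2"
    by (intro power_mono norm_triangle_ineq) simp
  also have "\<dots> \<le> 2 * ((norm a)\<^sup>2 + (norm b)\<^sup>2)"
    using sum_squares_bound[of "norm a" "norm b"] by (simp add: power2_sum)
  finally show ?thesis by (simp add: power_divide)
qed

text \<open>Convexity of the squared norm, integrated. The factor 2 stands on the left to avoid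
  halving in \<open>ennreal\<close>.\<close>

lemma gauss_mean_midpoint:
  assumes "finite I"
  shows "2 * gauss_mean I (\<lambda>i. (1/2) *\<^sub>R (x i + y i)) ((1/2) *\<^sub>R (u + v)) \<le> gauss_mean I x u + gauss_mean I y v"
proof -
  note [measurable] = borel_measurable_gauss_integrand[OF assms]
  let ?a = "\<lambda>t. u + (\<Sum>i\<in>I. t i *\<^sub>R x i)" and ?b = "\<lambda>t. v + (\<Sum>i\<in>I. t i *\<^sub>R y i)"
  have "2 * gauss_mean I (\<lambda>i. (1/2) *\<^sub>R (x i + y i)) ((1/2) *\<^sub>R (u + v)) =
      (\<integral>\<^sup>+t. 2 * ennreal ((norm ((1/2) *\<^sub>R (u + v) + (\<Sum>i\<in>I. t i *\<^sub>R (1/2) *\<^sub>R (x i + y i))))\<^sup>2) \<partial>PiM I (\<lambda>_. std_normal))"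
    unfolding gauss_mean_def
    by (intro nn_integral_cmult[symmetric] measurable_compose[OF _ measurable_ennreal] borel_measurable_power
        borel_measurable_gauss_integrand assms)
  also have "\<dots> \<le> (\<integral>\<^sup>+t. ennreal ((norm (?a t))\<^sup>2) + ennreal ((norm (?b t))\<^sup>2) \<partial>PiM I (\<lambda>_. std_normal))"
  proof (intro nn_integral_mono)
    fix t
    have "(1/2) *\<^sub>R (u + v) + (\<Sum>i\<in>I. t i *\<^sub>R (1/2) *\<^sub>R (x i + y i)) = (1/2) *\<^sub>R (?a t + ?b t)"
      by (simp add: algebra_simps scaleR_sum_right sum.distrib)
    then have *: "2 * (norm ((1/2) *\<^sub>R (u + v) + (\<Sum>i\<in>I. t i *\<^sub>R (1/2) *\<^sub>R (x i + y i))))\<^sup>2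
      \<le> (norm (?a t))\<^sup>2 + (norm (?b t))\<^sup>2"
      using norm_midpoint_power2[of "?a t" "?b t"] by simp
    have "2 * ennreal r = ennreal (2 * r)" for r
      by (subst ennreal_mult') auto
    then show "2 * ennreal ((norm ((1/2) *\<^sub>R (u + v) + (\<Sum>i\<in>I. t i *\<^sub>R (1/2) *\<^sub>R (x i + y i))))\<^sup>2)
      \<le> ennreal ((norm (?a t))\<^sup>2) + ennreal ((norm (?b t))\<^sup>2)"
      using * by (simp add: ennreal_plus[symmetric] ennreal_leI del: ennreal_plus)
  qed
  also have "\<dots> = gauss_mean I x u + gauss_mean I y v"
    unfolding gauss_mean_def by (subst nn_integral_add) auto
  finally show ?thesis .
qed

lemma ennreal_double_le_cancel: "2 * a \<le> 2 * b \<Longrightarrow> a \<le> (b :: ennreal)"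
  by (subst (asm) ennreal_mult_le_mult_iff) auto

text \<open>Deleting the term \<open>i\<close> gives the midpoint of the families with
  \<open>x i\<close> and with \<open>- x i\<close>, whose Gaussian means agree by symmetry.\<close>

lemma gauss_mean_mono:
  assumes "finite I" "J \<subseteq> I"
  shows "gauss_mean J x u \<le> gauss_mean I x u"
proof -
  have ins: "gauss_mean K x u \<le> gauss_mean (insert i K) x u" if K: "finite K" "i \<notin> K" for i K
  proof -
    let ?x0 = "x(i := 0)"
    have "gauss_mean K x u = gauss_mean (insert i K) ?x0 u"
      using K by (subst gauss_mean_insert_zero) (auto intro!: gauss_mean_cong)
    also have "\<dots> = gauss_mean (insert i K) (\<lambda>j. (1/2) *\<^sub>R (x j + (x(i := - x i)) j)) ((1/2) *\<^sub>R (u + u))"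
      by (intro gauss_mean_cong) (auto simp: scaleR_2[symmetric])
    finally have "2 * gauss_mean K x u \<le> gauss_mean (insert i K) x u + gauss_mean (insert i K) (x(i := - x i)) u"
      using K gauss_mean_midpoint[of "insert i K" x "x(i := - x i)" u u] by simp
    also have "\<dots> = 2 * gauss_mean (insert i K) x u"
      using gauss_mean_flip[of "insert i K" i x u] K by (simp add: mult_2)
    finally show ?thesis by (rule ennreal_double_le_cancel)
  qed
  have "gauss_mean J x u \<le> gauss_mean (J \<union> K) x u" if "finite K" "K \<inter> J = {}" for K
    using that
  proof (induction K)
    case (insert i K)
    then show ?case using ins[of "J \<union> K" i] finite_subset[OF assms(2,1)] by (auto intro: order_trans)
  qed simp
  from this[of "I - J"] assms show ?thesis by (auto simp: Un_absorb1)
qed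

lemma nn_integral_std_normal_power_even:
  "(\<integral>\<^sup>+a. ennreal (a ^ (2 * k)) \<partial>std_normal) = ennreal (fact (2 * k) / (2 ^ k * fact k))"
proof -
  have "(\<integral>\<^sup>+a. ennreal (a ^ (2 * k)) \<partial>std_normal) = (\<integral>\<^sup>+a. ennreal (std_normal_density a * a ^ (2 * k)) \<partial>lborel)"
    by (subst nn_integral_std_normal) (auto simp: ennreal_mult'[symmetric] power_mult)
  also have "\<dots> = ennreal (fact (2 * k) / (2 ^ k * fact k))"
    using std_normal_moment_even[of k]
    by (subst nn_integral_eq_integral) (auto simp: has_bochner_integral_iff power_mult)
  finally show ?thesis .
qed

lemma nn_integral_std_normal_power2: "(\<integral>\<^sup>+a. ennreal (a\<^sup>2) \<partial>std_normal) = 1"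
  using nn_integral_std_normal_power_even[of 1] by (simp add: fact_numeral)

lemma gauss_mean_single: "gauss_mean {i} x 0 = ennreal ((norm (x i))\<^sup>2)"
  by (simp add: gauss_mean_insert gauss_mean_empty power_mult_distrib ennreal_mult nn_integral_multc
       nn_integral_std_normal_power2)

text \<open>The family with offset is the midpoint of the doubled family without offset and the
  constant \<open>2 *\<^sub>R u\<close>. It serves the induction that shows finiteness.\<close>

lemma gauss_mean_offset_le:
  assumes "finite I"
  shows "gauss_mean I x u \<le> 2 * (gauss_mean I x 0 + ennreal ((norm u)\<^sup>2))"
proof -
  interpret P: prob_space "PiM I (\<lambda>_. std_normal)" by (rule prob_space_PiM_std_normal)
  have "2 * gauss_mean I (\<lambda>i. (1/2) *\<^sub>R (2 *\<^sub>R x i + 0)) ((1/2) *\<^sub>R (0 + 2 *\<^sub>R u))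
      \<le> gauss_mean I (\<lambda>i. 2 *\<^sub>R x i) 0 + gauss_mean I (\<lambda>_. 0) (2 *\<^sub>R u)"
    by (rule gauss_mean_midpoint[OF assms])
  also have "gauss_mean I (\<lambda>i. 2 *\<^sub>R x i) 0 = 4 * gauss_mean I x 0"
    using gauss_mean_scale[OF assms, of 2 x 0] by simp
  also have "gauss_mean I (\<lambda>_. 0) (2 *\<^sub>R u) = 4 * ennreal ((norm u)\<^sup>2)"
    by (simp add: gauss_mean_def P.emeasure_space_1 power_mult_distrib ennreal_mult)
  also have "4 * gauss_mean I x 0 + 4 * ennreal ((norm u)\<^sup>2) = 2 * (2 * (gauss_mean I x 0 + ennreal ((norm u)\<^sup>2)))"
    by (simp add: distrib_left mult.assoc[symmetric])
  finally show ?thesis using ennreal_double_le_cancel by simp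
qed

lemma gauss_mean_finite:
  assumes "finite I"
  shows "gauss_mean I x 0 < \<infinity>"
  using assms
proof (induction I)
  case (insert i I)
  have "gauss_mean (insert i I) x 0 \<le> (\<integral>\<^sup>+a. 2 * (gauss_mean I x 0 + ennreal (a\<^sup>2) * ennreal ((norm (x i))\<^sup>2)) \<partial>std_normal)"
    unfolding gauss_mean_insert[OF insert(1,2)]
    using gauss_mean_offset_le[OF insert(1), of x "_ *\<^sub>R x i"]
    by (intro nn_integral_mono) (simp add: power_mult_distrib ennreal_mult)
  also have "\<dots> = 2 * (gauss_mean I x 0 + ennreal ((norm (x i))\<^sup>2))"
    using std_normal.emeasure_space_1
    by (simp add: nn_integral_cmult nn_integral_add nn_integral_multc nn_integral_std_normal_power2)
  also have "\<dots> < \<infinity>"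
    using insert.IH by (simp add: ennreal_mult_less_top)
  finally show ?case .
qed (simp add: gauss_mean_empty)

section \<open>Conditional expectations on finite index sets as contractions of Gaussian
  means\<close>

definition weighted_mean :: "'i set \<Rightarrow> ('i \<Rightarrow> real) \<Rightarrow> ('i \<Rightarrow> 'l) \<Rightarrow> ('i \<Rightarrow> 'x::real_vector) \<Rightarrow> 'i \<Rightarrow> 'x" where
  "weighted_mean I w L y i =
     (\<Sum>m\<in>{m \<in> I. L m = L i}. w m *\<^sub>R y m) /\<^sub>R (\<Sum>m\<in>{m \<in> I. L m = L i}. w m)"

text \<open>The linear map here is the product of the Householder reflections along the normalized
  vectors \<open>sqrt (w i)\<close> restricted to each class of \<open>L\<close>.\<close>

lemma gauss_mean_reflection:
  assumes "finite I" "\<And>i. i \<in> I \<Longrightarrow> w i \<ge> 0"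
  shows "gauss_mean I (\<lambda>i. sqrt (w i) *\<^sub>R (y i - 2 *\<^sub>R weighted_mean I w L y i)) u
       = gauss_mean I (\<lambda>i. sqrt (w i) *\<^sub>R y i) u"
proof -
  define z where "z C i = sqrt (w i) *\<^sub>R (y i - (if L i \<in> C then 2 *\<^sub>R weighted_mean I w L y i else 0))" for C i
  have "gauss_mean I (z C) u = gauss_mean I (z {}) u" if "finite C" for C
    using that
  proof (induction C)
    case (insert c C)
    define A where "A = {m \<in> I. L m = c}"
    define W where "W = sum w A"
    have A: "finite A" "A \<subseteq> I" and w0: "\<And>m. m \<in> A \<Longrightarrow> w m \<ge> 0" using assms by (auto simp: A_def)
    have "gauss_mean I (z (insert c C)) u = gauss_mean I (z C) u"
    proof (cases "W = 0")
      case True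
      then have "w m = 0" if "m \<in> A" for m
        using that A w0 sum_nonneg_eq_0_iff[of A w] by (auto simp: W_def)
      then show ?thesis
        by (intro gauss_mean_cong) (auto simp: z_def A_def)
    next
      case False
      then have W: "W > 0" using sum_nonneg[of A w] w0 by (auto simp: W_def)
      define v where "v m = (if L m = c then sqrt (w m) / sqrt W else 0)" for m
      have sumI: "(\<Sum>m\<in>I. (if L m = c then h m else 0)) = (\<Sum>m\<in>A. h m)" for h :: "'a \<Rightarrow> real"
        using assms(1) unfolding A_def by (simp add: sum.inter_filter)
      have sumX: "(\<Sum>m\<in>I. (if L m = c then h m else 0)) = (\<Sum>m\<in>A. h m)" for h :: "'a \<Rightarrow> 'b"
        using assms(1) unfolding A_def by (simp add: sum.inter_filter)
      have "(\<Sum>m\<in>I. (v m)\<^sup>2) = (\<Sum>m\<in>I. if L m = c then w m / W else 0)"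
        using assms(2) W by (intro sum.cong) (auto simp: v_def power_divide)
      also have "\<dots> = 1"
        using W by (simp add: sumI W_def[symmetric] sum_divide_distrib[symmetric])
      finally have v1: "(\<Sum>m\<in>I. (v m)\<^sup>2) = 1" .
      have "(\<Sum>m\<in>I. v m *\<^sub>R z C m) = (\<Sum>m\<in>I. if L m = c then (1 / sqrt W) *\<^sub>R (w m *\<^sub>R y m) else 0)"
        using insert assms(2) by (intro sum.cong) (auto simp: v_def z_def)
      also have "\<dots> = (1 / sqrt W) *\<^sub>R (\<Sum>m\<in>A. w m *\<^sub>R y m)"
        by (simp add: sumX scaleR_sum_right)
      finally have S: "(\<Sum>m\<in>I. v m *\<^sub>R z C m) = (1 / sqrt W) *\<^sub>R (\<Sum>m\<in>A. w m *\<^sub>R y m)" .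
      have "z (insert c C) i = z C i - (2 * v i) *\<^sub>R (\<Sum>m\<in>I. v m *\<^sub>R z C m)" for i
      proof (cases "L i = c")
        case True
        then have "weighted_mean I w L y i = (1 / W) *\<^sub>R (\<Sum>m\<in>A. w m *\<^sub>R y m)"
          by (simp add: weighted_mean_def A_def W_def divide_inverse)
        moreover have "sqrt W * sqrt W = W" using W by simp
        ultimately show ?thesis using True insert(2) unfolding S
          by (simp add: z_def v_def algebra_simps)
      next
        case False
        then show ?thesis by (simp add: z_def v_def)
      qed
      then show ?thesis
        using gauss_mean_householder[OF assms(1) v1, of "z C" u] by (simp cong: gauss_mean_cong)
    qed
    then show ?case using insert by simp
  qed simp
  from this[of "L ` I"] assms(1) show ?thesis
    by (simp add: z_def cong: gauss_mean_cong)
qed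

text \<open>The conditional expectation given \<open>L\<close> is the midpoint of the identity and
  minus the reflection of the preceding lemma, and both of these give the same Gaussian
  mean.\<close>

lemma gauss_mean_weighted_mean_le:
  assumes "finite I" "\<And>i. i \<in> I \<Longrightarrow> w i \<ge> 0"
  shows "gauss_mean I (\<lambda>i. sqrt (w i) *\<^sub>R weighted_mean I w L y i) 0 \<le> gauss_mean I (\<lambda>i. sqrt (w i) *\<^sub>R y i) 0"
proof -
  let ?E = "weighted_mean I w L y"
  let ?y = "\<lambda>i. sqrt (w i) *\<^sub>R y i"
  let ?r = "\<lambda>i. - (sqrt (w i) *\<^sub>R (y i - 2 *\<^sub>R ?E i))"
  have "gauss_mean I (\<lambda>i. sqrt (w i) *\<^sub>R ?E i) 0 = gauss_mean I (\<lambda>i. (1/2) *\<^sub>R (?y i + ?r i)) ((1/2) *\<^sub>R (0 + 0))"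
    by (intro gauss_mean_cong) (auto simp: algebra_simps)
  then have "2 * gauss_mean I (\<lambda>i. sqrt (w i) *\<^sub>R ?E i) 0 \<le> gauss_mean I ?y 0 + gauss_mean I ?r 0"
    using gauss_mean_midpoint[OF assms(1), of ?y ?r 0 0] by (simp only:)
  moreover have "gauss_mean I ?r 0 = gauss_mean I ?y 0"
    using assms by (subst gauss_mean_uminus) (auto intro!: gauss_mean_reflection)
  ultimately have "2 * gauss_mean I (\<lambda>i. sqrt (w i) *\<^sub>R ?E i) 0 \<le> 2 * gauss_mean I ?y 0"
    unfolding mult_2[of "gauss_mean I ?y 0"] by metis
  then show ?thesis by (rule ennreal_double_le_cancel)
qed

section \<open>Cotype 2 and martingale differences\<close>

lemma nn_integral_indep_vars:
  assumes "prob_space P" "prob_space.indep_vars P (\<lambda>_. borel) X UNIV" "finite I"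
    and f[measurable]: "f \<in> borel_measurable (PiM I (\<lambda>_. borel :: real measure))"
  shows "(\<integral>\<^sup>+\<omega>. f (\<lambda>i\<in>I. X i \<omega>) \<partial>P) = (\<integral>\<^sup>+t. f t \<partial>PiM I (\<lambda>i. distr P borel (X i)))"
proof -
  interpret prob_space P by fact
  have rv[measurable]: "X i \<in> borel_measurable P" for i
    using assms(2) by (simp add: indep_vars_def)
  show ?thesis
  proof (cases "I = {}")
    case True
    then show ?thesis
      by (simp add: PiM_empty nn_integral_count_space_finite emeasure_space_1 restrict_def)
  next
    case False
    have "indep_vars (\<lambda>_. borel) X I" using assms(2) by (rule indep_vars_subset) simp
    then have *: "distr P (PiM I (\<lambda>_. borel)) (\<lambda>\<omega>. \<lambda>i\<in>I. X i \<omega>) = PiM I (\<lambda>i. distr P borel (X i))"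
      using indep_vars_iff_distr_eq_PiM[OF False rv] by simp
    show ?thesis
      unfolding *[symmetric] by (subst nn_integral_distr) auto
  qed
qed

lemma nn_integral_norm_indep_vars:
  fixes x :: "nat \<Rightarrow> 'x::real_normed_vector"
  assumes "prob_space P" "prob_space.indep_vars P (\<lambda>_. borel) X UNIV" "finite I"
  shows "(\<integral>\<^sup>+\<omega>. ennreal ((norm (\<Sum>i\<in>I. X i \<omega> *\<^sub>R x i))\<^sup>2) \<partial>P)
       = (\<integral>\<^sup>+t. ennreal ((norm (\<Sum>i\<in>I. t i *\<^sub>R x i))\<^sup>2) \<partial>PiM I (\<lambda>i. distr P borel (X i)))"
proof -
  have "(\<lambda>t. norm (0 + (\<Sum>i\<in>I. t i *\<^sub>R x i))) \<in> borel_measurable (PiM I (\<lambda>_. borel :: real measure))"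
    by (rule borel_measurable_norm_lincomb[OF assms(3)]) auto
  then have "(\<lambda>t. ennreal ((norm (\<Sum>i\<in>I. t i *\<^sub>R x i))\<^sup>2)) \<in> borel_measurable (PiM I (\<lambda>_. borel :: real measure))"
    by simp
  from nn_integral_indep_vars[OF assms this] show ?thesis
    by simp
qed

lemma gaussian_sequence_mean:
  assumes "gaussian_sequence P \<gamma>" "finite I"
  shows "(\<integral>\<^sup>+\<omega>. ennreal ((norm (\<Sum>i\<in>I. \<gamma> i \<omega> *\<^sub>R x i))\<^sup>2) \<partial>P) = gauss_mean I x 0"
proof -
  have "distr P borel (\<gamma> i) = std_normal" for i
  proof -
    have "distr P borel (\<gamma> i) = distr P lborel (\<gamma> i)" by (rule distr_cong) auto
    also have "\<dots> = std_normal"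
      using assms(1) distributed_distr_eq_density[of P lborel "\<gamma> i"] by (simp add: gaussian_sequence_def)
    finally show ?thesis .
  qed
  then show ?thesis
    using nn_integral_norm_indep_vars[of P \<gamma> I x] assms by (simp add: gaussian_sequence_def gauss_mean_def)
qed

lemma gaussian_sequence_measurable:
  "gaussian_sequence P \<gamma> \<Longrightarrow> \<gamma> i \<in> borel_measurable P"
  by (auto simp: gaussian_sequence_def distributed_def)

lemma gaussian_sequence_integral:
  assumes "gaussian_sequence P \<gamma>"
  shows "ennreal (\<integral>\<omega>. (norm (\<Sum>n<N. \<gamma> n \<omega> *\<^sub>R x n))\<^sup>2 \<partial>P) = gauss_mean {..<N} x 0"
proof -
  have "(\<lambda>\<omega>. norm (0 + (\<Sum>n<N. \<gamma> n \<omega> *\<^sub>R x n))) \<in> borel_measurable P"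
    by (rule borel_measurable_norm_lincomb) (auto intro: gaussian_sequence_measurable[OF assms])
  then have "(\<integral>\<omega>. (norm (\<Sum>n<N. \<gamma> n \<omega> *\<^sub>R x n))\<^sup>2 \<partial>P) = enn2real (gauss_mean {..<N} x 0)"
    by (subst integral_eq_nn_integral) (auto simp: gaussian_sequence_mean[OF assms])
  then show ?thesis
    using gauss_mean_finite[of "{..<N}" x] by simp
qed

lemma ennreal_sqrt_le_iff: "0 \<le> a \<Longrightarrow> 0 \<le> B \<Longrightarrow> ennreal (sqrt a) \<le> ennreal B \<longleftrightarrow> ennreal a \<le> ennreal (B\<^sup>2)"
  by (simp add: real_sqrt_le_iff' real_le_rsqrt sqrt_le_D real_le_lsqrt)

lemma gamma_variation_le_iff:
  assumes "gaussian_sequence P \<gamma>" "0 \<le> B"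
  shows "gamma_variation P \<gamma> M F \<le> ennreal B \<longleftrightarrow>
    (\<forall>(N :: nat) A. disjoint_family_on A {..<N} \<longrightarrow> (\<forall>n<N. A n \<in> sets M \<and> measure M (A n) > 0) \<longrightarrow>
      gauss_mean {..<N} (\<lambda>n. F (A n) /\<^sub>R sqrt (measure M (A n))) 0 \<le> ennreal (B\<^sup>2))"
proof -
  have *: "ennreal (sqrt (\<integral>\<omega>. (norm (\<Sum>n<N. \<gamma> n \<omega> *\<^sub>R x n))\<^sup>2 \<partial>P)) \<le> ennreal B \<longleftrightarrow>
      gauss_mean {..<N} x 0 \<le> ennreal (B\<^sup>2)" for N and x :: "nat \<Rightarrow> 'c"
    by (subst ennreal_sqrt_le_iff) (use assms in \<open>auto simp: gaussian_sequence_integral\<close>)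
  show ?thesis
    unfolding gamma_variation_def SUP_le_iff Ball_def split_paired_All mem_Collect_eq prod.case * imp_conjL by (rule refl)
qed

section \<open>Rademacher means and the cotype inequality in \<open>ennreal\<close>\<close>

lemma rademacher_sequence_AE:
  assumes "rademacher_sequence Q r"
  shows "AE \<omega> in Q. \<forall>n. r n \<omega> \<in> {1, -1}"
proof -
  interpret prob_space Q using assms by (simp add: rademacher_sequence_def)
  have [measurable]: "r n \<in> borel_measurable Q" for n
    using assms by (simp add: rademacher_sequence_def indep_vars_def)
  have "AE \<omega> in Q. r n \<omega> \<in> {1, -1}" for n
  proof -
    have "prob ({\<omega> \<in> space Q. r n \<omega> = 1} \<union> {\<omega> \<in> space Q. r n \<omega> = -1})
        = prob {\<omega> \<in> space Q. r n \<omega> = 1} + prob {\<omega> \<in> space Q. r n \<omega> = -1}"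
      by (rule finite_measure_Union) auto
    also have "\<dots> = 1 / 2 + 1 / 2" using assms unfolding rademacher_sequence_def by metis
    finally have "prob ({\<omega> \<in> space Q. r n \<omega> = 1} \<union> {\<omega> \<in> space Q. r n \<omega> = -1}) = 1" by simp
    then have "AE \<omega> in Q. \<omega> \<in> {\<omega> \<in> space Q. r n \<omega> = 1} \<union> {\<omega> \<in> space Q. r n \<omega> = -1}"
      by (subst (asm) prob_eq_1) auto
    then show ?thesis by eventually_elim auto
  qed
  then show ?thesis by (simp add: AE_all_countable)
qed

lemma rademacher_sequence_measurable:
  assumes "rademacher_sequence Q r"
  shows "r n \<in> borel_measurable Q"
proof -
  interpret prob_space Q using assms by (simp add: rademacher_sequence_def)
  show ?thesis using assms by (simp add: rademacher_sequence_def indep_vars_def)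
qed

definition rademacher_mean :: "'v measure \<Rightarrow> (nat \<Rightarrow> 'v \<Rightarrow> real) \<Rightarrow> nat \<Rightarrow> (nat \<Rightarrow> 'x::real_normed_vector) \<Rightarrow> ennreal" where
  "rademacher_mean Q r N x = (\<integral>\<^sup>+\<omega>. ennreal ((norm (\<Sum>n<N. r n \<omega> *\<^sub>R x n))\<^sup>2) \<partial>Q)"

lemma borel_measurable_rademacher_integrand:
  assumes "rademacher_sequence Q r"
  shows "(\<lambda>\<omega>. norm (\<Sum>n<N. r n \<omega> *\<^sub>R x n)) \<in> borel_measurable Q"
  using borel_measurable_norm_lincomb[of "{..<N}" r Q 0 x] rademacher_sequence_measurable[OF assms] by simp

lemma rademacher_mean_finite:
  assumes "rademacher_sequence Q r"
  shows "rademacher_mean Q r N x < \<infinity>"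
proof -
  interpret prob_space Q using assms by (simp add: rademacher_sequence_def)
  have "AE \<omega> in Q. ennreal ((norm (\<Sum>n<N. r n \<omega> *\<^sub>R x n))\<^sup>2) \<le> ennreal ((\<Sum>n<N. norm (x n))\<^sup>2)"
    using rademacher_sequence_AE[OF assms]
  proof eventually_elim
    case (elim \<omega>)
    then have "norm (\<Sum>n<N. r n \<omega> *\<^sub>R x n) \<le> (\<Sum>n<N. norm (x n))"
      by (intro sum_norm_le) (auto, metis abs_1 abs_minus_cancel mult_1 order_refl)
    then show ?case by (intro ennreal_leI power_mono) auto
  qed
  then have "rademacher_mean Q r N x \<le> (\<integral>\<^sup>+\<omega>. ennreal ((\<Sum>n<N. norm (x n))\<^sup>2) \<partial>Q)"
    unfolding rademacher_mean_def by (rule nn_integral_mono_AE)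
  also have "\<dots> < \<infinity>" by (simp add: emeasure_space_1)
  finally show ?thesis .
qed

lemma cotype2_constant_iff:
  assumes "rademacher_sequence Q r"
  shows "cotype2_constant Q r TYPE('x::real_normed_vector) C \<longleftrightarrow> 0 \<le> C \<and>
    (\<forall>N (x :: nat \<Rightarrow> 'x). ennreal (\<Sum>n<N. (norm (x n))\<^sup>2) \<le> ennreal (C\<^sup>2) * rademacher_mean Q r N x)"
proof -
  have "(\<Sum>n<N. (norm (x n))\<^sup>2) \<le> C\<^sup>2 * (\<integral>\<omega>. (norm (\<Sum>n<N. r n \<omega> *\<^sub>R x n))\<^sup>2 \<partial>Q) \<longleftrightarrow>
     ennreal (\<Sum>n<N. (norm (x n))\<^sup>2) \<le> ennreal (C\<^sup>2) * rademacher_mean Q r N x" for N and x :: "nat \<Rightarrow> 'x"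
  proof -
    have "(\<integral>\<omega>. (norm (\<Sum>n<N. r n \<omega> *\<^sub>R x n))\<^sup>2 \<partial>Q) = enn2real (rademacher_mean Q r N x)"
      unfolding rademacher_mean_def using borel_measurable_rademacher_integrand[OF assms, of x N]
      by (subst integral_eq_nn_integral) auto
    moreover have "rademacher_mean Q r N x = ennreal (enn2real (rademacher_mean Q r N x))"
      using rademacher_mean_finite[OF assms, of N x] by simp
    then have "ennreal (C\<^sup>2) * rademacher_mean Q r N x = ennreal (C\<^sup>2 * enn2real (rademacher_mean Q r N x))"
      by (metis ennreal_mult' zero_le_power2)
    ultimately show ?thesis by simp
  qed
  then show ?thesis by (simp add: cotype2_constant_def)
qed

text \<open>For a fixed point \<open>t\<close> of the Gaussian space, cotype 2 is applied to the
  vectors \<open>\<Sum>i\<in>I. t i *\<^sub>R z k i\<close>. After the integrals are exchanged, each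
  sign pattern contributes a Gaussian mean that \<open>B\<close> bounds.\<close>

lemma sum_gauss_mean_le_cotype:
  fixes z :: "nat \<Rightarrow> 'i \<Rightarrow> 'x::real_normed_vector"
  assumes r: "rademacher_sequence Q r" and C: "cotype2_constant Q r TYPE('x) C" and "finite I"
    and B: "\<And>e. (\<And>k. e k \<in> {1, -1}) \<Longrightarrow> gauss_mean I (\<lambda>i. \<Sum>k<K. e k *\<^sub>R z k i) 0 \<le> B"
  shows "(\<Sum>k<K. gauss_mean I (z k) 0) \<le> ennreal (C\<^sup>2) * B"
proof -
  interpret Q: prob_space Q using r by (simp add: rademacher_sequence_def)
  let ?G = "PiM I (\<lambda>_. std_normal)"
  interpret G: prob_space ?G by (rule prob_space_PiM_std_normal)
  interpret GQ: pair_sigma_finite ?G Q ..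
  let ?Z = "\<lambda>t k. \<Sum>i\<in>I. t i *\<^sub>R z k i"
  have swap: "(\<Sum>k<K. e k *\<^sub>R ?Z t k) = (\<Sum>i\<in>I. t i *\<^sub>R (\<Sum>k<K. e k *\<^sub>R z k i))" for e :: "nat \<Rightarrow> real" and t
    by (subst (2) scaleR_sum_right) (simp add: scaleR_sum_right sum.swap[of _ I] mult.commute)
  have [measurable]: "(\<lambda>t. norm (?Z t k)) \<in> borel_measurable ?G" for k
    using borel_measurable_gauss_integrand[OF assms(3), of 0 "z k"] by simp
  have "(\<lambda>p. norm (0 + (\<Sum>ki\<in>{..<K} \<times> I. (r (fst ki) (snd p) * fst p (snd ki)) *\<^sub>R z (fst ki) (snd ki)))) \<in> borel_measurable (?G \<Otimes>\<^sub>M Q)"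
    using assms(3)
    by (intro borel_measurable_norm_lincomb borel_measurable_times
         measurable_compose[OF measurable_snd rademacher_sequence_measurable[OF r]]
         measurable_compose[OF measurable_fst measurable_PiM_std_normal_component]) auto
  moreover have "(\<Sum>ki\<in>{..<K} \<times> I. (r (fst ki) (snd p) * fst p (snd ki)) *\<^sub>R z (fst ki) (snd ki)) =
      (\<Sum>k<K. r k (snd p) *\<^sub>R ?Z (fst p) k)" for p
    by (simp add: sum.cartesian_product[symmetric] split_beta' scaleR_sum_right)
       (simp add: sum.cartesian_product split_beta')
  ultimately have m: "(\<lambda>(t, \<omega>). ennreal ((norm (\<Sum>k<K. r k \<omega> *\<^sub>R ?Z t k))\<^sup>2)) \<in> borel_measurable (?G \<Otimes>\<^sub>M Q)"
    by (simp add: split_beta')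
  have "(\<Sum>k<K. gauss_mean I (z k) 0) = (\<integral>\<^sup>+t. (\<Sum>k<K. ennreal ((norm (?Z t k))\<^sup>2)) \<partial>?G)"
    unfolding gauss_mean_def by (subst nn_integral_sum) auto
  also have "\<dots> \<le> (\<integral>\<^sup>+t. ennreal (C\<^sup>2) * (\<integral>\<^sup>+\<omega>. ennreal ((norm (\<Sum>k<K. r k \<omega> *\<^sub>R ?Z t k))\<^sup>2) \<partial>Q) \<partial>?G)"
    using C unfolding cotype2_constant_iff[OF r] rademacher_mean_def
    by (intro nn_integral_mono) (auto simp: sum_ennreal)
  also have "\<dots> = ennreal (C\<^sup>2) * (\<integral>\<^sup>+t. \<integral>\<^sup>+\<omega>. ennreal ((norm (\<Sum>k<K. r k \<omega> *\<^sub>R ?Z t k))\<^sup>2) \<partial>Q \<partial>?G)"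
    using Q.borel_measurable_nn_integral[OF m] by (subst nn_integral_cmult) auto
  also have "(\<integral>\<^sup>+t. \<integral>\<^sup>+\<omega>. ennreal ((norm (\<Sum>k<K. r k \<omega> *\<^sub>R ?Z t k))\<^sup>2) \<partial>Q \<partial>?G)
      = (\<integral>\<^sup>+\<omega>. \<integral>\<^sup>+t. ennreal ((norm (\<Sum>k<K. r k \<omega> *\<^sub>R ?Z t k))\<^sup>2) \<partial>?G \<partial>Q)"
    by (rule GQ.Fubini'[symmetric]) (use m in simp)
  also have "\<dots> = (\<integral>\<^sup>+\<omega>. gauss_mean I (\<lambda>i. \<Sum>k<K. r k \<omega> *\<^sub>R z k i) 0 \<partial>Q)"
    by (simp add: gauss_mean_def swap)
  also have "ennreal (C\<^sup>2) * \<dots> \<le> ennreal (C\<^sup>2) * (\<integral>\<^sup>+\<omega>. B \<partial>Q)"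
    using rademacher_sequence_AE[OF r]
    by (intro mult_left_mono nn_integral_mono_AE) (auto elim!: eventually_mono intro!: B)
  also have "\<dots> = ennreal (C\<^sup>2) * B" by (simp add: Q.emeasure_space_1)
  finally show ?thesis .
qed

text \<open>The previous lemma is used with \<open>x k\<close> as the only nonzero vector of the
  k-th family. The signs then multiply single vectors and are absorbed by the symmetry of the
  Gaussian variables, so the cotype constant does not change.\<close>

lemma cotype2_gauss_mean:
  fixes x :: "'i \<Rightarrow> 'x::real_normed_vector"
  assumes r: "rademacher_sequence Q r" and C: "cotype2_constant Q r TYPE('x) C" and "finite I"
  shows "ennreal (\<Sum>i\<in>I. (norm (x i))\<^sup>2) \<le> ennreal (C\<^sup>2) * gauss_mean I x 0"
proof -
  obtain h where h: "bij_betw h {..<card I} I"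
    using ex_bij_betw_nat_finite[OF assms(3)] by (auto simp: atLeast0LessThan)
  define y where "y = x \<circ> h"
  let ?N = "card I"
  have "ennreal (\<Sum>i\<in>I. (norm (x i))\<^sup>2) = ennreal (\<Sum>k<?N. (norm (y k))\<^sup>2)"
    by (subst sum.reindex_bij_betw[OF h, symmetric]) (simp add: y_def)
  also have "\<dots> = (\<Sum>k<?N. gauss_mean {k} (\<lambda>i. if i = k then y k else 0) 0)"
    by (simp add: gauss_mean_single sum_ennreal)
  also have "\<dots> \<le> (\<Sum>k<?N. gauss_mean {..<?N} (\<lambda>i. if i = k then y k else 0) 0)"
    by (intro sum_mono gauss_mean_mono) auto
  also have "\<dots> \<le> ennreal (C\<^sup>2) * gauss_mean {..<?N} y 0"
  proof (rule sum_gauss_mean_le_cotype[OF r C])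
    fix e :: "nat \<Rightarrow> real" assume "\<And>k. e k \<in> {1, -1}"
    then have "gauss_mean {..<?N} (\<lambda>i. e i *\<^sub>R y i) 0 = gauss_mean {..<?N} y 0"
      by (intro gauss_mean_sign) auto
    moreover have "gauss_mean {..<?N} (\<lambda>i. \<Sum>k<?N. e k *\<^sub>R (if i = k then y k else 0)) 0
        = gauss_mean {..<?N} (\<lambda>i. e i *\<^sub>R y i) 0"
      by (intro gauss_mean_cong) (auto simp: if_distrib[of "\<lambda>z. _ *\<^sub>R z"] cong: if_cong)
    ultimately show "gauss_mean {..<?N} (\<lambda>i. \<Sum>k<?N. e k *\<^sub>R (if i = k then y k else 0)) 0
        \<le> gauss_mean {..<?N} y 0" by simp
  qed simp
  also have "gauss_mean {..<?N} y 0 = gauss_mean I x 0"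
    using gauss_mean_reindex[of "{..<?N}" h x 0] h by (simp add: y_def bij_betw_def comp_def)
  finally show ?thesis .
qed

text \<open>The reflection associated with \<open>L j\<close> flips the signs of exactly the differences \<open>d k\<close> with
  \<open>k > j\<close>, up to a global sign, and these sign changes generate all others.\<close>

lemma gauss_mean_martingale_signs:
  fixes d :: "nat \<Rightarrow> 'i \<Rightarrow> 'x::real_normed_vector"
  assumes "finite I" and w: "\<And>i. i \<in> I \<Longrightarrow> w i \<ge> 0"
    and const: "\<And>k j i m. k \<le> j \<Longrightarrow> i \<in> I \<Longrightarrow> m \<in> I \<Longrightarrow> L j i = L j m \<Longrightarrow> d k i = d k m"
    and zero: "\<And>k j c. j < k \<Longrightarrow> k < K \<Longrightarrow> (\<Sum>m\<in>{m \<in> I. L j m = c}. w m *\<^sub>R d k m) = 0"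
    and e: "\<And>k. e k \<in> {1, -1 :: real}"
  shows "gauss_mean I (\<lambda>i. sqrt (w i) *\<^sub>R (\<Sum>k<K. e k *\<^sub>R d k i)) 0 = gauss_mean I (\<lambda>i. sqrt (w i) *\<^sub>R (\<Sum>k<K. d k i)) 0"
proof -
  let ?g = "\<lambda>e. gauss_mean I (\<lambda>i. sqrt (w i) *\<^sub>R (\<Sum>k<K. e k *\<^sub>R d k i)) 0"
  have uminus: "?g (\<lambda>k. - e k) = ?g e" for e
    using gauss_mean_uminus[OF assms(1), of "\<lambda>i. sqrt (w i) *\<^sub>R (\<Sum>k<K. e k *\<^sub>R d k i)" 0]
    by (simp add: sum_negf)
  have "?g e = ?g (\<lambda>_. 1)" if "\<And>k. e k \<in> {1, -1 :: real}" "\<And>k. k \<ge> j \<Longrightarrow> e k = e j" for e j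
    using that
  proof (induction j arbitrary: e)
    case 0
    then have "e = (\<lambda>_. 1) \<or> e = (\<lambda>_. - 1)"
      by (metis (no_types, lifting) ext insertE le0 singletonD)
    then show ?case using uminus[of "\<lambda>_. 1"] by auto
  next
    case (Suc j)
    show ?case
    proof (cases "e j = e (Suc j)")
      case True
      have "e k = e j" if "k \<ge> j" for k
        using Suc.prems(2)[of k] that True by (cases "k = j") auto
      then show ?thesis using Suc by blast
    next
      case False
      \<comment> \<open>Flipping the tail after \<open>j\<close> removes the sign change between
        \<open>j\<close> and \<open>Suc j\<close>. So \<open>f\<close> is constant from
        \<open>j\<close> on and the induction hypothesis applies to it.\<close>
      define f where "f k = (if k \<le> j then e k else - e k)" for k
      have f: "f k \<in> {1, -1}" for k using Suc.prems(1)[of k] by (auto simp: f_def)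
      have "f k = f j" if "k \<ge> j" for k
        using Suc.prems(2)[of k] that False Suc.prems(1)[of j] Suc.prems(1)[of "Suc j"]
        by (cases "k = j") (auto simp: f_def)
      then have IH: "?g f = ?g (\<lambda>_. 1)" using Suc.IH f by blast
      let ?y = "\<lambda>i. \<Sum>k<K. f k *\<^sub>R d k i"
      have "sqrt (w i) *\<^sub>R (?y i - 2 *\<^sub>R weighted_mean I w (L j) ?y i) = - (sqrt (w i) *\<^sub>R (\<Sum>k<K. e k *\<^sub>R d k i))"
        if i: "i \<in> I" for i
      proof -
        define A where "A = {m \<in> I. L j m = L j i}"
        define W where "W = sum w A"
        have A: "finite A" "i \<in> A" "\<And>m. m \<in> A \<Longrightarrow> w m \<ge> 0" using assms(1) w i by (auto simp: A_def)
        show ?thesis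
        proof (cases "W = 0")
          case True
          then have "w i = 0" using A sum_nonneg_eq_0_iff[of A w] by (auto simp: W_def)
          then show ?thesis by simp
        next
          case False
          have "(\<Sum>m\<in>A. w m *\<^sub>R ?y m) = (\<Sum>k<K. f k *\<^sub>R (\<Sum>m\<in>A. w m *\<^sub>R d k m))"
            by (simp add: scaleR_sum_right sum.swap[of _ A] mult.commute)
          also have "\<dots> = (\<Sum>k<K. W *\<^sub>R (if k \<le> j then f k *\<^sub>R d k i else 0))"
          proof (intro sum.cong refl)
            fix k assume "k \<in> {..<K}"
            show "f k *\<^sub>R (\<Sum>m\<in>A. w m *\<^sub>R d k m) = W *\<^sub>R (if k \<le> j then f k *\<^sub>R d k i else 0)"
            proof (cases "k \<le> j")
              case True
              then have "(\<Sum>m\<in>A. w m *\<^sub>R d k m) = (\<Sum>m\<in>A. w m *\<^sub>R d k i)"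
                using i by (intro sum.cong refl arg_cong2[where f = scaleR] const[of k j]) (auto simp: A_def)
              then show ?thesis using True by (simp add: W_def scaleR_sum_left[symmetric] mult.commute)
            next
              case False
              then show ?thesis using zero[of j k "L j i"] \<open>k \<in> {..<K}\<close> by (simp add: A_def)
            qed
          qed
          \<comment> \<open>Averaging over the cells of \<open>L j\<close> keeps the differences up
            to \<open>j\<close>, which are constant there, and kills the later ones.\<close>
          finally have "weighted_mean I w (L j) ?y i = (\<Sum>k<K. if k \<le> j then f k *\<^sub>R d k i else 0)"
            using False by (simp add: weighted_mean_def A_def[symmetric] W_def[symmetric] scaleR_sum_right[symmetric])
          then have "?y i - 2 *\<^sub>R weighted_mean I w (L j) ?y i
              = (\<Sum>k<K. f k *\<^sub>R d k i - 2 *\<^sub>R (if k \<le> j then f k *\<^sub>R d k i else 0))"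
            by (simp add: scaleR_sum_right sum_subtractf)
          also have "\<dots> = (\<Sum>k<K. - (e k *\<^sub>R d k i))"
            by (intro sum.cong) (auto simp: f_def scaleR_2)
          finally show ?thesis by (simp add: sum_negf)
        qed
      qed
      then have "gauss_mean I (\<lambda>i. sqrt (w i) *\<^sub>R (?y i - 2 *\<^sub>R weighted_mean I w (L j) ?y i)) 0
          = gauss_mean I (\<lambda>i. - (sqrt (w i) *\<^sub>R (\<Sum>k<K. e k *\<^sub>R d k i))) 0"
        by (intro gauss_mean_cong) auto
      then have "?g f = ?g e"
        using gauss_mean_reflection[OF assms(1) w, where y = ?y and L = "L j" and u = 0] gauss_mean_uminus[OF assms(1)] by simp
      then show ?thesis using IH by simp
    qed
  qed
  note * = this
  \<comment> \<open>Signs from \<open>K\<close> on do not enter the sum. Setting them to 1 makes the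
    sequence constant from \<open>K\<close> on, as the induction demands.\<close>
  define e' where "e' k = (if k < K then e k else 1)" for k
  have "?g e = ?g e'" by (intro gauss_mean_cong) (auto simp: e'_def)
  also have "\<dots> = ?g (\<lambda>_. 1)" by (rule *[of _ K]) (use e in \<open>auto simp: e'_def\<close>)
  finally show ?thesis by simp
qed

text \<open>The first use of cotype 2 is over the cells, for each difference separately; the second
  is over the differences, whose signs do not affect the Gaussian mean of the sum. Each use costs a
  factor \<open>C\<^sup>2\<close>.\<close>

lemma martingale_differences_cotype:
  fixes d :: "nat \<Rightarrow> 'i \<Rightarrow> 'x::real_normed_vector"
  assumes r: "rademacher_sequence Q r" and C: "cotype2_constant Q r TYPE('x) C"
    and "finite I" and w: "\<And>i. i \<in> I \<Longrightarrow> w i \<ge> 0"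
    and const: "\<And>k j i m. k \<le> j \<Longrightarrow> i \<in> I \<Longrightarrow> m \<in> I \<Longrightarrow> L j i = L j m \<Longrightarrow> d k i = d k m"
    and zero: "\<And>k j c. j < k \<Longrightarrow> k < K \<Longrightarrow> (\<Sum>m\<in>{m \<in> I. L j m = c}. w m *\<^sub>R d k m) = 0"
  shows "ennreal (\<Sum>k<K. \<Sum>i\<in>I. w i * (norm (d k i))\<^sup>2)
     \<le> ennreal (C ^ 4) * gauss_mean I (\<lambda>i. sqrt (w i) *\<^sub>R (\<Sum>k<K. d k i)) 0"
proof -
  let ?B = "gauss_mean I (\<lambda>i. sqrt (w i) *\<^sub>R (\<Sum>k<K. d k i)) 0"
  have "ennreal (\<Sum>k<K. \<Sum>i\<in>I. w i * (norm (d k i))\<^sup>2) = (\<Sum>k<K. ennreal (\<Sum>i\<in>I. (norm (sqrt (w i) *\<^sub>R d k i))\<^sup>2))"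
    using w by (subst sum_ennreal) (auto simp: power_mult_distrib intro!: sum_nonneg)
  also have "\<dots> \<le> (\<Sum>k<K. ennreal (C\<^sup>2) * gauss_mean I (\<lambda>i. sqrt (w i) *\<^sub>R d k i) 0)"
    by (intro sum_mono cotype2_gauss_mean[OF r C assms(3)])
  also have "\<dots> = ennreal (C\<^sup>2) * (\<Sum>k<K. gauss_mean I (\<lambda>i. sqrt (w i) *\<^sub>R d k i) 0)"
    by (simp add: sum_distrib_left)
  also have "\<dots> \<le> ennreal (C\<^sup>2) * (ennreal (C\<^sup>2) * ?B)"
  proof (intro mult_left_mono sum_gauss_mean_le_cotype[OF r C assms(3)])
    fix e :: "nat \<Rightarrow> real" assume "\<And>k. e k \<in> {1, -1}"
    then have "gauss_mean I (\<lambda>i. sqrt (w i) *\<^sub>R (\<Sum>k<K. e k *\<^sub>R d k i)) 0 = ?B"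
      by (intro gauss_mean_martingale_signs[OF assms(3) w const zero]) auto
    then show "gauss_mean I (\<lambda>i. \<Sum>k<K. e k *\<^sub>R sqrt (w i) *\<^sub>R d k i) 0 \<le> ?B"
      by (simp add: scaleR_sum_right mult.commute)
  qed simp
  also have "\<dots> = ennreal (C ^ 4) * ?B"
    by (simp add: mult.assoc[symmetric] ennreal_mult'[symmetric] power_add[symmetric])
  finally show ?thesis .
qed

section \<open>Averaged densities\<close>

lemma vector_measure_empty: "vector_measure M F \<Longrightarrow> F {} = 0"
proof -
  assume "vector_measure M F"
  then have "(\<lambda>n::nat. F {}) sums F {}"
    unfolding vector_measure_def by (auto simp: disjoint_family_on_def dest: spec[of _ "\<lambda>_. {}"])
  then have "(\<lambda>n::nat. F {}) \<longlonglongrightarrow> 0" by (intro summable_LIMSEQ_zero sums_summable)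
  then show "F {} = 0" using LIMSEQ_unique tendsto_const by blast
qed

lemma vector_measure_finite_Union:
  assumes F: "vector_measure M F" and "finite I" and A: "\<And>i. i \<in> I \<Longrightarrow> A i \<in> sets M" "disjoint_family_on A I"
  shows "F (\<Union>i\<in>I. A i) = (\<Sum>i\<in>I. F (A i))"
proof -
  obtain h where h: "bij_betw h {..<card I} I"
    using ex_bij_betw_nat_finite[OF assms(2)] by (auto simp: atLeast0LessThan)
  define B where "B n = (if n < card I then A (h n) else {})" for n
  have hI: "h n \<in> I" if "n < card I" for n using h that by (auto simp: bij_betw_def)
  have "disjoint_family B"
  proof (unfold disjoint_family_on_def, intro ballI impI)
    fix m n :: nat assume "m \<noteq> n"
    show "B m \<inter> B n = {}"
    proof (cases "m < card I \<and> n < card I")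
      case True
      then have "h m \<noteq> h n" using h \<open>m \<noteq> n\<close> by (auto simp: bij_betw_def inj_on_def)
      then show ?thesis using True A(2) hI by (auto simp: B_def disjoint_family_on_def)
    qed (auto simp: B_def)
  qed
  moreover have "range B \<subseteq> sets M" using A(1) hI by (auto simp: B_def)
  ultimately have "(\<lambda>n. F (B n)) sums F (\<Union>n. B n)"
    using F unfolding vector_measure_def by blast
  moreover have "(\<lambda>n. F (B n)) sums (\<Sum>n<card I. F (B n))"
    by (rule sums_finite) (auto simp: B_def vector_measure_empty[OF F])
  moreover have "(\<Union>n. B n) = (\<Union>i\<in>I. A i)"
  proof -
    have "(\<Union>n. B n) = (\<Union>n\<in>{..<card I}. A (h n))" by (auto simp: B_def split: if_splits)
    also have "\<dots> = (\<Union>i\<in>h ` {..<card I}. A i)" by simp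
    finally show ?thesis by (simp only: bij_betw_imp_surj_on[OF h])
  qed
  moreover have "(\<Sum>n<card I. F (B n)) = (\<Sum>i\<in>I. F (A i))"
    by (subst sum.reindex_bij_betw[OF h, symmetric]) (simp add: B_def)
  ultimately show ?thesis using sums_unique2 by metis
qed

lemma vector_measure_Un:
  assumes "vector_measure M F" "A \<in> sets M" "B \<in> sets M" "A \<inter> B = {}"
  shows "F (A \<union> B) = F A + F B"
proof -
  have "F (\<Union>b\<in>UNIV. if b then A else B) = (\<Sum>b\<in>UNIV. F (if b then A else B))"
    by (rule vector_measure_finite_Union[OF assms(1)]) (use assms in \<open>auto simp: disjoint_family_on_def split: if_splits\<close>)
  then show ?thesis by (simp add: UNIV_bool Un_commute add.commute)
qed

text \<open>A finite measurable partition is given by the fibres of a simple function \<open>l\<close>. Division by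
  the measure of a null fibre gives 0.\<close>

definition averaged_density :: "'s measure \<Rightarrow> ('s set \<Rightarrow> 'x::real_normed_vector) \<Rightarrow> ('s \<Rightarrow> 'l) \<Rightarrow> 's \<Rightarrow> 'x" where
  "averaged_density M F l x = F (l -` {l x} \<inter> space M) /\<^sub>R measure M (l -` {l x} \<inter> space M)"

text \<open>The two label types may differ. With the Boolean label \<open>x \<in> A\<close> in the
  second place, for a set \<open>A\<close> inside the space, the relation says that \<open>A\<close>
  is a union of fibres of the first label.\<close>

definition fibres_refine :: "'s measure \<Rightarrow> ('s \<Rightarrow> 'l) \<Rightarrow> ('s \<Rightarrow> 'k) \<Rightarrow> bool" where
  "fibres_refine M l' l \<longleftrightarrow> (\<forall>x\<in>space M. \<forall>y\<in>space M. l' x = l' y \<longrightarrow> l x = l y)"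

lemma fibres_refine_refl: "fibres_refine M l l"
  by (simp add: fibres_refine_def)

lemma fibres_refine_trans: "fibres_refine M l'' l' \<Longrightarrow> fibres_refine M l' l \<Longrightarrow> fibres_refine M l'' l"
  unfolding fibres_refine_def by metis

lemma averaged_density_cong:
  "l x = l y \<Longrightarrow> averaged_density M F l x = averaged_density M F l y"
  by (simp add: averaged_density_def)

lemma simple_function_averaged_density:
  assumes "simple_function M l"
  shows "simple_function M (averaged_density M F l)"
  unfolding averaged_density_def[abs_def]
  by (rule simple_function_compose1[OF assms, of "\<lambda>c. F (l -` {c} \<inter> space M) /\<^sub>R measure M (l -` {c} \<inter> space M)"])

lemma (in finite_measure) simple_bochner_integrable_simple:
  "simple_function M f \<Longrightarrow> Bochner_Integration.simple_bochner_integrable M f"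
  by (intro simple_bochner_integrable.intros) auto

lemma simple_function_indicator_scaleR:
  assumes "simple_function M f" "A \<in> sets M"
  shows "simple_function M (\<lambda>x. indicator A x *\<^sub>R f x)"
  using simple_function_compose2[OF simple_function_indicator[OF assms(2)] assms(1), of "\<lambda>(a::real) y. a *\<^sub>R y"] .

text \<open>Averaging preserves the integral over each fibre: the measure of the fibre cancels. On a
  null fibre the averaged density is 0, and this is where \<open>F\<close> has to vanish on null
  sets.\<close>

lemma (in finite_measure) simple_bochner_integral_averaged_density:
  assumes F: "vector_measure M F" "vanishes_on_null_sets M F" and l: "simple_function M l"
    and A: "A \<in> sets M" and lA: "fibres_refine M l (\<lambda>x. x \<in> A)"
  shows "Bochner_Integration.simple_bochner_integral M (\<lambda>x. indicator A x *\<^sub>R averaged_density M F l x) = F A"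
proof -
  let ?f = "\<lambda>x. indicator A x *\<^sub>R averaged_density M F l x"
  define J where "J = l ` A"
  have AS: "A \<subseteq> space M" using A sets.sets_into_space by auto
  have J: "finite J" "J \<subseteq> l ` space M"
    using simple_functionD(1)[OF l] finite_subset[of J "l ` space M"] AS by (auto simp: J_def)
  let ?B = "\<lambda>c. l -` {c} \<inter> space M"
  have B: "?B c \<in> sets M" for c using simple_functionD(2)[OF l] .
  define v where "v c = (if c \<in> J then F (?B c) /\<^sub>R measure M (?B c) else 0)" for c
  have inA: "x \<in> A \<longleftrightarrow> l x \<in> J" if "x \<in> space M" for x
    using lA that AS unfolding J_def fibres_refine_def by blast
  have "Bochner_Integration.simple_bochner_integral M ?f = (\<Sum>c\<in>l ` space M. measure M {x \<in> space M. l x = c} *\<^sub>R v c)"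
  proof (rule simple_bochner_integral_partition)
    show "Bochner_Integration.simple_bochner_integrable M ?f"
      by (intro simple_bochner_integrable_simple simple_function_indicator_scaleR simple_function_averaged_density l A)
    fix x assume "x \<in> space M"
    then show "?f x = v (l x)" by (auto simp: v_def inA averaged_density_def indicator_def)
  next
    fix x y assume "x \<in> space M" "y \<in> space M" "l x = l y"
    then show "?f x = ?f y" by (simp add: indicator_def inA averaged_density_def)
  qed fact
  also have "\<dots> = (\<Sum>c\<in>J. measure M (?B c) *\<^sub>R (F (?B c) /\<^sub>R measure M (?B c)))"
    using J simple_functionD(1)[OF l]
    by (intro sum.mono_neutral_cong_right) (auto simp: v_def vimage_def Int_def conj_commute)
  also have "\<dots> = (\<Sum>c\<in>J. F (?B c))"
  proof (intro sum.cong refl)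
    fix c
    show "measure M (?B c) *\<^sub>R (F (?B c) /\<^sub>R measure M (?B c)) = F (?B c)"
    proof (cases "measure M (?B c) = 0")
      case True
      then have "?B c \<in> null_sets M" using B by (auto simp: null_sets_def emeasure_eq_measure)
      then show ?thesis using F(2) True by (simp add: vanishes_on_null_sets_def)
    qed simp
  qed
  also have "\<dots> = F (\<Union>c\<in>J. ?B c)"
    by (rule vector_measure_finite_Union[symmetric, OF F(1) J(1) B]) (auto simp: disjoint_family_on_def)
  also have "(\<Union>c\<in>J. ?B c) = A" using inA AS by auto
  finally show ?thesis .
qed

text \<open>The square of the usual distance: squares are what adds up over the differences of a
  martingale.\<close>

definition L2_dist :: "'s measure \<Rightarrow> ('s \<Rightarrow> 'x::real_normed_vector) \<Rightarrow> ('s \<Rightarrow> 'x) \<Rightarrow> ennreal" where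
  "L2_dist M f g = (\<integral>\<^sup>+x. ennreal ((norm (f x - g x))\<^sup>2) \<partial>M)"

section \<open>Averaged densities along chains of refinements\<close>

lemma (in finite_measure) nn_integral_norm_simple_partition:
  fixes f :: "'a \<Rightarrow> 'x::real_normed_vector"
  assumes "simple_function M f" "simple_function M q"
    and v: "\<And>x. x \<in> space M \<Longrightarrow> f x = v (q x)"
  shows "(\<integral>\<^sup>+x. ennreal ((norm (f x))\<^sup>2) \<partial>M) =
    ennreal (\<Sum>c\<in>q ` space M. measure M (q -` {c} \<inter> space M) * (norm (v c))\<^sup>2)"
proof -
  let ?g = "\<lambda>x. ennreal ((norm (f x))\<^sup>2)"
  have g: "simple_function M ?g" by (rule simple_function_compose1[OF assms(1)])
  have "(\<integral>\<^sup>+x. ?g x \<partial>M) = integral\<^sup>S M ?g" by (rule nn_integral_eq_simple_integral[OF g])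
  also have "\<dots> = (\<Sum>c\<in>q ` space M. ennreal ((norm (v c))\<^sup>2) * emeasure M {x\<in>space M. q x = c})"
    by (rule simple_function_partition[OF g assms(2)]) (auto simp: v)
  also have "\<dots> = (\<Sum>c\<in>q ` space M. ennreal (measure M (q -` {c} \<inter> space M) * (norm (v c))\<^sup>2))"
    by (intro sum.cong refl) (auto simp: emeasure_eq_measure ennreal_mult' vimage_def Int_def conj_commute mult.commute)
  also have "\<dots> = ennreal (\<Sum>c\<in>q ` space M. measure M (q -` {c} \<inter> space M) * (norm (v c))\<^sup>2)"
    by (rule sum_ennreal) auto
  finally show ?thesis .
qed

lemma gamma_variation_gauss_mean:
  assumes "gaussian_sequence P \<gamma>" "0 \<le> V" "gamma_variation P \<gamma> M F \<le> ennreal V"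
    and "finite I" "\<And>i. i \<in> I \<Longrightarrow> B i \<in> sets M" "\<And>i. i \<in> I \<Longrightarrow> measure M (B i) > 0" "disjoint_family_on B I"
  shows "gauss_mean I (\<lambda>i. F (B i) /\<^sub>R sqrt (measure M (B i))) 0 \<le> ennreal (V\<^sup>2)"
proof -
  obtain h where h: "bij_betw h {..<card I} I"
    using ex_bij_betw_nat_finite[OF assms(4)] by (auto simp: atLeast0LessThan)
  have hI: "h n \<in> I" if "n < card I" for n using h that by (auto simp: bij_betw_def)
  have hn: "h m \<noteq> h n" if "m \<noteq> n" "m < card I" "n < card I" for m n
    using h that by (auto simp: bij_betw_def inj_on_def)
  have "disjoint_family_on (B \<circ> h) {..<card I}"
    using assms(7) hI hn unfolding disjoint_family_on_def by auto
  then have "gauss_mean {..<card I} (\<lambda>n. F ((B \<circ> h) n) /\<^sub>R sqrt (measure M ((B \<circ> h) n))) 0 \<le> ennreal (V\<^sup>2)"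
    using assms(5,6) hI
    by (intro assms(3)[unfolded gamma_variation_le_iff[OF assms(1,2)], rule_format]) (auto simp: comp_def)
  then show ?thesis
    using gauss_mean_reindex[of "{..<card I}" h "\<lambda>i. F (B i) /\<^sub>R sqrt (measure M (B i))" 0] h
    by (simp add: bij_betw_def)
qed

text \<open>Over a fibre of a coarser partition all later densities integrate to the value of
  \<open>F\<close>, so their differences are martingale differences. Everything is read off on the
  cells of the finest partition \<open>l K\<close>, at one chosen point per cell, which turns
  functions into finite families of vectors.\<close>

lemma (in finite_measure) averaged_density_chain:
  fixes F :: "'a set \<Rightarrow> 'x::real_normed_vector" and l :: "nat \<Rightarrow> 'a \<Rightarrow> 'l"
  assumes \<gamma>: "gaussian_sequence P \<gamma>" and r: "rademacher_sequence Q r"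
    and C: "cotype2_constant Q r TYPE('x) C" and V: "0 \<le> V" "gamma_variation P \<gamma> M F \<le> ennreal V"
    and F: "vector_measure M F" "vanishes_on_null_sets M F" and l: "\<And>k. simple_function M (l k)"
    and ref: "\<And>k. fibres_refine M (l (Suc k)) (l k)"
  shows "(\<Sum>k<K. L2_dist M (averaged_density M F (l (Suc k))) (averaged_density M F (l k))) \<le> ennreal (C ^ 4 * V\<^sup>2)"
proof -
  let ?\<phi> = "\<lambda>k. averaged_density M F (l k)"
  \<comment> \<open>The initial density counts as difference number 0, so that the first
    \<open>Suc K\<close> differences sum up to the density of \<open>l K\<close>.\<close>
  define D where "D k x = (case k of 0 \<Rightarrow> ?\<phi> 0 x | Suc j \<Rightarrow> ?\<phi> (Suc j) x - ?\<phi> j x)" for k x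
  define q where "q = l K"
  have q: "simple_function M q" using l by (simp add: q_def)
  define B where "B c = q -` {c} \<inter> space M" for c
  have B: "B c \<in> sets M" for c using simple_functionD(2)[OF q] by (simp add: B_def)
  define I where "I = {c \<in> q ` space M. measure M (B c) > 0}"
  have fin: "finite (q ` space M)" using simple_functionD(1)[OF q] .
  then have I: "finite I" by (simp add: I_def)
  define p where "p c = (SOME x. x \<in> space M \<and> q x = c)" for c
  have p: "p c \<in> space M" "q (p c) = c" if "c \<in> q ` space M" for c
  proof -
    have "\<exists>x. x \<in> space M \<and> q x = c" using that by auto
    then have "p c \<in> space M \<and> q (p c) = c" unfolding p_def by (rule someI_ex)
    then show "p c \<in> space M" "q (p c) = c" by auto
  qed
  have refjk: "fibres_refine M (l k) (l j)" if "j \<le> k" for j k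
    using that by (induction k rule: dec_induct) (auto intro: fibres_refine_refl fibres_refine_trans ref)
  have D_cong: "D k x = D k y" if "x \<in> space M" "y \<in> space M" "k \<le> j" "l j x = l j y" for k j x y
  proof -
    have "l i x = l i y" if "i \<le> j" for i
      using refjk[OF that] \<open>x \<in> space M\<close> \<open>y \<in> space M\<close> \<open>l j x = l j y\<close> unfolding fibres_refine_def by blast
    then have "?\<phi> i x = ?\<phi> i y" if "i \<le> j" for i
      using that by (intro averaged_density_cong) blast
    then show ?thesis using \<open>k \<le> j\<close> by (cases k) (simp_all add: D_def)
  qed
  have sD: "simple_function M (D k)" for k
    unfolding D_def using simple_function_averaged_density[OF l]
    by (cases k) (auto intro: simple_function_compose2[of M _ _ "\<lambda>a b. a - b"])
  let ?w = "\<lambda>c. measure M (B c)"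
  let ?d = "\<lambda>k c. D k (p c)"
  have norm_D: "(\<integral>\<^sup>+x. ennreal ((norm (D k x))\<^sup>2) \<partial>M) = ennreal (\<Sum>c\<in>I. ?w c * (norm (?d k c))\<^sup>2)" if "k \<le> K" for k
  proof -
    have "(\<integral>\<^sup>+x. ennreal ((norm (D k x))\<^sup>2) \<partial>M) = ennreal (\<Sum>c\<in>q ` space M. ?w c * (norm (?d k c))\<^sup>2)"
      unfolding B_def
    proof (rule nn_integral_norm_simple_partition[OF sD q])
      fix x assume "x \<in> space M"
      then show "D k x = D k (p (q x))" using p[of "q x"] that by (intro D_cong[of _ _ k K]) (auto simp: q_def)
    qed
    also have "(\<Sum>c\<in>q ` space M. ?w c * (norm (?d k c))\<^sup>2) = (\<Sum>c\<in>I. ?w c * (norm (?d k c))\<^sup>2)"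
      using fin by (intro sum.mono_neutral_right) (auto simp: I_def zero_less_measure_iff)
    finally show ?thesis .
  qed
  have "(\<Sum>k<Suc K. ennreal (\<Sum>c\<in>I. ?w c * (norm (?d k c))\<^sup>2)) = ennreal (\<Sum>k<Suc K. \<Sum>c\<in>I. ?w c * (norm (?d k c))\<^sup>2)"
    by (rule sum_ennreal) (auto intro!: sum_nonneg)
  also have "\<dots> \<le> ennreal (C ^ 4) * gauss_mean I (\<lambda>c. sqrt (?w c) *\<^sub>R (\<Sum>k<Suc K. ?d k c)) 0"
  proof (rule martingale_differences_cotype[OF r C I, where L = "\<lambda>j c. l j (p c)"])
    fix k j i m assume "k \<le> j" "i \<in> I" "m \<in> I" "l j (p i) = l j (p m)"
    then show "D k (p i) = D k (p m)" using p by (intro D_cong[of _ _ k j]) (auto simp: I_def)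
  next
    fix k j c assume jk: "j < k" "k < Suc K"
    define A where "A = l j -` {c} \<inter> space M"
    have A: "A \<in> sets M" using simple_functionD(2)[OF l] by (simp add: A_def)
    obtain i where i: "k = Suc i" using jk by (cases k) auto
    have ref_A: "fibres_refine M (l n) (\<lambda>x. x \<in> A)" if "j \<le> n" for n
      unfolding fibres_refine_def
    proof (intro ballI impI)
      fix x y assume "x \<in> space M" "y \<in> space M" "l n x = l n y"
      then have "l j x = l j y" using refjk[OF that] unfolding fibres_refine_def by metis
      then show "(x \<in> A) = (y \<in> A)" using \<open>x \<in> space M\<close> \<open>y \<in> space M\<close> by (simp add: A_def)
    qed
    have SI: "Bochner_Integration.simple_bochner_integral M (\<lambda>x. indicator A x *\<^sub>R ?\<phi> n x) = F A" if "j \<le> n" for n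
      by (rule simple_bochner_integral_averaged_density[OF F l A ref_A[OF that]])
    have SBI: "Bochner_Integration.simple_bochner_integrable M (\<lambda>x. indicator A x *\<^sub>R ?\<phi> n x)" for n
      by (intro simple_bochner_integrable_simple simple_function_indicator_scaleR simple_function_averaged_density l A)
    have "0 = Bochner_Integration.simple_bochner_integral M (\<lambda>x. indicator A x *\<^sub>R ?\<phi> k x - indicator A x *\<^sub>R ?\<phi> i x)"
      using jk i SI[of k] SI[of i] by (subst simple_bochner_integral_diff[OF SBI SBI]) auto
    also have "(\<lambda>x. indicator A x *\<^sub>R ?\<phi> k x - indicator A x *\<^sub>R ?\<phi> i x) = (\<lambda>x. indicator A x *\<^sub>R D k x)"
      by (simp add: D_def i scaleR_diff_right)
    also have "Bochner_Integration.simple_bochner_integral M (\<lambda>x. indicator A x *\<^sub>R D k x) =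
      (\<Sum>m\<in>q ` space M. measure M {x \<in> space M. q x = m} *\<^sub>R (indicator A (p m) *\<^sub>R ?d k m))"
    proof -
      have eq: "indicator A x *\<^sub>R D k x = indicator A y *\<^sub>R D k y" if "x \<in> space M" "y \<in> space M" "q x = q y" for x y
        proof -
        have "x \<in> A \<longleftrightarrow> y \<in> A"
          using that jk ref_A[of K] unfolding fibres_refine_def q_def by (metis less_Suc_eq_le less_imp_le order_trans)
        moreover have "D k x = D k y" using that jk by (intro D_cong[of _ _ k K]) (auto simp: q_def)
        ultimately show ?thesis by (simp add: indicator_def)
      qed
      show ?thesis
      proof (rule simple_bochner_integral_partition)
        show "Bochner_Integration.simple_bochner_integrable M (\<lambda>x. indicator A x *\<^sub>R D k x)"
          by (intro simple_bochner_integrable_simple simple_function_indicator_scaleR sD A)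
        fix x assume "x \<in> space M"
        then show "indicator A x *\<^sub>R D k x = indicator A (p (q x)) *\<^sub>R ?d k (q x)"
          using p[of "q x"] by (intro eq) auto
      qed (rule q, rule eq)
    qed
    also have "\<dots> = (\<Sum>m\<in>q ` space M. if m \<in> I \<and> l j (p m) = c then ?w m *\<^sub>R ?d k m else 0)"
    proof (intro sum.cong refl)
      fix m assume m: "m \<in> q ` space M"
      have "{x \<in> space M. q x = m} = B m" by (auto simp: B_def)
      moreover have "p m \<in> A \<longleftrightarrow> l j (p m) = c" using p[OF m] by (auto simp: A_def)
      moreover have "m \<in> I \<longleftrightarrow> ?w m \<noteq> 0" using m by (auto simp: I_def zero_less_measure_iff)
      ultimately show "measure M {x \<in> space M. q x = m} *\<^sub>R (indicator A (p m) *\<^sub>R ?d k m) =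
        (if m \<in> I \<and> l j (p m) = c then ?w m *\<^sub>R ?d k m else 0)" by (auto simp: indicator_def)
    qed
    also have "\<dots> = (\<Sum>m\<in>{m \<in> I. l j (p m) = c}. ?w m *\<^sub>R ?d k m)"
      using fin by (subst sum.inter_filter[symmetric]) (auto simp: I_def intro!: sum.cong)
    finally show "(\<Sum>m\<in>{m \<in> I. l j (p m) = c}. ?w m *\<^sub>R ?d k m) = 0" by simp
  qed simp
  also have "gauss_mean I (\<lambda>c. sqrt (?w c) *\<^sub>R (\<Sum>k<Suc K. ?d k c)) 0 = gauss_mean I (\<lambda>c. F (B c) /\<^sub>R sqrt (?w c)) 0"
  proof (intro gauss_mean_cong refl)
    fix c assume c: "c \<in> I"
    have "(\<Sum>k<Suc n. D k x) = ?\<phi> n x" for n x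
      by (induction n) (auto simp: D_def)
    then have "(\<Sum>k<Suc K. ?d k c) = F (B c) /\<^sub>R ?w c"
      using p[of c] c by (simp add: averaged_density_def q_def[symmetric] B_def I_def)
    moreover have "sqrt (?w c) * inverse (?w c) = inverse (sqrt (?w c))"
      using c by (simp add: I_def field_simps)
    ultimately show "sqrt (?w c) *\<^sub>R (\<Sum>k<Suc K. ?d k c) = F (B c) /\<^sub>R sqrt (?w c)" by simp
  qed
  also have "ennreal (C ^ 4) * \<dots> \<le> ennreal (C ^ 4) * ennreal (V\<^sup>2)"
    using B by (intro mult_left_mono gamma_variation_gauss_mean[OF \<gamma> V I])
      (auto simp: I_def B_def disjoint_family_on_def)
  also have "\<dots> = ennreal (C ^ 4 * V\<^sup>2)" by (simp add: ennreal_mult')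
  finally have le1: "(\<Sum>k<Suc K. ennreal (\<Sum>c\<in>I. ?w c * (norm (?d k c))\<^sup>2)) \<le> ennreal (C ^ 4 * V\<^sup>2)" .
  have eq: "(\<Sum>k<K. L2_dist M (?\<phi> (Suc k)) (?\<phi> k)) = (\<Sum>k<K. ennreal (\<Sum>c\<in>I. ?w c * (norm (?d (Suc k) c))\<^sup>2))"
  proof (intro sum.cong refl)
    fix k assume "k \<in> {..<K}"
    then show "L2_dist M (?\<phi> (Suc k)) (?\<phi> k) = ennreal (\<Sum>c\<in>I. ?w c * (norm (?d (Suc k) c))\<^sup>2)"
      by (subst norm_D[symmetric]) (simp_all add: L2_dist_def D_def)
  qed
  have le2: "(\<Sum>k<K. ennreal (\<Sum>c\<in>I. ?w c * (norm (?d (Suc k) c))\<^sup>2)) \<le> (\<Sum>k<Suc K. ennreal (\<Sum>c\<in>I. ?w c * (norm (?d k c))\<^sup>2))"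
    unfolding sum.lessThan_Suc_shift by (rule add_increasing) auto
  show ?thesis unfolding eq by (rule order_trans[OF le2 le1])
qed

lemma (in finite_measure) averaged_density_bound:
  fixes F :: "'a set \<Rightarrow> 'x::real_normed_vector"
  assumes \<gamma>: "gaussian_sequence P \<gamma>" and r: "rademacher_sequence Q r"
    and C: "cotype2_constant Q r TYPE('x) C" and V: "0 \<le> V" "gamma_variation P \<gamma> M F \<le> ennreal V"
    and q: "simple_function M q"
  shows "(\<integral>\<^sup>+x. ennreal ((norm (averaged_density M F q x))\<^sup>2) \<partial>M) \<le> ennreal (C\<^sup>2 * V\<^sup>2)"
proof -
  define B where "B c = q -` {c} \<inter> space M" for c
  have B: "B c \<in> sets M" for c using simple_functionD(2)[OF q] by (simp add: B_def)
  define I where "I = {c \<in> q ` space M. measure M (B c) > 0}"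
  have fin: "finite (q ` space M)" using simple_functionD(1)[OF q] .
  then have I: "finite I" by (simp add: I_def)
  let ?w = "\<lambda>c. measure M (B c)"
  have "(\<integral>\<^sup>+x. ennreal ((norm (averaged_density M F q x))\<^sup>2) \<partial>M) = ennreal (\<Sum>c\<in>q ` space M. ?w c * (norm (F (B c) /\<^sub>R ?w c))\<^sup>2)"
    unfolding B_def by (rule nn_integral_norm_simple_partition[OF simple_function_averaged_density[OF q] q])
      (simp add: averaged_density_def)
  also have "(\<Sum>c\<in>q ` space M. ?w c * (norm (F (B c) /\<^sub>R ?w c))\<^sup>2) = (\<Sum>c\<in>I. (norm (F (B c) /\<^sub>R sqrt (?w c)))\<^sup>2)"
    using fin by (intro sum.mono_neutral_cong_right)
      (auto simp: I_def zero_less_measure_iff power_mult_distrib power_divide power2_eq_square field_simps)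
  also have "ennreal \<dots> \<le> ennreal (C\<^sup>2) * gauss_mean I (\<lambda>c. F (B c) /\<^sub>R sqrt (?w c)) 0"
    by (rule cotype2_gauss_mean[OF r C I])
  also have "\<dots> \<le> ennreal (C\<^sup>2) * ennreal (V\<^sup>2)"
    using B by (intro mult_left_mono gamma_variation_gauss_mean[OF \<gamma> V I])
      (auto simp: I_def B_def disjoint_family_on_def)
  finally show ?thesis by (simp add: ennreal_mult')
qed

text \<open>Otherwise one could refine forever, every step having squared size above \<epsilon>,
  whereas the chain bound rules out K such steps as soon as K \<epsilon> exceeds
  \<open>C ^ 4 * V\<^sup>2\<close>. The control extends to every refinement, not just to a sequence;
  this is what later reaches an arbitrary measurable set.\<close>

lemma (in finite_measure) averaged_density_Cauchy:
  fixes F :: "'a set \<Rightarrow> 'x::real_normed_vector" and l0 :: "'a \<Rightarrow> 'l"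
  assumes \<gamma>: "gaussian_sequence P \<gamma>" and r: "rademacher_sequence Q r"
    and C: "cotype2_constant Q r TYPE('x) C" and V: "0 \<le> V" "gamma_variation P \<gamma> M F \<le> ennreal V"
    and F: "vector_measure M F" "vanishes_on_null_sets M F" and l0: "simple_function M l0"
    and "\<epsilon> > 0"
  shows "\<exists>l :: 'a \<Rightarrow> 'l. simple_function M l \<and> fibres_refine M l l0 \<and>
    (\<forall>l' :: 'a \<Rightarrow> 'l. simple_function M l' \<longrightarrow> fibres_refine M l' l \<longrightarrow>
       L2_dist M (averaged_density M F l') (averaged_density M F l) \<le> ennreal \<epsilon>)"
proof (rule ccontr)
  let ?d = "\<lambda>(l' :: 'a \<Rightarrow> 'l) (l :: 'a \<Rightarrow> 'l). L2_dist M (averaged_density M F l') (averaged_density M F l)"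
  assume neg: "\<not> ?thesis"
  have step: "\<exists>l'. (simple_function M l' \<and> fibres_refine M l' l0) \<and> (fibres_refine M l' l \<and> ennreal \<epsilon> < ?d l' l)"
    if "simple_function M l \<and> fibres_refine M l l0" for l
  proof -
    have "\<exists>l'. simple_function M l' \<and> fibres_refine M l' l \<and> \<not> ?d l' l \<le> ennreal \<epsilon>"
    proof (rule ccontr)
      assume "\<not> ?thesis"
      then have "\<forall>l'. simple_function M l' \<longrightarrow> fibres_refine M l' l \<longrightarrow> ?d l' l \<le> ennreal \<epsilon>" by metis
      then show False using neg that by metis
    qed
    then obtain l' where "simple_function M l'" "fibres_refine M l' l" "\<not> ?d l' l \<le> ennreal \<epsilon>" by metis
    then show ?thesis using that fibres_refine_trans[of M l' l l0] not_le by metis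
  qed
  have "\<exists>f. \<forall>n::nat. (simple_function M (f n) \<and> fibres_refine M (f n) l0) \<and>
      (fibres_refine M (f (Suc n)) (f n) \<and> ennreal \<epsilon> < ?d (f (Suc n)) (f n))"
  proof (rule dependent_nat_choice)
    show "\<exists>l :: 'a \<Rightarrow> 'l. simple_function M l \<and> fibres_refine M l l0" by (intro exI[of _ l0] conjI l0 fibres_refine_refl)
  qed (rule step)
  then obtain f where f: "\<And>n::nat. simple_function M (f n)"
      "\<And>n. fibres_refine M (f (Suc n)) (f n)" "\<And>n. ennreal \<epsilon> < ?d (f (Suc n)) (f n)"
    by blast
  obtain K :: nat where K: "C ^ 4 * V\<^sup>2 < of_nat K * \<epsilon>"
    using reals_Archimedean3[OF \<open>\<epsilon> > 0\<close>] by blast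
  have "ennreal (of_nat K * \<epsilon>) = (\<Sum>k<K. ennreal \<epsilon>)"
    using \<open>\<epsilon> > 0\<close> by (simp add: ennreal_mult ennreal_of_nat_eq_real_of_nat)
  also have "\<dots> \<le> (\<Sum>k<K. ?d (f (Suc k)) (f k))"
    using f(3) by (intro sum_mono less_imp_le) auto
  also have "\<dots> \<le> ennreal (C ^ 4 * V\<^sup>2)"
    by (rule averaged_density_chain[OF \<gamma> r C V F, where l = f, OF f(1,2)])
  finally show False using K by (subst (asm) ennreal_le_iff) auto
qed

text \<open>Fatou's lemma. The limit is not assumed to be Borel measurable, so its integral is first
  replaced by that of the lower limit of measurable functions. The exponent 2 gives the norm bound,
  the exponent 1 the convergence of integrals.\<close>

lemma nn_integral_norm_power_limit_le:
  fixes f :: "nat \<Rightarrow> 's \<Rightarrow> 'x::real_normed_vector"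
  assumes "\<And>m. simple_function M (f m)" "AE x in M. (\<lambda>m. f m x) \<longlonglongrightarrow> \<phi> x" "simple_function M c"
    and B: "\<And>m. m \<ge> k \<Longrightarrow> (\<integral>\<^sup>+x. ennreal (norm (f m x - c x) ^ p) \<partial>M) \<le> B"
  shows "(\<integral>\<^sup>+x. ennreal (norm (\<phi> x - c x) ^ p) \<partial>M) \<le> B"
proof -
  have meas: "(\<lambda>x. ennreal (norm (f m x - c x) ^ p)) \<in> borel_measurable M" for m
    using simple_function_compose2[OF assms(1,3), where h = "\<lambda>a b. ennreal (norm (a - b) ^ p)"]
    by (rule borel_measurable_simple_function)
  have "(\<integral>\<^sup>+x. ennreal (norm (\<phi> x - c x) ^ p) \<partial>M) = (\<integral>\<^sup>+x. liminf (\<lambda>m. ennreal (norm (f m x - c x) ^ p)) \<partial>M)"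
    using assms(2)
  proof (intro nn_integral_cong_AE, eventually_elim)
    case (elim x)
    then have "(\<lambda>m. ennreal (norm (f m x - c x) ^ p)) \<longlonglongrightarrow> ennreal (norm (\<phi> x - c x) ^ p)"
      by (intro tendsto_intros)
    then show ?case by (rule lim_imp_Liminf[OF sequentially_bot, symmetric])
  qed
  also have "\<dots> \<le> liminf (\<lambda>m. \<integral>\<^sup>+x. ennreal (norm (f m x - c x) ^ p) \<partial>M)"
    by (rule nn_integral_liminf[OF meas])
  also have "\<dots> \<le> limsup (\<lambda>m. \<integral>\<^sup>+x. ennreal (norm (f m x - c x) ^ p) \<partial>M)"
    by (rule Liminf_le_Limsup) simp
  also have "\<dots> \<le> B"
    using B by (intro Limsup_bounded) (auto simp: eventually_at_top_linorder)
  finally show ?thesis .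
qed

text \<open>With e = (1/2)^k the arithmetic-geometric mean inequality gives d \<le> e/2 + d^2/(2 e)
  pointwise. Integrated over a probability space, the right side is at most e, because the integral
  of d^2 is at most e^2.\<close>

lemma (in prob_space) L1_le_of_L2_dist_le:
  assumes "simple_function M f" "simple_function M g" "L2_dist M f g \<le> ennreal ((1/4) ^ k)"
  shows "(\<integral>\<^sup>+x. ennreal (norm (f x - g x)) \<partial>M) \<le> ennreal ((1/2) ^ k)"
proof -
  have m: "(\<lambda>x. ennreal ((norm (f x - g x))\<^sup>2)) \<in> borel_measurable M"
    using simple_function_compose2[OF assms(1,2), where h = "\<lambda>a b. ennreal ((norm (a - b))\<^sup>2)"]
    by (rule borel_measurable_simple_function)
  have m': "(\<lambda>x. ennreal (2 ^ k / 2) * ennreal ((norm (f x - g x))\<^sup>2)) \<in> borel_measurable M"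
    by (rule borel_measurable_times_ennreal[OF borel_measurable_const m])
  have "(\<integral>\<^sup>+x. ennreal (norm (f x - g x)) \<partial>M) \<le>
     (\<integral>\<^sup>+x. ennreal ((1/2) ^ k / 2) + ennreal (2 ^ k / 2) * ennreal ((norm (f x - g x))\<^sup>2) \<partial>M)"
  proof (intro nn_integral_mono)
    fix x
    have "0 \<le> ((1/2) ^ k - norm (f x - g x))\<^sup>2 * 2 ^ k" by simp
    also have "\<dots> = ((1/2) ^ k)\<^sup>2 * 2 ^ k - 2 * ((1/2) ^ k * 2 ^ k) * norm (f x - g x) + 2 ^ k * (norm (f x - g x))\<^sup>2"
      by (simp only: power2_diff) (simp only: ring_distribs mult.assoc mult.commute mult.left_commute diff_add_eq)
    also have "(1/2) ^ k * 2 ^ k = (1 :: real)" by (simp add: power_mult_distrib[symmetric])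
    also have "((1/2) ^ k)\<^sup>2 * 2 ^ k = ((1/2) ^ k :: real)"
      by (simp add: power2_eq_square power_mult_distrib[symmetric] mult.assoc)
    finally have "norm (f x - g x) \<le> (1/2) ^ k / 2 + 2 ^ k / 2 * (norm (f x - g x))\<^sup>2" by simp
    then have "ennreal (norm (f x - g x)) \<le> ennreal ((1/2) ^ k / 2 + 2 ^ k / 2 * (norm (f x - g x))\<^sup>2)"
      by (rule ennreal_leI)
    also have "\<dots> = ennreal ((1/2) ^ k / 2) + ennreal (2 ^ k / 2) * ennreal ((norm (f x - g x))\<^sup>2)"
      by (subst ennreal_plus) (auto simp: ennreal_mult[symmetric] simp del: ennreal_plus)
    finally show "ennreal (norm (f x - g x)) \<le> \<dots>" .
  qed
  also have "\<dots> = ennreal ((1/2) ^ k / 2) + ennreal (2 ^ k / 2) * L2_dist M f g"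
    unfolding L2_dist_def
    by (subst nn_integral_add) (simp_all add: nn_integral_cmult[OF m] emeasure_space_1 m')
  also have "\<dots> \<le> ennreal ((1/2) ^ k / 2) + ennreal (2 ^ k / 2) * ennreal ((1/4) ^ k)"
    by (intro add_left_mono mult_left_mono assms) simp
  also have "\<dots> = ennreal ((1/2) ^ k / 2 + 2 ^ k / 2 * (1/4) ^ k)"
    by (subst ennreal_plus) (auto simp: ennreal_mult[symmetric] simp del: ennreal_plus)
  also have "(1/2) ^ k / 2 + 2 ^ k / 2 * (1/4) ^ k = ((1/2) ^ k :: real)"
    by (simp add: power_mult_distrib[symmetric])
  finally show ?thesis .
qed

text \<open>The norms of the increments have an integrable sum, so the telescoping series converges
  absolutely almost everywhere; completeness of the space does the rest.\<close>

lemma (in prob_space) AE_convergent_of_L1_summable: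
  fixes f :: "nat \<Rightarrow> 'a \<Rightarrow> 'x::banach"
  assumes "\<And>m. simple_function M (f m)"
    and "\<And>k. (\<integral>\<^sup>+x. ennreal (norm (f (Suc k) x - f k x)) \<partial>M) \<le> ennreal ((1/2) ^ k)"
  shows "AE x in M. convergent (\<lambda>m. f m x)"
proof -
  let ?h = "\<lambda>k x. ennreal (norm (f (Suc k) x - f k x))"
  have meas[measurable]: "?h k \<in> borel_measurable M" for k
    using simple_function_compose2[OF assms(1) assms(1), where h = "\<lambda>a b. ennreal (norm (a - b))"]
    by (rule borel_measurable_simple_function)
  have "(\<integral>\<^sup>+x. (\<Sum>k. ?h k x) \<partial>M) = (\<Sum>k. \<integral>\<^sup>+x. ?h k x \<partial>M)"
    by (rule nn_integral_suminf) measurable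
  also have "\<dots> \<le> (\<Sum>k. ennreal ((1/2) ^ k))"
    by (intro suminf_le assms) auto
  also have "\<dots> = ennreal (\<Sum>k. (1/2) ^ k)"
    by (intro suminf_ennreal2) (auto intro: summable_geometric)
  also have "\<dots> < \<infinity>" by simp
  finally have "AE x in M. (\<Sum>k. ?h k x) \<noteq> \<infinity>"
    by (intro nn_integral_PInf_AE) auto
  then show ?thesis
  proof eventually_elim
    case (elim x)
    then have "summable (\<lambda>k. norm (f (Suc k) x - f k x))"
      by (intro summable_suminf_not_top) auto
    then have "summable (\<lambda>k. f (Suc k) x - f k x)" by (rule summable_norm_cancel)
    then have "convergent (\<lambda>n. \<Sum>k<n. f (Suc k) x - f k x)" by (simp add: summable_iff_convergent)
    then have "convergent (\<lambda>n. f n x - f 0 x)" by (simp add: sum_lessThan_telescope[of "\<lambda>n. f n x"])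
    then have "convergent (\<lambda>n. f n x - f 0 x + f 0 x)" by (intro convergent_add convergent_const)
    then show ?case by simp
  qed
qed

text \<open>The density is built with one cotype constant, but its norm is bounded for every cotype
  constant: that estimate holds for each partition separately and passes to the limit.\<close>

lemma (in prob_space) cotype2_representation:
  fixes F :: "'a set \<Rightarrow> 'x::banach"
  assumes \<gamma>: "gaussian_sequence P \<gamma>" and r: "rademacher_sequence Q r"
    and cot: "cotype2 Q r TYPE('x)"
    and F: "vector_measure M F" "bounded_gamma_variation P \<gamma> M F" "vanishes_on_null_sets M F"
  shows "\<exists>\<phi>\<in>bochner_L2 M. represents M \<phi> F \<and>
    (\<forall>C. cotype2_constant Q r TYPE('x) C \<longrightarrow> ennreal (bochner_L2_norm M \<phi>) \<le> ennreal C * gamma_variation P \<gamma> M F)"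
proof -
  obtain C where C: "cotype2_constant Q r TYPE('x) C" using cot by (auto simp: cotype2_def)
  define V where "V = enn2real (gamma_variation P \<gamma> M F)"
  have V: "0 \<le> V" "gamma_variation P \<gamma> M F = ennreal V"
    using F(2) by (auto simp: V_def bounded_gamma_variation_def)
  then have V': "gamma_variation P \<gamma> M F \<le> ennreal V" by simp
  let ?a = "averaged_density M F"
  \<comment> \<open>Closeness is demanded for all refinements, including those that are not in the
    sequence. The rate \<open>(1/4) ^ n\<close> for squared distances makes the first-power
    distances summable.\<close>
  let ?good = "\<lambda>n (l :: 'a \<Rightarrow> nat). simple_function M l \<and>
    (\<forall>l' :: 'a \<Rightarrow> nat. simple_function M l' \<longrightarrow> fibres_refine M l' l \<longrightarrow> L2_dist M (?a l') (?a l) \<le> ennreal ((1/4) ^ n))"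
  have ex: "\<exists>l. ?good n l \<and> fibres_refine M l l0" if "simple_function M l0" for n :: nat and l0 :: "'a \<Rightarrow> nat"
    using averaged_density_Cauchy[OF \<gamma> r C V(1) V' F(1,3) that, of "(1/4) ^ n"] by auto
  have "\<exists>f. \<forall>n. ?good n (f n) \<and> fibres_refine M (f (Suc n)) (f n)"
  proof (rule dependent_nat_choice)
    show "\<exists>l. ?good 0 l" using ex[of "\<lambda>_. 0" 0] by auto
    show "\<exists>l'. ?good (Suc n) l' \<and> fibres_refine M l' l" if "?good n l" for l n
      using ex[of l "Suc n"] that by auto
  qed
  then obtain l where l_good: "\<forall>n. ?good n (l n) \<and> fibres_refine M (l (Suc n)) (l n)" ..
  then have l: "\<And>n. simple_function M (l n)" "\<And>n. fibres_refine M (l (Suc n)) (l n)" by simp_all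
  have close: "L2_dist M (?a l') (?a (l n)) \<le> ennreal ((1/4) ^ n)"
    if "simple_function M l'" "fibres_refine M l' (l n)" for n and l' :: "'a \<Rightarrow> nat"
    using l_good that by metis
  define f where "f n = ?a (l n)" for n
  have f: "simple_function M (f n)" for n
    unfolding f_def by (rule simple_function_averaged_density[OF l(1)])
  have ref: "fibres_refine M (l m) (l n)" if "n \<le> m" for m n
    using that by (induction m rule: dec_induct) (auto intro: fibres_refine_refl fibres_refine_trans l)
  have L2: "L2_dist M (f m) (f n) \<le> ennreal ((1/4) ^ n)" if "n \<le> m" for m n
    unfolding f_def by (rule close[OF l(1) ref[OF that]])
  have L1: "(\<integral>\<^sup>+x. ennreal (norm (f m x - f n x)) \<partial>M) \<le> ennreal ((1/2) ^ n)" if "n \<le> m" for m n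
    by (rule L1_le_of_L2_dist_le[OF f f L2[OF that]])
  have "AE x in M. convergent (\<lambda>m. f m x)"
    by (rule AE_convergent_of_L1_summable[OF f L1]) simp
  define \<phi> where "\<phi> x = lim (\<lambda>m. f m x)" for x
  have lim: "AE x in M. (\<lambda>m. f m x) \<longlonglongrightarrow> \<phi> x"
    using \<open>AE x in M. convergent (\<lambda>m. f m x)\<close> by eventually_elim (simp add: \<phi>_def convergent_LIMSEQ_iff)
  have bound: "(\<integral>\<^sup>+x. ennreal ((norm (\<phi> x))\<^sup>2) \<partial>M) \<le> ennreal (C\<^sup>2 * V\<^sup>2)"
    if "cotype2_constant Q r TYPE('x) C" for C
  proof -
    have "(\<integral>\<^sup>+x. ennreal (norm (\<phi> x - 0) ^ 2) \<partial>M) \<le> ennreal (C\<^sup>2 * V\<^sup>2)"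
      using averaged_density_bound[OF \<gamma> r that V(1) V' l(1)]
      by (intro nn_integral_norm_power_limit_le[OF f lim, of _ 0]) (auto simp: f_def)
    then show ?thesis by simp
  qed
  have sm: "strongly_measurable M \<phi>"
    unfolding strongly_measurable_def using f lim by blast
  have "\<phi> \<in> bochner_L2 M"
    using sm bound[OF C] by (auto simp: bochner_L2_def intro: le_less_trans)
  moreover have "represents M \<phi> F"
    unfolding represents_def
  proof
    fix A assume A: "A \<in> sets M"
    let ?s = "\<lambda>i x. indicator A x *\<^sub>R f i x"
    have s: "simple_function M (?s i)" for i by (rule simple_function_indicator_scaleR[OF f A])
    have "AE x in M. (\<lambda>i. ?s i x) \<longlonglongrightarrow> indicator A x *\<^sub>R \<phi> x"
      using lim by eventually_elim (intro tendsto_intros)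
    then have "strongly_measurable M (\<lambda>x. indicator A x *\<^sub>R \<phi> x)"
      unfolding strongly_measurable_def using s by (intro exI[of _ ?s]) auto
    moreover have "(\<lambda>i. \<integral>\<^sup>+x. ennreal (norm (indicator A x *\<^sub>R \<phi> x - ?s i x)) \<partial>M) \<longlonglongrightarrow> 0"
    proof (rule tendsto_sandwich[OF _ _ tendsto_const])
      have "(\<lambda>i. ennreal ((1/2) ^ i)) \<longlonglongrightarrow> ennreal 0"
        by (intro tendsto_ennrealI LIMSEQ_power_zero) simp
      then show "(\<lambda>i. ennreal ((1/2) ^ i)) \<longlonglongrightarrow> 0" by simp
      have "(\<integral>\<^sup>+x. ennreal (norm (indicator A x *\<^sub>R \<phi> x - ?s i x)) \<partial>M) \<le> ennreal ((1/2) ^ i)" for i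
      proof -
        have "(\<integral>\<^sup>+x. ennreal (norm (indicator A x *\<^sub>R \<phi> x - ?s i x)) \<partial>M) \<le> (\<integral>\<^sup>+x. ennreal (norm (\<phi> x - f i x) ^ 1) \<partial>M)"
          by (intro nn_integral_mono) (simp add: indicator_def)
        also have "\<dots> \<le> ennreal ((1/2) ^ i)"
          by (rule nn_integral_norm_power_limit_le[OF f lim f, of i]) (use L1 in simp)
        finally show ?thesis .
      qed
      then show "\<forall>\<^sub>F i in sequentially. (\<integral>\<^sup>+x. ennreal (norm (indicator A x *\<^sub>R \<phi> x - ?s i x)) \<partial>M) \<le> ennreal ((1/2) ^ i)"
        by simp
    qed simp
    moreover have "(\<lambda>i. Bochner_Integration.simple_bochner_integral M (?s i)) \<longlonglongrightarrow> F A"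
    proof -
      have "norm (Bochner_Integration.simple_bochner_integral M (?s i) - F A) \<le> (1/2) ^ i" for i
      proof -
        \<comment> \<open>The cells of \<open>l i\<close> are cut along \<open>A\<close>, so
          \<open>A\<close> becomes a union of fibres while \<open>q\<close> still refines
          \<open>l i\<close>. Encoding the pair keeps the labels natural numbers, as
          \<open>close\<close> requires.\<close>
        define q where "q x = prod_encode (l i x, if x \<in> A then 1 else 0)" for x
        have q: "simple_function M q"
        proof -
          have "simple_function M (\<lambda>x. prod_encode (l i x, nat \<lfloor>indicator A x :: real\<rfloor>))"
            by (rule simple_function_compose2[OF l(1) simple_function_indicator[OF A], where h = "\<lambda>a b. prod_encode (a, nat \<lfloor>b :: real\<rfloor>)"])
          also have "(\<lambda>x. prod_encode (l i x, nat \<lfloor>indicator A x :: real\<rfloor>)) = q"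
            by (auto simp: q_def indicator_def)
          finally show ?thesis .
        qed
        have qA: "fibres_refine M q (\<lambda>x. x \<in> A)" and ql: "fibres_refine M q (l i)"
          unfolding fibres_refine_def by (auto simp: q_def split: if_splits)
        let ?g = "\<lambda>x. indicator A x *\<^sub>R ?a q x"
        have g: "simple_function M ?g"
          by (intro simple_function_indicator_scaleR simple_function_averaged_density q A)
        have diff: "simple_function M (\<lambda>x. ?g x - ?s i x)"
          by (rule simple_function_compose2[OF g s])
        have "Bochner_Integration.simple_bochner_integral M (?s i) - F A
            = - Bochner_Integration.simple_bochner_integral M (\<lambda>x. ?g x - ?s i x)"
          using simple_bochner_integral_averaged_density[OF F(1,3) q A qA]
          by (simp add: simple_bochner_integral_diff simple_bochner_integrable_simple g s)
        then have "ennreal (norm (Bochner_Integration.simple_bochner_integral M (?s i) - F A))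
            \<le> ennreal (Bochner_Integration.simple_bochner_integral M (\<lambda>x. norm (?g x - ?s i x)))"
          using simple_bochner_integral_norm_bound[OF simple_bochner_integrable_simple[OF diff]]
          by (simp add: ennreal_leI)
        also have "\<dots> = (\<integral>\<^sup>+x. ennreal (norm (?g x - ?s i x)) \<partial>M)"
          by (rule simple_bochner_integral_eq_nn_integral)
            (auto intro!: simple_bochner_integrable_simple simple_function_compose1[OF diff])
        also have "\<dots> \<le> (\<integral>\<^sup>+x. ennreal (norm (?a q x - f i x)) \<partial>M)"
          by (intro nn_integral_mono) (simp add: indicator_def)
        also have "\<dots> \<le> ennreal ((1/2) ^ i)"
          using close[OF q ql]
          by (intro L1_le_of_L2_dist_le simple_function_averaged_density q f) (simp add: f_def)
        finally show ?thesis by (simp add: ennreal_le_iff)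
      qed
      then have ev: "\<forall>\<^sub>F i in sequentially. norm (Bochner_Integration.simple_bochner_integral M (?s i) - F A) \<le> (1/2) ^ i"
        by simp
      have "(\<lambda>i. (1/2) ^ i :: real) \<longlonglongrightarrow> 0" by (rule LIMSEQ_power_zero) simp
      from Lim_null_comparison[OF ev this]
      show ?thesis by (rule LIM_zero_cancel)
    qed
    ultimately show "has_strong_bochner_integral M (\<lambda>x. indicator A x *\<^sub>R \<phi> x) (F A)"
      unfolding has_strong_bochner_integral_def
      by (intro conjI exI[of _ ?s] allI simple_bochner_integrable_simple s)
  qed
  moreover have "ennreal (bochner_L2_norm M \<phi>) \<le> ennreal C * gamma_variation P \<gamma> M F"
    if "cotype2_constant Q r TYPE('x) C" for C
  proof -
    have "0 \<le> C" using that by (simp add: cotype2_constant_def)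
    have "enn2real (\<integral>\<^sup>+x. ennreal ((norm (\<phi> x))\<^sup>2) \<partial>M) \<le> C\<^sup>2 * V\<^sup>2"
      using enn2real_mono[OF bound[OF that]] by simp
    then have "bochner_L2_norm M \<phi> \<le> sqrt ((C * V)\<^sup>2)"
      unfolding bochner_L2_norm_def by (intro real_sqrt_le_mono) (simp add: power_mult_distrib)
    then have "bochner_L2_norm M \<phi> \<le> C * V" using V(1) \<open>0 \<le> C\<close> by simp
    then show ?thesis unfolding V(2) using V(1) \<open>0 \<le> C\<close> by (simp add: ennreal_mult[symmetric] ennreal_leI)
  qed
  ultimately show ?thesis by blast
qed

section \<open>Infinite-dimensional $L^2$ and atoms\<close>

definition measure_atom :: "'s measure \<Rightarrow> 's set \<Rightarrow> bool" where
  "measure_atom M A \<longleftrightarrow> A \<in> sets M \<and> measure M A > 0 \<and>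
     (\<forall>B\<in>sets M. B \<subseteq> A \<longrightarrow> measure M B = 0 \<or> measure M (A - B) = 0)"

definition purely_finitely_atomic :: "'s measure \<Rightarrow> 's set \<Rightarrow> bool" where
  "purely_finitely_atomic M Z \<longleftrightarrow>
     (\<exists>\<A>. finite \<A> \<and> (\<forall>A\<in>\<A>. measure_atom M A) \<and> measure M (Z - \<Union>\<A>) = 0)"

lemma (in finite_measure) measure_atom_subset:
  assumes "measure_atom M A" "B \<in> sets M" "B \<subseteq> A" "measure M B > 0"
  shows "measure_atom M B"
  unfolding measure_atom_def
proof (intro conjI ballI impI)
  fix D assume D: "D \<in> sets M" "D \<subseteq> B"
  show "measure M D = 0 \<or> measure M (B - D) = 0"
  proof (rule ccontr)
    assume neg: "\<not> ?thesis"
    then have "measure M (A - D) = 0" using assms D unfolding measure_atom_def by blast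
    moreover have "measure M (B - D) \<le> measure M (A - D)"
      using assms D by (intro finite_measure_mono) (auto simp: measure_atom_def)
    ultimately show False using neg by (simp add: measure_le_0_iff)
  qed
qed (use assms in auto)

text \<open>From a set that is not finitely atomic, a piece of positive measure can be removed such
  that the rest is still not finitely atomic: an atom, if the set contains one, and otherwise any
  part whose complement in the set also has positive measure. The removed pieces form the
  sequence.\<close>

lemma (in finite_measure) disjoint_sequence_of_not_finitely_atomic:
  assumes "\<not> purely_finitely_atomic M (space M)"
  shows "\<exists>B :: nat \<Rightarrow> 'a set. disjoint_family B \<and> (\<forall>n. B n \<in> sets M \<and> measure M (B n) > 0)"
proof -
  let ?\<Phi> = "\<lambda>Z. Z \<in> sets M \<and> \<not> purely_finitely_atomic M Z"
  have step: "\<exists>Z'. ?\<Phi> Z' \<and> Z' \<subseteq> Z \<and> measure M (Z - Z') > 0" if Z: "?\<Phi> Z" for Z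
  proof (cases "\<exists>B. measure_atom M B \<and> B \<subseteq> Z")
    case True
    then obtain B where B: "measure_atom M B" "B \<subseteq> Z" by auto
    have "\<not> purely_finitely_atomic M (Z - B)"
    proof
      assume "purely_finitely_atomic M (Z - B)"
      then obtain \<A> where \<A>: "finite \<A>" "\<forall>A\<in>\<A>. measure_atom M A" "measure M (Z - B - \<Union>\<A>) = 0"
        by (auto simp: purely_finitely_atomic_def)
      have "Z - \<Union>(insert B \<A>) = Z - B - \<Union>\<A>" by auto
      then have "purely_finitely_atomic M Z"
        unfolding purely_finitely_atomic_def using \<A> B by (intro exI[of _ "insert B \<A>"]) auto
      then show False using Z by simp
    qed
    moreover have "Z - (Z - B) = B" using B by auto
    ultimately show ?thesis using Z B by (intro exI[of _ "Z - B"]) (auto simp: measure_atom_def)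
  next
    case False
    have "measure M Z > 0"
    proof -
      have "measure M Z \<noteq> 0" using Z by (auto simp: purely_finitely_atomic_def dest: spec[of _ "{}"])
      then show ?thesis by (simp add: zero_less_measure_iff)
    qed
    then obtain B where B: "B \<in> sets M" "B \<subseteq> Z" "measure M B \<noteq> 0" "measure M (Z - B) \<noteq> 0"
      using False Z unfolding measure_atom_def by blast
    have "\<not> purely_finitely_atomic M (Z - B)"
    proof
      assume "purely_finitely_atomic M (Z - B)"
      then obtain \<A> where \<A>: "finite \<A>" "\<forall>A\<in>\<A>. measure_atom M A" "measure M (Z - B - \<Union>\<A>) = 0"
        by (auto simp: purely_finitely_atomic_def)
      have sA: "A \<in> sets M" if "A \<in> \<A>" for A using \<A>(2) that by (simp add: measure_atom_def)
      have ZB: "Z - B \<in> sets M" using Z B(1) by (intro sets.Diff) simp_all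
      have ZBA: "(Z - B) \<inter> A \<in> sets M" if "A \<in> \<A>" for A using ZB sA[OF that] by (rule sets.Int)
      have Un: "(\<Union>A\<in>\<A>. (Z - B) \<inter> A) \<in> sets M" using \<A>(1) ZBA by (rule sets.finite_UN)
      have "\<Union>\<A> \<in> sets M" using \<A>(1) sA by (intro sets.finite_Union) auto
      then have rest: "Z - B - \<Union>\<A> \<in> sets M" using ZB by (rule sets.Diff[rotated])
      \<comment> \<open>The covering atoms may stick out of \<open>Z\<close>. If the part of one
        inside \<open>Z - B\<close> had positive measure, it would itself be an atom, but
        \<open>Z\<close> contains none.\<close>
      have null: "measure M ((Z - B) \<inter> A) = 0" if "A \<in> \<A>" for A
      proof (rule ccontr)
        assume "measure M ((Z - B) \<inter> A) \<noteq> 0"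
        then have "measure_atom M ((Z - B) \<inter> A)"
          by (intro measure_atom_subset[OF bspec[OF \<A>(2) that] ZBA[OF that]]) (auto simp: zero_less_measure_iff)
        moreover have "(Z - B) \<inter> A \<subseteq> Z" by auto
        ultimately show False using False by metis
      qed
      have "measure M (Z - B) \<le> measure M ((Z - B - \<Union>\<A>) \<union> (\<Union>A\<in>\<A>. (Z - B) \<inter> A))"
        by (intro finite_measure_mono sets.Un rest Un) auto
      also have "\<dots> \<le> measure M (Z - B - \<Union>\<A>) + measure M (\<Union>A\<in>\<A>. (Z - B) \<inter> A)"
        by (rule measure_Un_le[OF rest Un])
      also have "measure M (\<Union>A\<in>\<A>. (Z - B) \<inter> A) \<le> (\<Sum>A\<in>\<A>. measure M ((Z - B) \<inter> A))"
        by (rule finite_measure_subadditive_finite) (use \<A>(1) ZBA in auto)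
      also have "(\<Sum>A\<in>\<A>. measure M ((Z - B) \<inter> A)) = 0" by (simp add: null)
      finally show False using \<A>(3) B(4) by (simp add: measure_le_0_iff)
    qed
    moreover have "Z - (Z - B) = B" using B by auto
    ultimately show ?thesis using Z B(1-3) by (intro exI[of _ "Z - B"]) (simp add: zero_less_measure_iff sets.Diff)
  qed
  have "\<exists>Z. \<forall>n::nat. ?\<Phi> (Z n) \<and> (Z (Suc n) \<subseteq> Z n \<and> measure M (Z n - Z (Suc n)) > 0)"
  proof (rule dependent_nat_choice)
    show "\<exists>Z. ?\<Phi> Z" using assms by blast
    show "\<exists>Z'. ?\<Phi> Z' \<and> (Z' \<subseteq> Z \<and> measure M (Z - Z') > 0)" if "?\<Phi> Z" for Z and n :: nat
      using step[OF that] by auto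
  qed
  then obtain Z where Z: "\<And>n::nat. Z n \<in> sets M" "\<And>n. Z (Suc n) \<subseteq> Z n" "\<And>n. measure M (Z n - Z (Suc n)) > 0"
    by metis
  have dec: "Z n \<subseteq> Z m" if "m \<le> n" for m n
    using that by (induction n rule: dec_induct) (use Z(2) in auto)
  have "(Z m - Z (Suc m)) \<inter> (Z n - Z (Suc n)) = {}" if "m < n" for m n
    using dec[of "Suc m" n] that by auto
  then have "disjoint_family (\<lambda>n. Z n - Z (Suc n))"
    unfolding disjoint_family_on_def by (metis Int_commute linorder_neqE_nat)
  then show ?thesis using Z by (intro exI[of _ "\<lambda>n. Z n - Z (Suc n)"]) auto
qed

text \<open>One of the finitely many fibres of a simple function meets the atom in positive measure,
  hence fills it up to a null set. The limit of these constants is the value of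
  \<open>f\<close>.\<close>

lemma (in finite_measure) strongly_measurable_constant_on_atom:
  assumes f: "strongly_measurable M f" and A: "measure_atom M A"
  shows "\<exists>c. AE x in M. x \<in> A \<longrightarrow> f x = c"
proof -
  obtain s where s: "\<And>i. simple_function M (s i)" "AE x in M. (\<lambda>i::nat. s i x) \<longlonglongrightarrow> f x"
    using f by (auto simp: strongly_measurable_def)
  have AS: "A \<in> sets M" "measure M A > 0" "A \<subseteq> space M"
    using A sets.sets_into_space by (auto simp: measure_atom_def)
  have "\<exists>c. AE x in M. x \<in> A \<longrightarrow> s i x = c" for i
  proof -
    let ?B = "\<lambda>c. (s i -` {c} \<inter> space M) \<inter> A"
    have B: "?B c \<in> sets M" for c using simple_functionD(2)[OF s(1)] AS by auto
    have fin: "finite (s i ` space M)" using simple_functionD(1)[OF s(1)] .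
    have "\<exists>c\<in>s i ` space M. measure M (?B c) \<noteq> 0"
    proof (rule ccontr)
      assume "\<not> ?thesis"
      then have null: "\<And>c. c \<in> s i ` space M \<Longrightarrow> measure M (?B c) = 0" by blast
      have "measure M A \<le> measure M (\<Union>c\<in>s i ` space M. ?B c)"
        using AS by (intro finite_measure_mono sets.finite_UN fin B) auto
      also have "\<dots> \<le> (\<Sum>c\<in>s i ` space M. measure M (?B c))"
        by (rule finite_measure_subadditive_finite[OF fin]) (use B in blast)
      also have "\<dots> = 0" using null by (intro sum.neutral) blast
      finally show False using AS(2) by simp
    qed
    then obtain c where "measure M (?B c) \<noteq> 0" by auto
    moreover have "measure M (?B c) = 0 \<or> measure M (A - ?B c) = 0"
      using A unfolding measure_atom_def by (elim conjE) (drule bspec[OF _ B[of c]], simp)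
    ultimately have "measure M (A - ?B c) = 0" by simp
    then have "A - ?B c \<in> null_sets M" using AS B[of c] by (auto simp: null_sets_def emeasure_eq_measure)
    then have "AE x in M. x \<notin> A - ?B c" by (rule AE_not_in)
    then have "AE x in M. x \<in> A \<longrightarrow> s i x = c" by eventually_elim auto
    then show ?thesis ..
  qed
  then obtain c where c: "\<And>i. AE x in M. x \<in> A \<longrightarrow> s i x = c i" by metis
  have "AE x in M. x \<in> A \<longrightarrow> f x = lim c"
  proof -
    have "AE x in M. \<forall>i. x \<in> A \<longrightarrow> s i x = c i" by (subst AE_all_countable) (use c in blast)
    with s(2) show ?thesis
      by eventually_elim (auto intro!: limI[symmetric])
  qed
  then show ?thesis ..
qed

lemma exists_nontrivial_homogeneous_solution:
  fixes c :: "'i \<Rightarrow> 'b \<Rightarrow> real"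
  assumes "finite \<A>" "finite I" "card \<A> < card I"
  shows "\<exists>a. (\<exists>i\<in>I. a i \<noteq> 0) \<and> (\<forall>A\<in>\<A>. (\<Sum>i\<in>I. a i * c i A) = 0)"
  using assms
proof (induction \<A> arbitrary: I c)
  case empty
  then have "I \<noteq> {}" by auto
  then show ?case by (intro exI[of _ "\<lambda>_. 1"]) auto
next
  case (insert B \<A>)
  show ?case
  proof (cases "\<forall>i\<in>I. c i B = 0")
    case True
    then have "(\<Sum>i\<in>I. a i * c i B) = 0" for a by simp
    moreover have "\<exists>a. (\<exists>i\<in>I. a i \<noteq> 0) \<and> (\<forall>A\<in>\<A>. (\<Sum>i\<in>I. a i * c i A) = 0)"
      by (rule insert.IH) (use insert in auto)
    ultimately show ?thesis by simp
  next
    case False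
    then obtain j where j: "j \<in> I" "c j B \<noteq> 0" by auto
    \<comment> \<open>Gaussian elimination: equation \<open>B\<close> is solved for the unknown
      \<open>j\<close>, and these are the coefficients after substitution into the other
      equations.\<close>
    let ?c = "\<lambda>i A. c i A - c i B / c j B * c j A"
    let ?I = "I - {j}"
    have "\<exists>a. (\<exists>i\<in>?I. a i \<noteq> 0) \<and> (\<forall>A\<in>\<A>. (\<Sum>i\<in>?I. a i * ?c i A) = 0)"
      by (rule insert.IH) (use insert.prems insert.hyps j in \<open>auto simp: card_Diff_singleton\<close>)
    then obtain a where a: "\<exists>i\<in>?I. a i \<noteq> 0" "\<forall>A\<in>\<A>. (\<Sum>i\<in>?I. a i * ?c i A) = 0"
      by (elim exE conjE)
    define S where "S = (\<Sum>i\<in>?I. a i * (c i B / c j B))"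
    define b where "b = a(j := - S)"
    have sum_b: "(\<Sum>i\<in>I. b i * c i A) = (\<Sum>i\<in>?I. a i * c i A) - S * c j A" for A
    proof -
      have "(\<Sum>i\<in>?I. b i * c i A) = (\<Sum>i\<in>?I. a i * c i A)"
        by (intro sum.cong) (auto simp: b_def)
      then show ?thesis using insert.prems(1) j by (subst sum.remove[of _ j]) (auto simp: b_def)
    qed
    have "(\<Sum>i\<in>I. b i * c i A) = (\<Sum>i\<in>?I. a i * ?c i A)" for A
      unfolding sum_b S_def by (simp add: sum_distrib_right sum_subtractf[symmetric] right_diff_distrib mult.assoc)
    moreover have "(\<Sum>i\<in>?I. a i * ?c i B) = 0" using j by (intro sum.neutral) auto
    ultimately have "\<forall>A\<in>insert B \<A>. (\<Sum>i\<in>I. b i * c i A) = 0" using a(2) by auto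
    moreover have "\<exists>i\<in>I. b i \<noteq> 0" using a(1) by (auto simp: b_def)
    ultimately show ?thesis by blast
  qed
qed

text \<open>Functions are almost everywhere constant on atoms. If finitely many atoms exhausted the
  space, a function would be determined by one number per atom, and one function more than there are
  atoms would force a linear dependence.\<close>

lemma (in finite_measure) infinite_dim_L2_not_finitely_atomic:
  assumes "infinite_dim_L2 M"
  shows "\<not> purely_finitely_atomic M (space M)"
proof
  assume "purely_finitely_atomic M (space M)"
  then obtain \<A> where \<A>: "finite \<A>" "\<forall>A\<in>\<A>. measure_atom M A" "measure M (space M - \<Union>\<A>) = 0"
    by (auto simp: purely_finitely_atomic_def)
  let ?n = "Suc (card \<A>)"
  obtain f :: "nat \<Rightarrow> 'a \<Rightarrow> real" where f: "\<forall>i<?n. f i \<in> bochner_L2 M"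
      "\<forall>a. (AE x in M. (\<Sum>i<?n. a i * f i x) = 0) \<longrightarrow> (\<forall>i<?n. a i = 0)"
    using spec[OF assms[unfolded infinite_dim_L2_def], of ?n] by (elim exE conjE)
  have "\<exists>c. AE x in M. x \<in> A \<longrightarrow> f i x = c" if "i < ?n" "A \<in> \<A>" for i A
    using strongly_measurable_constant_on_atom[of "f i" A] f(1) \<A> that by (auto simp: bochner_L2_def)
  then obtain c where c: "\<And>i A. i < ?n \<Longrightarrow> A \<in> \<A> \<Longrightarrow> AE x in M. x \<in> A \<longrightarrow> f i x = c i A"
    by metis
  obtain a where a: "\<exists>i\<in>{..<?n}. a i \<noteq> 0" "\<forall>A\<in>\<A>. (\<Sum>i<?n. a i * c i A) = 0"
    using exists_nontrivial_homogeneous_solution[OF \<A>(1), of "{..<?n}" c] by auto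
  have sA: "A \<in> sets M" if "A \<in> \<A>" for A using \<A> that by (auto simp: measure_atom_def)
  have "space M - \<Union>\<A> \<in> null_sets M"
    using \<A> sA by (auto simp: null_sets_def emeasure_eq_measure)
  then have "AE x in M. x \<notin> space M - \<Union>\<A>" by (rule AE_not_in)
  moreover have "AE x in M. \<forall>A\<in>\<A>. \<forall>i\<in>{..<?n}. x \<in> A \<longrightarrow> f i x = c i A"
    by (intro AE_finite_allI \<A>(1) finite_lessThan c) simp_all
  ultimately have "AE x in M. (\<Sum>i<?n. a i * f i x) = 0"
    using AE_space
  proof eventually_elim
    case (elim x)
    then obtain A where A: "A \<in> \<A>" "x \<in> A" by auto
    have "(\<Sum>i<?n. a i * f i x) = (\<Sum>i<?n. a i * c i A)"
      using elim(2) A by (intro sum.cong refl) auto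
    then show ?case using a(2) A by simp
  qed
  then have "\<forall>i<?n. a i = 0" using f(2) by (elim allE[of _ a]) (rule mp)
  then show False using a(1) by auto
qed

lemma (in finite_measure) infinite_dim_L2_disjoint_sequence:
  assumes "infinite_dim_L2 M"
  obtains B :: "nat \<Rightarrow> 'a set"
  where "disjoint_family B" "\<And>n. B n \<in> sets M" "\<And>n. measure M (B n) > 0"
  using disjoint_sequence_of_not_finitely_atomic[OF infinite_dim_L2_not_finitely_atomic[OF assms]] by blast

lemma norm_le_gamma_variation:
  assumes "gaussian_sequence P \<gamma>" "0 \<le> V" "gamma_variation P \<gamma> M F \<le> ennreal V" "A \<in> sets M" "measure M A > 0"
  shows "norm (F A) \<le> V * sqrt (measure M A)"
proof -
  have "ennreal ((norm (F A /\<^sub>R sqrt (measure M A)))\<^sup>2) \<le> ennreal (V\<^sup>2)"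
    using gamma_variation_gauss_mean[OF assms(1-3), of "{()}" "\<lambda>_. A"] assms(4,5)
    by (simp add: gauss_mean_single disjoint_family_on_def)
  then have "(norm (F A) / sqrt (measure M A))\<^sup>2 \<le> V\<^sup>2" by (simp add: divide_inverse mult.commute)
  then have "norm (F A) / sqrt (measure M A) \<le> V" using assms(2) by (rule power2_le_imp_le)
  then show ?thesis using assms(5) by (simp add: divide_le_eq)
qed

text \<open>A null set is invisible to the \<gamma>-variation until it is attached to a set of
  positive measure. \<open>F A\<close> is the difference of the values at \<open>B n\<close> with
  \<open>A\<close> added and with \<open>A\<close> removed; both are of order
  \<open>sqrt (measure M (B n))\<close>, which tends to 0 along a disjoint sequence.\<close>

lemma (in finite_measure) vanishes_on_null_sets_of_infinite_dim:
  fixes F :: "'a set \<Rightarrow> 'x::real_normed_vector"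
  assumes \<gamma>: "gaussian_sequence P \<gamma>" and F: "vector_measure M F" "bounded_gamma_variation P \<gamma> M F"
    and "infinite_dim_L2 M"
  shows "vanishes_on_null_sets M F"
  unfolding vanishes_on_null_sets_def
proof
  fix A assume A: "A \<in> null_sets M"
  obtain B :: "nat \<Rightarrow> 'a set" where B: "disjoint_family B" "\<And>n. B n \<in> sets M" "\<And>n. measure M (B n) > 0"
    using infinite_dim_L2_disjoint_sequence[OF assms(4)] by blast
  define V where "V = enn2real (gamma_variation P \<gamma> M F)"
  have V: "0 \<le> V" "gamma_variation P \<gamma> M F \<le> ennreal V"
    using F(2) by (auto simp: V_def bounded_gamma_variation_def)
  have "(\<lambda>n. measure M (B n)) \<longlonglongrightarrow> 0"
    using finite_measure_UNION[of B] B by (intro summable_LIMSEQ_zero sums_summable) auto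
  then have "(\<lambda>n. 2 * (V * sqrt (measure M (B n)))) \<longlonglongrightarrow> 2 * (V * sqrt 0)"
    by (intro tendsto_intros)
  moreover have "norm (F A) \<le> 2 * (V * sqrt (measure M (B n)))" for n
  proof -
    have [simp]: "measure M (B n - A) = measure M (B n)" "measure M (B n \<union> A) = measure M (B n)"
      using A B(2) by (auto simp: measure_Diff_null_set measure_Un_null_set)
    have AM: "A \<in> sets M" using A by auto
    have "F (B n - A \<union> A) = F (B n - A) + F A"
      using AM B by (intro vector_measure_Un[OF F(1)]) auto
    then have "norm (F A) = norm (F (B n - A \<union> A) - F (B n - A))" by simp
    also have "\<dots> \<le> norm (F (B n - A \<union> A)) + norm (F (B n - A))" by (rule norm_triangle_ineq4)
    also have "\<dots> \<le> V * sqrt (measure M (B n)) + V * sqrt (measure M (B n))"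
      using norm_le_gamma_variation[OF \<gamma> V, of "B n - A \<union> A"] norm_le_gamma_variation[OF \<gamma> V, of "B n - A"] AM B
      by (intro add_mono) auto
    finally show ?thesis by simp
  qed
  ultimately have "norm (F A) \<le> 0"
    by (intro LIMSEQ_le_const[of "\<lambda>n. 2 * (V * sqrt (measure M (B n)))"]) auto
  then show "F A = 0" by simp
qed

section \<open>Gaussian cotype from representability\<close>

text \<open>Cauchy-Schwarz for counting measure with the weights left free: geometric ones serve for
  series of Gaussian families, inverse squares for the layers of a Gaussian sum.\<close>

lemma weighted_Cauchy_Schwarz_suminf:
  fixes b w :: "nat \<Rightarrow> real"
  assumes "\<And>k. w k > 0"
  shows "(\<Sum>k. ennreal \<bar>b k\<bar>)\<^sup>2 \<le> (\<Sum>k. ennreal (w k)) * (\<Sum>k. ennreal ((b k)\<^sup>2 / w k))"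
proof -
  have "(\<integral>\<^sup>+k. ennreal (sqrt (w k)) * ennreal (\<bar>b k\<bar> / sqrt (w k)) \<partial>count_space UNIV)\<^sup>2
      \<le> (\<integral>\<^sup>+k. (ennreal (sqrt (w k)))\<^sup>2 \<partial>count_space UNIV) * (\<integral>\<^sup>+k. (ennreal (\<bar>b k\<bar> / sqrt (w k)))\<^sup>2 \<partial>count_space UNIV)"
    by (rule Cauchy_Schwarz_nn_integral) auto
  moreover have "ennreal (sqrt (w k)) * ennreal (\<bar>b k\<bar> / sqrt (w k)) = ennreal \<bar>b k\<bar>" for k
    using assms[of k] by (simp add: ennreal_mult[symmetric])
  moreover have "(ennreal (sqrt (w k)))\<^sup>2 = ennreal (w k)" for k
    using assms[of k] by (simp add: ennreal_power)
  moreover have "(ennreal (\<bar>b k\<bar> / sqrt (w k)))\<^sup>2 = ennreal ((b k)\<^sup>2 / w k)" for k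
    using assms[of k] by (simp add: ennreal_power power_divide)
  ultimately show ?thesis by (simp add: nn_integral_count_space_nat)
qed

lemma ennreal_norm_suminf_le:
  fixes z :: "nat \<Rightarrow> 'x::real_normed_vector"
  assumes "z sums s"
  shows "ennreal (norm s) \<le> (\<Sum>k. ennreal (norm (z k)))"
proof -
  have lim: "(\<lambda>n. ennreal (norm (\<Sum>k<n. z k))) \<longlonglongrightarrow> ennreal (norm s)"
    using assms unfolding sums_def by (intro tendsto_ennrealI tendsto_norm)
  have le: "ennreal (norm (\<Sum>k<n. z k)) \<le> (\<Sum>k. ennreal (norm (z k)))" for n
  proof -
    have "ennreal (norm (\<Sum>k<n. z k)) \<le> ennreal (\<Sum>k<n. norm (z k))"
      by (intro ennreal_leI norm_sum)
    also have "\<dots> = (\<Sum>k<n. ennreal (norm (z k)))" by (rule sum_ennreal[symmetric]) simp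
    also have "\<dots> \<le> (\<Sum>k. ennreal (norm (z k)))" by (rule sum_le_suminf) auto
    finally show ?thesis .
  qed
  show ?thesis by (rule LIMSEQ_le_const2[OF lim]) (use le in blast)
qed

lemma suminf_ennreal_half_power: "(\<Sum>k. ennreal ((1/2) ^ k)) = 2"
proof -
  have "(\<Sum>k. ennreal ((1/2) ^ k)) = ennreal (\<Sum>k. (1/2) ^ k)"
    by (rule suminf_ennreal2) (auto intro: summable_geometric)
  also have "(\<Sum>k. (1/2) ^ k) = (2 :: real)" by (subst suminf_geometric) auto
  finally show ?thesis by simp
qed

text \<open>Pointwise Cauchy-Schwarz with the weights \<open>(1/2) ^ k\<close>: their sum gives the
  factor 2, their inverses the factors \<open>2 ^ k\<close>.\<close>

lemma gauss_mean_sums_le: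
  assumes "finite I" "\<And>i. i \<in> I \<Longrightarrow> (\<lambda>k. z k i) sums x i"
  shows "gauss_mean I x 0 \<le> 2 * (\<Sum>k. ennreal (2 ^ k) * gauss_mean I (z k) 0)"
proof -
  let ?Z = "\<lambda>t k. \<Sum>i\<in>I. t i *\<^sub>R z k i"
  have m: "(\<lambda>t. ennreal ((norm (?Z t k))\<^sup>2)) \<in> borel_measurable (PiM I (\<lambda>_. std_normal))" for k
    using borel_measurable_gauss_integrand[OF assms(1), of 0 "z k"] by simp
  have m': "(\<lambda>t. ennreal (2 ^ k) * ennreal ((norm (?Z t k))\<^sup>2)) \<in> borel_measurable (PiM I (\<lambda>_. std_normal))" for k
    by (rule borel_measurable_times_ennreal[OF borel_measurable_const m])
  have "gauss_mean I x 0 \<le> (\<integral>\<^sup>+t. 2 * (\<Sum>k. ennreal (2 ^ k) * ennreal ((norm (?Z t k))\<^sup>2)) \<partial>PiM I (\<lambda>_. std_normal))"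
    unfolding gauss_mean_def
  proof (intro nn_integral_mono)
    fix t :: "'a \<Rightarrow> real"
    let ?s = "\<Sum>i\<in>I. t i *\<^sub>R x i"
    have "?Z t sums ?s"
      by (intro sums_sum sums_scaleR_right assms)
    then have "(ennreal (norm ?s))\<^sup>2 \<le> (\<Sum>k. ennreal \<bar>norm (?Z t k)\<bar>)\<^sup>2"
      unfolding abs_norm_cancel by (intro power_mono ennreal_norm_suminf_le zero_le)
    also have "\<dots> \<le> (\<Sum>k. ennreal ((1/2) ^ k)) * (\<Sum>k. ennreal ((norm (?Z t k))\<^sup>2 / (1/2) ^ k))"
      by (rule weighted_Cauchy_Schwarz_suminf) simp
    also have "(\<lambda>k. ennreal ((norm (?Z t k))\<^sup>2 / (1/2) ^ k)) = (\<lambda>k. ennreal (2 ^ k) * ennreal ((norm (?Z t k))\<^sup>2))"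
    proof
      fix k
      have "r / (1/2) ^ k = 2 ^ k * r" for r :: real by (simp add: power_divide)
      then show "ennreal ((norm (?Z t k))\<^sup>2 / (1/2) ^ k) = ennreal (2 ^ k) * ennreal ((norm (?Z t k))\<^sup>2)"
        by (simp only: ennreal_mult' zero_le_power zero_le_numeral)
    qed
    finally show "ennreal ((norm (0 + ?s))\<^sup>2) \<le> 2 * (\<Sum>k. ennreal (2 ^ k) * ennreal ((norm (?Z t k))\<^sup>2))"
      by (simp only: suminf_ennreal_half_power ennreal_power norm_ge_zero add_0_left)
  qed
  also have "\<dots> = 2 * (\<Sum>k. \<integral>\<^sup>+t. ennreal (2 ^ k) * ennreal ((norm (?Z t k))\<^sup>2) \<partial>PiM I (\<lambda>_. std_normal))"
    by (simp only: nn_integral_cmult[OF borel_measurable_suminf_order[OF m']] nn_integral_suminf[OF m'])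
  also have "\<dots> = 2 * (\<Sum>k. ennreal (2 ^ k) * gauss_mean I (z k) 0)"
    unfolding gauss_mean_def by (simp add: nn_integral_cmult m)
  finally show ?thesis .
qed

text \<open>On the common refinement, indexed by \<open>J \<times> K\<close>, the family
  \<open>y\<close> depends on the second index only, and its conditional expectation given the first
  index has the averages over the \<open>B j\<close> as values. Conditional expectation contracts,
  and merging equal vectors identifies both Gaussian means.\<close>

lemma (in finite_measure) gauss_mean_partition_contraction:
  fixes y :: "'n \<Rightarrow> 'x::real_normed_vector"
  assumes "finite K" "finite J"
    and A: "\<And>n. n \<in> K \<Longrightarrow> A n \<in> sets M" "disjoint_family_on A K" "(\<Union>n\<in>K. A n) = space M"
    and B: "\<And>j. j \<in> J \<Longrightarrow> B j \<in> sets M" "disjoint_family_on B J" "(\<Union>j\<in>J. B j) = space M"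
  shows "gauss_mean J (\<lambda>j. (\<Sum>n\<in>K. measure M (B j \<inter> A n) *\<^sub>R y n) /\<^sub>R sqrt (measure M (B j))) 0
     \<le> gauss_mean K (\<lambda>n. sqrt (measure M (A n)) *\<^sub>R y n) 0"
proof (cases "K = {} \<or> J = {}")
  case True
  then show ?thesis by (auto simp: gauss_mean_empty gauss_mean_def)
next
  case False
  let ?I = "J \<times> K"
  let ?w = "\<lambda>(j, n). measure M (B j \<inter> A n)"
  let ?z = "\<lambda>j. (\<Sum>n\<in>K. measure M (B j \<inter> A n) *\<^sub>R y n) /\<^sub>R measure M (B j)"
  have I: "finite ?I" using assms by simp
  have images: "snd ` ?I = K" "fst ` ?I = J" using False by auto
  have sumA: "(\<Sum>j\<in>J. measure M (B j \<inter> A n)) = measure M (A n)" if "n \<in> K" for n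
  proof -
    have "A n \<subseteq> space M" using A that sets.sets_into_space by auto
    then have "A n = (\<Union>j\<in>J. B j \<inter> A n)" using B(3) by auto
    moreover have "measure M (\<Union>j\<in>J. B j \<inter> A n) = (\<Sum>j\<in>J. measure M (B j \<inter> A n))"
    proof (rule finite_measure_finite_Union[OF assms(2)])
      show "disjoint_family_on (\<lambda>j. B j \<inter> A n) J"
        using B(2) unfolding disjoint_family_on_def by blast
    qed (use A(1) B(1) that in auto)
    ultimately show ?thesis by simp
  qed
  have sumB: "(\<Sum>n\<in>K. measure M (B j \<inter> A n)) = measure M (B j)" if "j \<in> J" for j
  proof -
    have "B j \<subseteq> space M" using B that sets.sets_into_space by auto
    then have "B j = (\<Union>n\<in>K. B j \<inter> A n)" using A(3) by auto
    moreover have "measure M (\<Union>n\<in>K. B j \<inter> A n) = (\<Sum>n\<in>K. measure M (B j \<inter> A n))"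
    proof (rule finite_measure_finite_Union[OF assms(1)])
      show "disjoint_family_on (\<lambda>n. B j \<inter> A n) K"
        using A(2) unfolding disjoint_family_on_def by blast
    qed (use A(1) B(1) that in auto)
    ultimately show ?thesis by simp
  qed
  have fib_snd: "{i \<in> ?I. snd i = n} = (\<lambda>j. (j, n)) ` J" if "n \<in> K" for n using that by auto
  have fib_fst: "{i \<in> ?I. fst i = j} = Pair j ` K" if "j \<in> J" for j using that by auto
  have sum_snd: "(\<Sum>i\<in>{i \<in> ?I. snd i = n}. ?w i) = measure M (A n)" if "n \<in> K" for n
    unfolding fib_snd[OF that] using sumA[OF that] by (simp add: sum.reindex inj_on_def)
  have sum_fst: "(\<Sum>i\<in>{i \<in> ?I. fst i = j}. ?w i) = measure M (B j)" if "j \<in> J" for j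
    unfolding fib_fst[OF that] using sumB[OF that] by (simp add: sum.reindex inj_on_def)
  have sum_fst_y: "(\<Sum>i\<in>{i \<in> ?I. fst i = j}. ?w i *\<^sub>R y (snd i)) = (\<Sum>n\<in>K. measure M (B j \<inter> A n) *\<^sub>R y n)" if "j \<in> J" for j
    unfolding fib_fst[OF that] by (simp add: sum.reindex inj_on_def)
  have w0: "?w i \<ge> 0" for i by (simp add: split_beta)
  have sq: "(sqrt (?w i))\<^sup>2 = ?w i" for i using w0 by simp
  have "gauss_mean J (\<lambda>j. (\<Sum>n\<in>K. measure M (B j \<inter> A n) *\<^sub>R y n) /\<^sub>R sqrt (measure M (B j))) 0
      = gauss_mean J (\<lambda>j. sqrt (\<Sum>i\<in>{i \<in> ?I. fst i = j}. (sqrt (?w i))\<^sup>2) *\<^sub>R ?z j) 0"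
  proof (intro gauss_mean_cong refl)
    fix j assume "j \<in> J"
    have "sqrt a * inverse a = inverse (sqrt a)" if "a \<ge> 0" for a :: real
      using that by (cases "a = 0") (auto simp: field_simps)
    then show "(\<Sum>n\<in>K. measure M (B j \<inter> A n) *\<^sub>R y n) /\<^sub>R sqrt (measure M (B j))
        = sqrt (\<Sum>i\<in>{i \<in> ?I. fst i = j}. (sqrt (?w i))\<^sup>2) *\<^sub>R ?z j"
      by (simp only: sq sum_fst[OF \<open>j \<in> J\<close>]) simp
  qed
  also have "\<dots> = gauss_mean ?I (\<lambda>i. sqrt (?w i) *\<^sub>R ?z (fst i)) 0"
    using gauss_mean_merge[OF I, of "\<lambda>i. sqrt (?w i)" ?z fst 0] w0 by (simp only: images real_sqrt_ge_0_iff)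
  also have "\<dots> = gauss_mean ?I (\<lambda>i. sqrt (?w i) *\<^sub>R weighted_mean ?I ?w fst (\<lambda>i. y (snd i)) i) 0"
  proof (intro gauss_mean_cong refl)
    fix i assume "i \<in> ?I"
    then have "fst i \<in> J" by auto
    then show "sqrt (?w i) *\<^sub>R ?z (fst i) = sqrt (?w i) *\<^sub>R weighted_mean ?I ?w fst (\<lambda>i. y (snd i)) i"
      by (simp only: weighted_mean_def sum_fst sum_fst_y)
  qed
  also have "\<dots> \<le> gauss_mean ?I (\<lambda>i. sqrt (?w i) *\<^sub>R y (snd i)) 0"
    by (rule gauss_mean_weighted_mean_le[OF I w0])
  also have "\<dots> = gauss_mean K (\<lambda>n. sqrt (\<Sum>i\<in>{i \<in> ?I. snd i = n}. (sqrt (?w i))\<^sup>2) *\<^sub>R y n) 0"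
    using gauss_mean_merge[OF I, of "\<lambda>i. sqrt (?w i)" y snd 0] w0 by (simp only: images real_sqrt_ge_0_iff)
  also have "\<dots> = gauss_mean K (\<lambda>n. sqrt (measure M (A n)) *\<^sub>R y n) 0"
    by (intro gauss_mean_cong refl) (simp only: sq sum_snd)
  finally show ?thesis .
qed

text \<open>The indefinite integral of the step function with value
  \<open>x n /\<^sub>R sqrt (measure M (A n))\<close> on \<open>A n\<close>, at least for disjoint
  sets of positive measure. The scaling makes \<open>x n\<close> the vector that \<open>A n\<close>
  contributes to a sum in the \<gamma>-variation.\<close>

definition step_measure :: "'s measure \<Rightarrow> nat \<Rightarrow> (nat \<Rightarrow> 's set) \<Rightarrow> (nat \<Rightarrow> 'x::real_normed_vector) \<Rightarrow> 's set \<Rightarrow> 'x" where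
  "step_measure M N A x E = (\<Sum>n<N. (measure M (E \<inter> A n) / sqrt (measure M (A n))) *\<^sub>R x n)"

text \<open>The quotients of the step measure by the measures of the \<open>B j\<close> are
  conditional means of a step density, so no disjoint family produces a larger Gaussian mean than
  the one the measure was built from.\<close>

lemma (in finite_measure) step_measure_gauss_mean_le:
  fixes N J :: nat and x :: "nat \<Rightarrow> 'x::real_normed_vector"
  assumes A: "\<And>n. n < N \<Longrightarrow> A n \<in> sets M" "disjoint_family_on A {..<N}" "\<And>n. n < N \<Longrightarrow> measure M (A n) > 0"
    and B: "\<And>j. j < J \<Longrightarrow> B j \<in> sets M" "disjoint_family_on B {..<J}"
  shows "gauss_mean {..<J} (\<lambda>j. step_measure M N A x (B j) /\<^sub>R sqrt (measure M (B j))) 0 \<le> gauss_mean {..<N} x 0"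
proof -
  \<comment> \<open>Complements are added as cells number \<open>N\<close> and \<open>J\<close>,
    with density value \<open>y N = 0\<close>, so that both families become partitions of the
    space.\<close>
  define A' where "A' n = (if n < N then A n else space M - (\<Union>n<N. A n))" for n
  define B' where "B' j = (if j < J then B j else space M - (\<Union>j<J. B j))" for j
  define y where "y n = (if n < N then x n /\<^sub>R sqrt (measure M (A n)) else 0)" for n
  have part: "\<And>n. n \<in> {..N} \<Longrightarrow> A' n \<in> sets M" "disjoint_family_on A' {..N}" "(\<Union>n\<in>{..N}. A' n) = space M"
    if A: "\<And>n. n < N \<Longrightarrow> A n \<in> sets M" "disjoint_family_on A {..<N}"
      and A'_def: "\<And>n. A' n = (if n < N then A n else space M - (\<Union>n<N. A n))"
    for A A' :: "nat \<Rightarrow> 'a set" and N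
  proof -
    show "A' n \<in> sets M" if "n \<in> {..N}" for n using A(1) by (auto simp: A'_def intro!: sets.Diff sets.finite_UN)
    show "disjoint_family_on A' {..N}"
      using A(2) unfolding disjoint_family_on_def A'_def by (auto split: if_splits)
    have "A n \<subseteq> space M" if "n < N" for n using A(1)[OF that] sets.sets_into_space by auto
    then show "(\<Union>n\<in>{..N}. A' n) = space M" by (auto simp: A'_def split: if_splits)
  qed
  note pA = part[OF A(1,2) A'_def] and pB = part[OF B B'_def]
  have sum_eq: "(\<Sum>n\<in>{..N}. measure M (E \<inter> A' n) *\<^sub>R y n) = step_measure M N A x E" for E
  proof -
    have "(\<Sum>n\<in>{..N}. measure M (E \<inter> A' n) *\<^sub>R y n) = (\<Sum>n<N. measure M (E \<inter> A' n) *\<^sub>R y n)"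
      by (intro sum.mono_neutral_right) (auto simp: y_def)
    also have "\<dots> = step_measure M N A x E"
      unfolding step_measure_def by (intro sum.cong) (auto simp: A'_def y_def divide_inverse)
    finally show ?thesis .
  qed
  have "gauss_mean {..<J} (\<lambda>j. step_measure M N A x (B j) /\<^sub>R sqrt (measure M (B j))) 0
      = gauss_mean {..<J} (\<lambda>j. step_measure M N A x (B' j) /\<^sub>R sqrt (measure M (B' j))) 0"
    by (intro gauss_mean_cong) (auto simp: B'_def)
  also have "\<dots> \<le> gauss_mean {..J} (\<lambda>j. step_measure M N A x (B' j) /\<^sub>R sqrt (measure M (B' j))) 0"
    by (intro gauss_mean_mono) auto
  also have "\<dots> \<le> gauss_mean {..N} (\<lambda>n. sqrt (measure M (A' n)) *\<^sub>R y n) 0"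
    using gauss_mean_partition_contraction[OF _ _ pA pB, of y] by (simp add: sum_eq)
  also have "\<dots> = gauss_mean (insert N {..<N}) (\<lambda>n. if n < N then x n else 0) 0"
  proof (intro arg_cong3[where f = gauss_mean] refl)
    show "{..N} = insert N {..<N}" by auto
    show "(\<lambda>n. sqrt (measure M (A' n)) *\<^sub>R y n) = (\<lambda>n. if n < N then x n else 0)"
    proof
      fix n
      show "sqrt (measure M (A' n)) *\<^sub>R y n = (if n < N then x n else 0)"
        using A(3)[of n] by (auto simp: A'_def y_def)
    qed
  qed
  also have "\<dots> = gauss_mean {..<N} x 0"
    by (subst gauss_mean_insert_zero) (auto intro: gauss_mean_cong)
  finally show ?thesis .
qed

lemma (in finite_measure) norm_step_measure_le:
  assumes A: "\<And>n. n < N \<Longrightarrow> A n \<in> sets M" "disjoint_family_on A {..<N}" "\<And>n. n < N \<Longrightarrow> measure M (A n) > 0"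
    and E: "E \<in> sets M" and g: "gauss_mean {..<N} x 0 \<le> ennreal (c\<^sup>2)" "c \<ge> 0"
  shows "norm (step_measure M N A x E) \<le> c * sqrt (measure M E)"
proof (cases "measure M E = 0")
  case True
  have "measure M (E \<inter> A n) = 0" for n
    using finite_measure_mono[OF _ E, of "E \<inter> A n"] True by (simp add: measure_le_0_iff)
  then show ?thesis using g by (simp add: step_measure_def)
next
  case False
  then have pos: "measure M E > 0" by (simp add: zero_less_measure_iff)
  have one: "{..<1::nat} = {0}" by auto
  have "gauss_mean {..<1::nat} (\<lambda>j. step_measure M N A x E /\<^sub>R sqrt (measure M E)) 0 \<le> gauss_mean {..<N} x 0"
    by (rule step_measure_gauss_mean_le[OF A]) (use E in \<open>auto simp: disjoint_family_on_def\<close>)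
  then have "gauss_mean {0::nat} (\<lambda>j. step_measure M N A x E /\<^sub>R sqrt (measure M E)) 0 \<le> ennreal (c\<^sup>2)"
    unfolding one using g(1) by (rule order_trans)
  then have "(norm (step_measure M N A x E /\<^sub>R sqrt (measure M E)))\<^sup>2 \<le> c\<^sup>2"
    by (simp add: gauss_mean_single)
  then have "norm (step_measure M N A x E /\<^sub>R sqrt (measure M E)) \<le> c"
    using g(2) by (rule power2_le_imp_le)
  then show ?thesis using pos by (simp add: field_simps)
qed

lemma (in finite_measure) step_measure_Un:
  assumes "\<And>n. n < N \<Longrightarrow> A n \<in> sets M" "E \<in> sets M" "E' \<in> sets M" "E \<inter> E' = {}"
  shows "step_measure M N A x (E \<union> E') = step_measure M N A x E + step_measure M N A x E'"
proof -
  have "measure M ((E \<union> E') \<inter> A n) = measure M (E \<inter> A n) + measure M (E' \<inter> A n)" if "n < N" for n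
    unfolding Int_Un_distrib2 using assms that by (intro finite_measure_Union) auto
  then show ?thesis
    unfolding step_measure_def sum.distrib[symmetric]
    by (intro sum.cong) (auto simp: add_divide_distrib scaleR_add_left)
qed

text \<open>The tails of a disjoint sequence have measures tending to 0, and the bound transfers
  this to \<open>F\<close>. This upgrades finite to countable additivity.\<close>

lemma (in finite_measure) vector_measure_of_additive:
  assumes Un: "\<And>E E'. E \<in> sets M \<Longrightarrow> E' \<in> sets M \<Longrightarrow> E \<inter> E' = {} \<Longrightarrow> F (E \<union> E') = F E + F E'"
    and bound: "\<And>E. E \<in> sets M \<Longrightarrow> norm (F E) \<le> c * sqrt (measure M E)"
  shows "vector_measure M F"
  unfolding vector_measure_def
proof (intro allI impI)
  fix A :: "nat \<Rightarrow> 'a set"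
  assume A: "range A \<subseteq> sets M" "disjoint_family A"
  define T where "T n = (\<Union>i\<in>{n..}. A i)" for n
  have T: "T n \<in> sets M" for n using A by (auto simp: T_def)
  have T_split: "T n = A n \<union> T (Suc n)" for n
  proof -
    have "{n..} = insert n {Suc n..}" by auto
    then show ?thesis by (simp add: T_def)
  qed
  have T_disj: "A n \<inter> T (Suc n) = {}" for n
  proof -
    have "A n \<inter> A i = {}" if "Suc n \<le> i" for i
      using that by (intro disjoint_family_onD[OF A(2)]) auto
    then show ?thesis by (auto simp: T_def)
  qed
  have AM: "A n \<in> sets M" for n using A(1) by auto
  have sT: "(\<Sum>i<n. F (A i)) + F (T n) = F (\<Union>i. A i)" for n
  proof (induction n)
    case (Suc n)
    have "F (T n) = F (A n) + F (T (Suc n))"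
      using Un[OF AM T T_disj, of n] by (simp only: T_split[symmetric])
    then show ?case using Suc by (simp add: add.assoc)
  qed (simp add: T_def)
  have mT: "(\<Sum>i<n. measure M (A i)) + measure M (T n) = measure M (\<Union>i. A i)" for n
  proof (induction n)
    case (Suc n)
    have "measure M (T n) = measure M (A n) + measure M (T (Suc n))"
      using finite_measure_Union[OF AM T T_disj, of n] by (simp only: T_split[symmetric])
    then show ?case using Suc by simp
  qed (simp add: T_def)
  have "(\<lambda>n. \<Sum>i<n. measure M (A i)) \<longlonglongrightarrow> measure M (\<Union>i. A i)"
    using finite_measure_UNION[OF A] by (simp add: sums_def)
  then have "(\<lambda>n. measure M (\<Union>i. A i) - (\<Sum>i<n. measure M (A i))) \<longlonglongrightarrow> measure M (\<Union>i. A i) - measure M (\<Union>i. A i)"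
    by (intro tendsto_intros)
  moreover have "measure M (\<Union>i. A i) - (\<Sum>i<n. measure M (A i)) = measure M (T n)" for n
    using mT[of n] by simp
  ultimately have "(\<lambda>n. measure M (T n)) \<longlonglongrightarrow> 0" by simp
  then have "(\<lambda>n. c * sqrt (measure M (T n))) \<longlonglongrightarrow> c * sqrt 0"
    by (intro tendsto_intros)
  then have "(\<lambda>n. c * sqrt (measure M (T n))) \<longlonglongrightarrow> 0" by simp
  then have "(\<lambda>n. F (T n)) \<longlonglongrightarrow> 0"
    by (rule Lim_null_comparison[rotated]) (simp add: bound T)
  then have "(\<lambda>n. F (\<Union>i. A i) - F (T n)) \<longlonglongrightarrow> F (\<Union>i. A i) - 0"
    by (intro tendsto_intros)
  moreover have "F (\<Union>i. A i) - F (T n) = (\<Sum>i<n. F (A i))" for n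
    using sT[of n] by (simp add: algebra_simps)
  ultimately show "(\<lambda>n. F (A n)) sums F (\<Union>n. A n)" by (simp add: sums_def)
qed

text \<open>Strong measurability is an almost everywhere notion, so the norm itself need not be
  Borel measurable. The version \<open>g\<close> is, and additivity of \<open>nn_integral\<close>
  and Cauchy-Schwarz can be applied to it.\<close>

lemma strongly_measurable_norm:
  assumes "strongly_measurable M f"
  obtains g :: "'s \<Rightarrow> real" where "g \<in> borel_measurable M" "AE x in M. norm (f x) = g x"
proof -
  obtain s where s: "\<And>i. simple_function M (s i)" "AE x in M. (\<lambda>i::nat. s i x) \<longlonglongrightarrow> f x"
    using assms by (auto simp: strongly_measurable_def)
  define g where "g x = lim (\<lambda>i. norm (s i x))" for x
  have "(\<lambda>x. norm (s i x)) \<in> borel_measurable M" for i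
    by (intro borel_measurable_simple_function simple_function_compose1[OF s(1)])
  then have "g \<in> borel_measurable M"
    unfolding g_def by (rule borel_measurable_lim_metric)
  moreover have "AE x in M. norm (f x) = g x"
    using s(2) unfolding g_def by eventually_elim (intro limI[symmetric] tendsto_norm)
  ultimately show ?thesis by (rule that)
qed

lemma strongly_measurable_diff_simple:
  assumes "strongly_measurable M f" "simple_function M s"
  shows "strongly_measurable M (\<lambda>x. f x - s x)"
proof -
  obtain h where h: "\<And>i. simple_function M (h i)" "AE x in M. (\<lambda>i::nat. h i x) \<longlonglongrightarrow> f x"
    using assms by (auto simp: strongly_measurable_def)
  have "simple_function M (\<lambda>x. h i x - s x)" for i
    by (rule simple_function_compose2[OF h(1) assms(2)])
  moreover have "AE x in M. (\<lambda>i. h i x - s x) \<longlonglongrightarrow> f x - s x"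
    using h(2) by eventually_elim (intro tendsto_intros)
  ultimately show ?thesis
    unfolding strongly_measurable_def by (intro exI[of _ "\<lambda>i x. h i x - s x"] conjI allI)
qed

lemma has_strong_bochner_integral_norm_le:
  assumes I: "has_strong_bochner_integral M f I" and g: "g \<in> borel_measurable M" "AE x in M. norm (f x) = g x"
  shows "ennreal (norm I) \<le> (\<integral>\<^sup>+x. ennreal (g x) \<partial>M)"
proof -
  have f: "strongly_measurable M f" using I by (simp add: has_strong_bochner_integral_def)
  obtain s where s: "\<And>i. Bochner_Integration.simple_bochner_integrable M (s i)"
      "(\<lambda>i::nat. \<integral>\<^sup>+x. ennreal (norm (f x - s i x)) \<partial>M) \<longlonglongrightarrow> 0"
      "(\<lambda>i. Bochner_Integration.simple_bochner_integral M (s i)) \<longlonglongrightarrow> I"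
    using I unfolding has_strong_bochner_integral_def by blast
  have "ennreal (norm (Bochner_Integration.simple_bochner_integral M (s i)))
      \<le> (\<integral>\<^sup>+x. ennreal (g x) \<partial>M) + (\<integral>\<^sup>+x. ennreal (norm (f x - s i x)) \<partial>M)" for i
  proof -
    have si: "simple_function M (s i)" using s(1)[of i] by (auto elim: simple_bochner_integrable.cases)
    obtain h where h: "h \<in> borel_measurable M" "AE x in M. norm (f x - s i x) = h x"
      using strongly_measurable_norm[OF strongly_measurable_diff_simple[OF f si]] by blast
    have "Bochner_Integration.simple_bochner_integrable M (\<lambda>x. norm (s i x))"
      by (rule simple_bochner_integrable_compose2[OF _ s(1) s(1), of "\<lambda>a b. norm a"]) simp
    then have "ennreal (norm (Bochner_Integration.simple_bochner_integral M (s i))) \<le> (\<integral>\<^sup>+x. ennreal (norm (s i x)) \<partial>M)"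
      using simple_bochner_integral_norm_bound[OF s(1)[of i]]
      by (subst simple_bochner_integral_eq_nn_integral[symmetric]) (auto intro: ennreal_leI)
    also have "\<dots> \<le> (\<integral>\<^sup>+x. ennreal (g x) + ennreal (h x) \<partial>M)"
      using g(2) h(2)
    proof (intro nn_integral_mono_AE, eventually_elim)
      case (elim x)
      have "norm (s i x) \<le> norm (f x) + norm (f x - s i x)"
        by (metis add.commute norm_minus_commute norm_triangle_sub)
      then have "ennreal (norm (s i x)) \<le> ennreal (norm (f x) + norm (f x - s i x))" by (rule ennreal_leI)
      also have "\<dots> = ennreal (norm (f x)) + ennreal (norm (f x - s i x))" by (rule ennreal_plus) auto
      finally show ?case by (simp only: elim)
    qed
    also have "\<dots> = (\<integral>\<^sup>+x. ennreal (g x) \<partial>M) + (\<integral>\<^sup>+x. ennreal (h x) \<partial>M)"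
      using g(1) h(1) by (intro nn_integral_add) auto
    also have "(\<integral>\<^sup>+x. ennreal (h x) \<partial>M) = (\<integral>\<^sup>+x. ennreal (norm (f x - s i x)) \<partial>M)"
      using h(2) by (intro nn_integral_cong_AE) auto
    finally show ?thesis .
  qed
  moreover have "(\<lambda>i. ennreal (norm (Bochner_Integration.simple_bochner_integral M (s i)))) \<longlonglongrightarrow> ennreal (norm I)"
    by (intro tendsto_ennrealI tendsto_norm s)
  moreover have "(\<lambda>i. (\<integral>\<^sup>+x. ennreal (g x) \<partial>M) + (\<integral>\<^sup>+x. ennreal (norm (f x - s i x)) \<partial>M)) \<longlonglongrightarrow> (\<integral>\<^sup>+x. ennreal (g x) \<partial>M) + 0"
    by (intro tendsto_add tendsto_const s)
  ultimately show ?thesis by (auto intro: LIMSEQ_le)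
qed

lemma represents_norm_le:
  assumes "represents M \<phi> F" "A \<in> sets M" and g: "g \<in> borel_measurable M" "AE x in M. norm (\<phi> x) = g x"
  shows "ennreal ((norm (F A))\<^sup>2) \<le> emeasure M A * (\<integral>\<^sup>+x. indicator A x * ennreal ((g x)\<^sup>2) \<partial>M)"
proof -
  have "ennreal (norm (F A)) \<le> (\<integral>\<^sup>+x. ennreal (indicator A x * g x) \<partial>M)"
  proof (rule has_strong_bochner_integral_norm_le)
    show "has_strong_bochner_integral M (\<lambda>x. indicator A x *\<^sub>R \<phi> x) (F A)"
      using assms(1,2) by (simp add: represents_def)
    show "(\<lambda>x. indicator A x * g x) \<in> borel_measurable M" using assms(2) g(1) by measurable
    show "AE x in M. norm (indicator A x *\<^sub>R \<phi> x) = indicator A x * g x"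
      using g(2) by eventually_elim (auto simp: indicator_def)
  qed
  \<comment> \<open>The indicator is doubled so that Cauchy-Schwarz yields the measure of
    \<open>A\<close> in one factor and an integral restricted to \<open>A\<close> in the
    other.\<close>
  also have "\<dots> = (\<integral>\<^sup>+x. indicator A x * (indicator A x * ennreal (g x)) \<partial>M)"
    by (intro nn_integral_cong) (auto simp: indicator_def)
  finally have "(ennreal (norm (F A)))\<^sup>2 \<le> (\<integral>\<^sup>+x. indicator A x * (indicator A x * ennreal (g x)) \<partial>M)\<^sup>2"
    by (rule power_mono) simp
  also have "\<dots> \<le> (\<integral>\<^sup>+x. (indicator A x)\<^sup>2 \<partial>M) * (\<integral>\<^sup>+x. (indicator A x * ennreal (g x))\<^sup>2 \<partial>M)"
    using assms(2) g(1) by (intro Cauchy_Schwarz_nn_integral) auto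
  also have "(\<integral>\<^sup>+x. (indicator A x)\<^sup>2 \<partial>M) = emeasure M A"
  proof -
    have "(\<integral>\<^sup>+x. (indicator A x)\<^sup>2 \<partial>M) = (\<integral>\<^sup>+x. indicator A x \<partial>M)"
      by (intro nn_integral_cong) (auto simp: indicator_def)
    then show ?thesis using assms(2) by simp
  qed
  also have "(\<integral>\<^sup>+x. (indicator A x * ennreal (g x))\<^sup>2 \<partial>M) = (\<integral>\<^sup>+x. indicator A x * ennreal ((g x)\<^sup>2) \<partial>M)"
    using g(2)
  proof (intro nn_integral_cong_AE, eventually_elim)
    case (elim x)
    then have "g x \<ge> 0" by (metis norm_ge_zero)
    then show ?case by (auto simp: indicator_def ennreal_power)
  qed
  finally show ?thesis by (simp add: ennreal_power)
qed

section \<open>A measure of bounded \<gamma>-variation without square integrable density\<close>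

lemma gauss_mean_eq_ennreal:
  assumes "finite I"
  shows "gauss_mean I x 0 = ennreal (enn2real (gauss_mean I x 0))"
  using gauss_mean_finite[OF assms, of x] by simp

lemma not_gauss_cotype_normalized:
  fixes x :: "nat \<Rightarrow> 'x::real_normed_vector"
  assumes "\<not> ennreal (\<Sum>n<N. (norm (x n))\<^sup>2) \<le> ennreal D * gauss_mean {..<N} x 0" "D > 0"
  shows "\<exists>y :: nat \<Rightarrow> 'x. (\<Sum>n<N. (norm (y n))\<^sup>2) = 1 \<and> gauss_mean {..<N} y 0 \<le> ennreal (1 / D)"
proof -
  define T where "T = (\<Sum>n<N. (norm (x n))\<^sup>2)"
  define G where "G = enn2real (gauss_mean {..<N} x 0)"
  have G: "gauss_mean {..<N} x 0 = ennreal G" "G \<ge> 0"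
    unfolding G_def by (rule gauss_mean_eq_ennreal) auto
  have T0: "T \<ge> 0" unfolding T_def by (intro sum_nonneg) auto
  have "\<not> T \<le> D * G"
    using assms(1) T0 unfolding G(1) T_def[symmetric] using \<open>D > 0\<close> G(2)
    by (simp add: ennreal_mult[symmetric] ennreal_leI)
  then have T: "D * G < T" "T > 0" using G(2) \<open>D > 0\<close> mult_nonneg_nonneg[of D G] by linarith+
  define c where "c = 1 / sqrt T"
  have c: "c\<^sup>2 = 1 / T" using T by (simp add: c_def power_divide)
  have "(\<Sum>n<N. (norm (c *\<^sub>R x n))\<^sup>2) = c\<^sup>2 * T"
    by (simp add: T_def sum_distrib_left power_mult_distrib)
  then have one: "(\<Sum>n<N. (norm (c *\<^sub>R x n))\<^sup>2) = 1" using c T by simp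
  have "gauss_mean {..<N} (\<lambda>n. c *\<^sub>R x n) 0 = ennreal (c\<^sup>2) * gauss_mean {..<N} x 0"
    using gauss_mean_scale[of "{..<N}" c x 0] by simp
  also have "\<dots> = ennreal (G / T)" unfolding G(1) c using G(2) T by (simp add: ennreal_mult[symmetric])
  also have "\<dots> \<le> ennreal (1 / D)" using T \<open>D > 0\<close> by (intro ennreal_leI) (simp add: field_simps)
  finally show ?thesis using one by (intro exI[of _ "\<lambda>n. c *\<^sub>R x n"] conjI)
qed

text \<open>Without Gaussian cotype, block \<open>k\<close> can have squared norms summing to 1 and
  yet be negligible for the \<gamma>-variation. A density would pay 1 for each of infinitely many
  blocks, on disjoint sets.\<close>

lemma (in finite_measure) gauss_cotype_of_representation:
  fixes P :: "'w measure"
  assumes \<gamma>: "gaussian_sequence P \<gamma>" and inf: "infinite_dim_L2 M"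
    and rep: "\<And>F :: 'a set \<Rightarrow> 'x::banach. vector_measure M F \<Longrightarrow> bounded_gamma_variation P \<gamma> M F \<Longrightarrow>
      \<exists>\<phi>\<in>bochner_L2 M. represents M \<phi> F"
  shows "\<exists>D>0. \<forall>N (x :: nat \<Rightarrow> 'x). ennreal (\<Sum>n<N. (norm (x n))\<^sup>2) \<le> ennreal D * gauss_mean {..<N} x 0"
proof (rule ccontr)
  assume neg: "\<not> ?thesis"
  \<comment> \<open>\<open>1 / 16 ^ k\<close> is the square of \<open>(1/4) ^ k\<close>, which makes
    the values of the blocks summable, and it outweighs the factor \<open>2 ^ k\<close> in
    \<open>gauss_mean_sums_le\<close>.\<close>
  have "\<exists>N (u :: nat \<Rightarrow> 'x). (\<Sum>n<N. (norm (u n))\<^sup>2) = 1 \<and> gauss_mean {..<N} u 0 \<le> ennreal (1 / 16 ^ k)" for k :: nat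
  proof -
    have "(16 :: real) ^ k > 0" by simp
    then obtain N and x :: "nat \<Rightarrow> 'x" where "\<not> ennreal (\<Sum>n<N. (norm (x n))\<^sup>2) \<le> ennreal (16 ^ k) * gauss_mean {..<N} x 0"
      using neg by meson
    from not_gauss_cotype_normalized[OF this] show ?thesis by auto
  qed
  then obtain N and u :: "nat \<Rightarrow> nat \<Rightarrow> 'x" where u: "\<And>k. (\<Sum>n<N k. (norm (u k n))\<^sup>2) = 1"
      and gu: "\<And>k. gauss_mean {..<N k} (u k) 0 \<le> ennreal (1 / 16 ^ k)"
    by metis
  obtain B :: "nat \<Rightarrow> 'a set" where B: "disjoint_family B" "\<And>n. B n \<in> sets M" "\<And>n. measure M (B n) > 0"
    using infinite_dim_L2_disjoint_sequence[OF inf] by blast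
  \<comment> \<open>A pairing of the natural numbers splits the single disjoint sequence into
    infinitely many disjoint sequences, one for each block.\<close>
  define A where "A k n = B (prod_encode (k, n))" for k n
  have A: "A k n \<in> sets M" "measure M (A k n) > 0" for k n using B by (auto simp: A_def)
  have A_disj: "A k n \<inter> A j m = {}" if "(k, n) \<noteq> (j, m)" for k n j m
    unfolding A_def using that by (intro disjoint_family_onD[OF B(1)]) auto
  have A_disj1: "disjoint_family_on (A k) {..<N k}" for k
    using A_disj unfolding disjoint_family_on_def by blast
  define G where "G k = step_measure M (N k) (A k) (u k)" for k
  have G_norm: "norm (G k E) \<le> (1/4) ^ k * sqrt (measure M E)" if "E \<in> sets M" for k E
    unfolding G_def
  proof (rule norm_step_measure_le[OF A(1) A_disj1 A(2) that])
    have "((1/4) ^ k)\<^sup>2 = (1 / 16 ^ k :: real)"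
      by (simp add: power2_eq_square power_mult_distrib[symmetric] power_one_over)
    then show "gauss_mean {..<N k} (u k) 0 \<le> ennreal (((1/4) ^ k)\<^sup>2)" using gu[of k] by simp
  qed simp
  have G_sum: "summable (\<lambda>k. norm (G k E))" if "E \<in> sets M" for E
  proof (rule summable_comparison_test')
    show "summable (\<lambda>k. (1/4) ^ k * sqrt (measure M E))"
      by (rule summable_mult2[OF summable_geometric]) simp
    show "norm (norm (G k E)) \<le> (1/4) ^ k * sqrt (measure M E)" if "k \<ge> 0" for k
      using G_norm[OF \<open>E \<in> sets M\<close>] by simp
  qed
  define F where "F E = (\<Sum>k. G k E)" for E
  have F_sums: "(\<lambda>k. G k E) sums F E" if "E \<in> sets M" for E
    unfolding F_def by (rule summable_sums[OF summable_norm_cancel[OF G_sum[OF that]]])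
  have F_norm: "norm (F E) \<le> 2 * sqrt (measure M E)" if "E \<in> sets M" for E
  proof -
    have s: "summable (\<lambda>k. (1/4 :: real) ^ k)" by (intro summable_geometric) simp
    have "norm (F E) \<le> (\<Sum>k. norm (G k E))" unfolding F_def by (rule summable_norm[OF G_sum[OF that]])
    also have "\<dots> \<le> (\<Sum>k. (1/4) ^ k * sqrt (measure M E))"
      by (rule suminf_le[OF G_norm[OF that] G_sum[OF that] summable_mult2[OF s]])
    also have "\<dots> = (\<Sum>k. (1/4) ^ k) * sqrt (measure M E)" by (rule suminf_mult2[OF s, symmetric])
    also have "(\<Sum>k. (1/4 :: real) ^ k) = 4 / 3" by (subst suminf_geometric) auto
    also have "4 / 3 * sqrt (measure M E) \<le> 2 * sqrt (measure M E)" by (intro mult_right_mono) auto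
    finally show ?thesis .
  qed
  have F_Un: "F (E \<union> E') = F E + F E'" if "E \<in> sets M" "E' \<in> sets M" "E \<inter> E' = {}" for E E'
  proof -
    have "G k (E \<union> E') = G k E + G k E'" for k
      unfolding G_def using A that by (intro step_measure_Un) auto
    then have "(\<lambda>k. G k (E \<union> E')) sums (F E + F E')"
      using sums_add[OF F_sums F_sums] that by simp
    then show ?thesis using F_sums[of "E \<union> E'"] that sums_unique2 by blast
  qed
  have vm: "vector_measure M F"
    by (rule vector_measure_of_additive[OF F_Un F_norm])
  \<comment> \<open>2 is the square root of 4, the product of the leading factor in
    \<open>gauss_mean_sums_le\<close> and the value 2 of the geometric series.\<close>
  have "gamma_variation P \<gamma> M F \<le> ennreal 2"
    unfolding gamma_variation_le_iff[OF \<gamma> zero_le_numeral]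
  proof (intro allI impI)
    fix J :: nat and E assume E: "disjoint_family_on E {..<J}" "\<forall>j<J. E j \<in> sets M \<and> measure M (E j) > 0"
    have "gauss_mean {..<J} (\<lambda>j. F (E j) /\<^sub>R sqrt (measure M (E j))) 0
        \<le> 2 * (\<Sum>k. ennreal (2 ^ k) * gauss_mean {..<J} (\<lambda>j. G k (E j) /\<^sub>R sqrt (measure M (E j))) 0)"
      using E by (intro gauss_mean_sums_le sums_scaleR_right F_sums) auto
    also have "\<dots> \<le> 2 * (\<Sum>k. ennreal ((1/2) ^ k))"
    proof (intro mult_left_mono suminf_le)
      fix k
      have "gauss_mean {..<J} (\<lambda>j. G k (E j) /\<^sub>R sqrt (measure M (E j))) 0 \<le> gauss_mean {..<N k} (u k) 0"
        unfolding G_def using A A_disj1 E by (intro step_measure_gauss_mean_le) auto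
      also have "\<dots> \<le> ennreal (1 / 16 ^ k)" by (rule gu)
      finally have "ennreal (2 ^ k) * gauss_mean {..<J} (\<lambda>j. G k (E j) /\<^sub>R sqrt (measure M (E j))) 0
          \<le> ennreal (2 ^ k) * ennreal (1 / 16 ^ k)" by (rule mult_left_mono) simp
      also have "\<dots> = ennreal ((1/8) ^ k)"
        by (simp add: ennreal_mult[symmetric] power_divide[symmetric] power_mult_distrib[symmetric])
      also have "\<dots> \<le> ennreal ((1/2) ^ k)" by (intro ennreal_leI power_mono) auto
      finally show "ennreal (2 ^ k) * gauss_mean {..<J} (\<lambda>j. G k (E j) /\<^sub>R sqrt (measure M (E j))) 0 \<le> ennreal ((1/2) ^ k)" .
    qed auto
    also have "\<dots> = ennreal (2\<^sup>2)" by (simp add: suminf_ennreal_half_power)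
    finally show "gauss_mean {..<J} (\<lambda>j. F (E j) /\<^sub>R sqrt (measure M (E j))) 0 \<le> ennreal (2\<^sup>2)" .
  qed
  then have "bounded_gamma_variation P \<gamma> M F"
    unfolding bounded_gamma_variation_def by (rule le_less_trans) simp
  from rep[OF vm this] obtain \<phi> where \<phi>: "\<phi> \<in> bochner_L2 M" "represents M \<phi> F" by blast
  obtain g where g: "g \<in> borel_measurable M" "AE x in M. norm (\<phi> x) = g x"
    using strongly_measurable_norm[of M \<phi>] \<phi>(1) by (auto simp: bochner_L2_def)
  let ?g = "\<lambda>x. ennreal ((g x)\<^sup>2)"
  have g_fin: "(\<integral>\<^sup>+x. ?g x \<partial>M) < \<infinity>"
  proof -
    have "(\<integral>\<^sup>+x. ?g x \<partial>M) = (\<integral>\<^sup>+x. ennreal ((norm (\<phi> x))\<^sup>2) \<partial>M)"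
      using g(2) by (intro nn_integral_cong_AE) auto
    then show ?thesis using \<phi>(1) by (simp add: bochner_L2_def)
  qed
  have FA: "F (A k n) = sqrt (measure M (A k n)) *\<^sub>R u k n" if "n < N k" for k n
  proof -
    have "G j (A k n) = (if j = k then sqrt (measure M (A k n)) *\<^sub>R u k n else 0)" for j
    proof (cases "j = k")
      case True
      have "step_measure M (N k) (A k) (u k) (A k n) =
          (\<Sum>m<N k. if m = n then (measure M (A k n) / sqrt (measure M (A k n))) *\<^sub>R u k n else 0)"
        unfolding step_measure_def using A_disj[of k n k] by (intro sum.cong) auto
      then show ?thesis using True that A(2)[of k n] by (simp add: G_def real_div_sqrt)
    next
      case False
      then have "A k n \<inter> A j m = {}" for m by (intro A_disj) auto
      then show ?thesis using False by (simp add: G_def step_measure_def)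
    qed
    then have "(\<lambda>j. G j (A k n)) sums (sqrt (measure M (A k n)) *\<^sub>R u k n)"
      using sums_single[of k "\<lambda>_. sqrt (measure M (A k n)) *\<^sub>R u k n"] by (simp add: eq_commute)
    then show ?thesis using F_sums[OF A(1)] sums_unique2 by blast
  qed
  have u_le: "ennreal ((norm (u k n))\<^sup>2) \<le> (\<integral>\<^sup>+x. indicator (A k n) x * ?g x \<partial>M)" if "n < N k" for k n
  proof -
    let ?m = "measure M (A k n)"
    have "ennreal ?m * ennreal ((norm (u k n))\<^sup>2) = ennreal ((norm (F (A k n)))\<^sup>2)"
      using A(2)[of k n] by (simp add: FA[OF that] power_mult_distrib ennreal_mult)
    also have "\<dots> \<le> emeasure M (A k n) * (\<integral>\<^sup>+x. indicator (A k n) x * ?g x \<partial>M)"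
      by (rule represents_norm_le[OF \<phi>(2) A(1) g])
    finally show ?thesis
      using A(2)[of k n] by (simp add: emeasure_eq_measure ennreal_mult_le_mult_iff)
  qed
  \<comment> \<open>By \<open>u_le\<close> each vector uses up a part of the integral over its own
    set. These sets are disjoint, and each of the first \<open>K\<close> blocks uses up at least
    1.\<close>
  have K_le: "ennreal (of_nat K) \<le> (\<integral>\<^sup>+x. ?g x \<partial>M)" for K
  proof -
    let ?S = "Sigma {..<K} (\<lambda>k. {..<N k})"
    have "ennreal (of_nat K) = ennreal (\<Sum>k<K. \<Sum>n<N k. (norm (u k n))\<^sup>2)"
      by (simp add: u)
    also have "(\<Sum>k<K. \<Sum>n<N k. (norm (u k n))\<^sup>2) = (\<Sum>p\<in>?S. (norm (u (fst p) (snd p)))\<^sup>2)"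
      by (subst sum.Sigma) (auto simp: split_beta)
    also have "ennreal \<dots> = (\<Sum>p\<in>?S. ennreal ((norm (u (fst p) (snd p)))\<^sup>2))"
      by (rule sum_ennreal[symmetric]) simp
    also have "\<dots> \<le> (\<Sum>p\<in>?S. \<integral>\<^sup>+x. indicator (A (fst p) (snd p)) x * ?g x \<partial>M)"
      by (intro sum_mono u_le) auto
    also have "\<dots> = (\<integral>\<^sup>+x. (\<Sum>p\<in>?S. indicator (A (fst p) (snd p)) x * ?g x) \<partial>M)"
      using A(1) g(1) by (intro nn_integral_sum[symmetric]) auto
    also have "\<dots> = (\<integral>\<^sup>+x. indicator (\<Union>p\<in>?S. A (fst p) (snd p)) x * ?g x \<partial>M)"
    proof (intro nn_integral_cong)
      fix x
      have "(\<Sum>p\<in>?S. indicator (A (fst p) (snd p)) x) = (indicator (\<Union>p\<in>?S. A (fst p) (snd p)) x :: ennreal)"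
      proof (rule indicator_UN_disjoint[symmetric])
        show "disjoint_family_on (\<lambda>p. A (fst p) (snd p)) ?S"
          unfolding disjoint_family_on_def using A_disj by auto
      qed auto
      then show "(\<Sum>p\<in>?S. indicator (A (fst p) (snd p)) x * ?g x) = indicator (\<Union>p\<in>?S. A (fst p) (snd p)) x * ?g x"
        by (simp only: sum_distrib_right[symmetric])
    qed
    also have "\<dots> \<le> (\<integral>\<^sup>+x. ?g x \<partial>M)"
      by (intro nn_integral_mono) (auto simp: indicator_def)
    finally show ?thesis .
  qed
  define R where "R = enn2real (\<integral>\<^sup>+x. ?g x \<partial>M)"
  have R: "(\<integral>\<^sup>+x. ?g x \<partial>M) = ennreal R" "R \<ge> 0" using g_fin by (auto simp: R_def)
  obtain K :: nat where "R < of_nat K" using reals_Archimedean2 by blast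
  with K_le[of K] R show False by (simp add: ennreal_le_iff)
qed

section \<open>From Gaussian to Rademacher cotype\<close>

lemma nn_integral_rademacher:
  assumes r: "rademacher_sequence Q r" and f: "f \<in> borel_measurable borel"
  shows "(\<integral>\<^sup>+\<omega>. f (r n \<omega>) \<partial>Q) = f 1 * ennreal (1/2) + f (- 1) * ennreal (1/2)"
proof -
  interpret prob_space Q using r by (simp add: rademacher_sequence_def)
  note [measurable] = rademacher_sequence_measurable[OF r]
  let ?A = "{\<omega> \<in> space Q. r n \<omega> = 1}" and ?B = "{\<omega> \<in> space Q. r n \<omega> = - 1}"
  have AB: "?A \<in> sets Q" "?B \<in> sets Q" by measurable
  have p: "emeasure Q ?A = ennreal (1/2)" "emeasure Q ?B = ennreal (1/2)"
    using r unfolding rademacher_sequence_def by (simp_all only: emeasure_eq_measure)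
  have "(\<integral>\<^sup>+\<omega>. f (r n \<omega>) \<partial>Q) = (\<integral>\<^sup>+\<omega>. f 1 * indicator ?A \<omega> + f (- 1) * indicator ?B \<omega> \<partial>Q)"
    using rademacher_sequence_AE[OF r] AE_space[of Q]
  proof (intro nn_integral_cong_AE, eventually_elim)
    case (elim \<omega>)
    then have "r n \<omega> = 1 \<or> r n \<omega> = - 1" "\<omega> \<in> space Q" by auto
    then show ?case by (auto simp: indicator_def)
  qed
  also have "\<dots> = f 1 * emeasure Q ?A + f (- 1) * emeasure Q ?B"
    using AB by (subst nn_integral_add) (auto simp: nn_integral_cmult_indicator)
  finally show ?thesis by (simp only: p)
qed

lemma distr_rademacher_uminus:
  assumes r: "rademacher_sequence Q r"
  shows "distr Q borel (\<lambda>\<omega>. - r n \<omega>) = distr Q borel (r n)"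
proof (rule measure_eqI)
  note [measurable] = rademacher_sequence_measurable[OF r]
  fix A assume "A \<in> sets (distr Q borel (\<lambda>\<omega>. - r n \<omega>))"
  then have A[measurable]: "A \<in> sets borel" by simp
  have law: "emeasure (distr Q borel f) A = (\<integral>\<^sup>+\<omega>. indicator A (f \<omega>) \<partial>Q)"
    if [measurable]: "f \<in> borel_measurable Q" for f :: "'a \<Rightarrow> real"
  proof -
    have "emeasure (distr Q borel f) A = (\<integral>\<^sup>+x. indicator A x \<partial>distr Q borel f)" by simp
    then show ?thesis by (subst (asm) nn_integral_distr) auto
  qed
  have "emeasure (distr Q borel (\<lambda>\<omega>. - r n \<omega>)) A = (\<integral>\<^sup>+\<omega>. indicator A (- r n \<omega>) \<partial>Q)"
    by (rule law) measurable
  also have "\<dots> = (\<integral>\<^sup>+\<omega>. indicator A (r n \<omega>) \<partial>Q)"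
    using nn_integral_rademacher[OF r, of "\<lambda>x. indicator A (- x)" n] nn_integral_rademacher[OF r, of "indicator A" n]
    by (simp add: add.commute)
  also have "\<dots> = emeasure (distr Q borel (r n)) A"
    by (rule law[symmetric]) measurable
  finally show "emeasure (distr Q borel (\<lambda>\<omega>. - r n \<omega>)) A = emeasure (distr Q borel (r n)) A" .
qed simp

lemma rademacher_mean_sign:
  assumes r: "rademacher_sequence Q r" and e: "\<And>n. e n \<in> {1, -1}"
  shows "rademacher_mean Q r N (\<lambda>n. e n *\<^sub>R x n) = rademacher_mean Q r N x"
proof -
  interpret prob_space Q using r by (simp add: rademacher_sequence_def)
  have iv: "indep_vars (\<lambda>_. borel) r UNIV" using r by (simp add: rademacher_sequence_def)
  have iv': "indep_vars (\<lambda>_. borel) (\<lambda>n \<omega>. e n * r n \<omega>) UNIV"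
    by (rule indep_vars_compose2[OF iv]) measurable
  have "distr Q borel (\<lambda>\<omega>. e n * r n \<omega>) = distr Q borel (r n)" for n
    using e[of n] distr_rademacher_uminus[OF r, of n] by auto
  then show ?thesis
    using nn_integral_norm_indep_vars[OF prob_space_axioms iv, of "{..<N}" x]
      nn_integral_norm_indep_vars[OF prob_space_axioms iv', of "{..<N}" x]
    by (simp add: rademacher_mean_def mult.commute)
qed

lemma rademacher_mean_cong:
  assumes "\<And>n. n < N \<Longrightarrow> x n = y n"
  shows "rademacher_mean Q r N x = rademacher_mean Q r N y"
  using assms by (simp add: rademacher_mean_def)

lemma norm_convex_combination_power2:
  fixes a b :: "'x::real_normed_vector"
  assumes "0 \<le> c" "c \<le> 1"
  shows "(norm (c *\<^sub>R a + (1 - c) *\<^sub>R b))\<^sup>2 \<le> c * (norm a)\<^sup>2 + (1 - c) * (norm b)\<^sup>2"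
proof -
  have "norm (c *\<^sub>R a + (1 - c) *\<^sub>R b) \<le> c * norm a + (1 - c) * norm b"
    using norm_triangle_ineq[of "c *\<^sub>R a" "(1 - c) *\<^sub>R b"] assms by simp
  then have "(norm (c *\<^sub>R a + (1 - c) *\<^sub>R b))\<^sup>2 \<le> (c * norm a + (1 - c) * norm b)\<^sup>2"
    by (rule power_mono) simp
  also have "\<dots> = c * (norm a)\<^sup>2 + (1 - c) * (norm b)\<^sup>2 - c * (1 - c) * (norm a - norm b)\<^sup>2"
    by algebra
  also have "\<dots> \<le> c * (norm a)\<^sup>2 + (1 - c) * (norm b)\<^sup>2" using assms by simp
  finally show ?thesis .
qed

lemma rademacher_mean_convex:
  assumes r: "rademacher_sequence Q r" and c: "0 \<le> c" "c \<le> 1"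
  shows "rademacher_mean Q r N (\<lambda>n. c *\<^sub>R x n + (1 - c) *\<^sub>R y n)
    \<le> ennreal c * rademacher_mean Q r N x + ennreal (1 - c) * rademacher_mean Q r N y"
proof -
  let ?S = "\<lambda>x \<omega>. \<Sum>n<N. r n \<omega> *\<^sub>R x n"
  note [measurable] = borel_measurable_rademacher_integrand[OF r, of x N] borel_measurable_rademacher_integrand[OF r, of y N]
  have "rademacher_mean Q r N (\<lambda>n. c *\<^sub>R x n + (1 - c) *\<^sub>R y n)
     \<le> (\<integral>\<^sup>+\<omega>. ennreal c * ennreal ((norm (?S x \<omega>))\<^sup>2) + ennreal (1 - c) * ennreal ((norm (?S y \<omega>))\<^sup>2) \<partial>Q)"
    unfolding rademacher_mean_def
  proof (intro nn_integral_mono)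
    fix \<omega>
    have "?S (\<lambda>n. c *\<^sub>R x n + (1 - c) *\<^sub>R y n) \<omega> = c *\<^sub>R ?S x \<omega> + (1 - c) *\<^sub>R ?S y \<omega>"
      by (simp add: scaleR_sum_right sum.distrib[symmetric] scaleR_add_right mult.commute)
    then have "ennreal ((norm (?S (\<lambda>n. c *\<^sub>R x n + (1 - c) *\<^sub>R y n) \<omega>))\<^sup>2)
        \<le> ennreal (c * (norm (?S x \<omega>))\<^sup>2 + (1 - c) * (norm (?S y \<omega>))\<^sup>2)"
      using norm_convex_combination_power2[OF c, of "?S x \<omega>" "?S y \<omega>"] by (simp add: ennreal_leI)
    also have "\<dots> = ennreal c * ennreal ((norm (?S x \<omega>))\<^sup>2) + ennreal (1 - c) * ennreal ((norm (?S y \<omega>))\<^sup>2)"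
      using c by (subst ennreal_plus) (auto simp: ennreal_mult)
    finally show "ennreal ((norm (?S (\<lambda>n. c *\<^sub>R x n + (1 - c) *\<^sub>R y n) \<omega>))\<^sup>2) \<le> \<dots>" .
  qed
  also have "\<dots> = ennreal c * rademacher_mean Q r N x + ennreal (1 - c) * rademacher_mean Q r N y"
    unfolding rademacher_mean_def by (subst nn_integral_add) (auto simp: nn_integral_cmult)
  finally show ?thesis .
qed

text \<open>The contraction principle. A multiplier in the interval from -1 to 1 is a convex
  combination of the signs 1 and -1, with \<open>c = (1 + a J) / 2\<close>; signs leave the mean
  unchanged and the squared norm is convex, so the coordinates are replaced one by one.\<close>

lemma rademacher_mean_contraction_1:
  assumes r: "rademacher_sequence Q r" and a: "\<And>n. n < N \<Longrightarrow> \<bar>a n\<bar> \<le> 1"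
  shows "rademacher_mean Q r N (\<lambda>n. a n *\<^sub>R x n) \<le> rademacher_mean Q r N x"
proof -
  let ?y = "\<lambda>J n. if n < J then a n *\<^sub>R x n else x n"
  have "rademacher_mean Q r N (?y J) \<le> rademacher_mean Q r N x" if "J \<le> N" for J
    using that
  proof (induction J)
    case (Suc J)
    define c where "c = (1 + a J) / 2"
    have c: "0 \<le> c" "c \<le> 1" "c - (1 - c) = a J" using a[of J] Suc by (auto simp: c_def abs_le_iff field_simps)
    let ?e = "\<lambda>n. if n = J then -1 else (1 :: real)"
    have "?y (Suc J) n = c *\<^sub>R ?y J n + (1 - c) *\<^sub>R (?e n *\<^sub>R ?y J n)" for n
    proof (cases "n = J")
      case True
      have "c *\<^sub>R x J + (1 - c) *\<^sub>R (- 1) *\<^sub>R x J = (c - (1 - c)) *\<^sub>R x J"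
        by (simp only: scaleR_diff_left[of c] scaleR_minus1_left scaleR_minus_right add_uminus_conv_diff)
      then show ?thesis using True c(3) by simp
    next
      case False
      then show ?thesis by (auto simp: scaleR_add_left[symmetric] less_Suc_eq)
    qed
    then have "rademacher_mean Q r N (?y (Suc J))
        = rademacher_mean Q r N (\<lambda>n. c *\<^sub>R ?y J n + (1 - c) *\<^sub>R (?e n *\<^sub>R ?y J n))"
      by simp
    also have "\<dots> \<le> ennreal c * rademacher_mean Q r N (?y J) + ennreal (1 - c) * rademacher_mean Q r N (\<lambda>n. ?e n *\<^sub>R ?y J n)"
      by (rule rademacher_mean_convex[OF r c(1,2)])
    also have "rademacher_mean Q r N (\<lambda>n. ?e n *\<^sub>R ?y J n) = rademacher_mean Q r N (?y J)"
      by (rule rademacher_mean_sign[OF r]) auto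
    also have "ennreal c * rademacher_mean Q r N (?y J) + ennreal (1 - c) * rademacher_mean Q r N (?y J)
        = rademacher_mean Q r N (?y J)"
      using c by (simp add: distrib_right[symmetric] ennreal_plus[symmetric] del: ennreal_plus)
    also have "\<dots> \<le> rademacher_mean Q r N x" using Suc by simp
    finally show ?case .
  qed simp
  from this[of N] have "rademacher_mean Q r N (?y N) \<le> rademacher_mean Q r N x" by simp
  moreover have "rademacher_mean Q r N (?y N) = rademacher_mean Q r N (\<lambda>n. a n *\<^sub>R x n)"
    by (intro rademacher_mean_cong) auto
  ultimately show ?thesis by simp
qed

lemma rademacher_mean_contraction:
  assumes r: "rademacher_sequence Q r" and ab: "\<And>n. n < N \<Longrightarrow> \<bar>a n\<bar> \<le> \<bar>b n\<bar>"
  shows "rademacher_mean Q r N (\<lambda>n. a n *\<^sub>R x n) \<le> rademacher_mean Q r N (\<lambda>n. b n *\<^sub>R x n)"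
proof -
  \<comment> \<open>Where \<open>b n = 0\<close> the quotient is 0 by convention and
    \<open>a n = 0\<close> by assumption, so no index has to be excluded.\<close>
  have "\<bar>a n / b n\<bar> \<le> 1" if "n < N" for n using ab[OF that] by (simp add: divide_le_eq)
  from rademacher_mean_contraction_1[OF r this, of N "\<lambda>n. n" "\<lambda>n. b n *\<^sub>R x n"]
  have "rademacher_mean Q r N (\<lambda>n. (a n / b n) *\<^sub>R b n *\<^sub>R x n) \<le> rademacher_mean Q r N (\<lambda>n. b n *\<^sub>R x n)"
    by simp
  moreover have "rademacher_mean Q r N (\<lambda>n. (a n / b n) *\<^sub>R b n *\<^sub>R x n) = rademacher_mean Q r N (\<lambda>n. a n *\<^sub>R x n)"
  proof (rule rademacher_mean_cong)
    fix n assume "n < N"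
    then show "(a n / b n) *\<^sub>R b n *\<^sub>R x n = a n *\<^sub>R x n" using ab[of n] by (cases "b n = 0") auto
  qed
  ultimately show ?thesis by simp
qed

lemma rademacher_mean_scale:
  assumes r: "rademacher_sequence Q r"
  shows "rademacher_mean Q r N (\<lambda>n. c *\<^sub>R x n) = ennreal (c\<^sup>2) * rademacher_mean Q r N x"
proof -
  have "norm (\<Sum>n<N. r n \<omega> *\<^sub>R c *\<^sub>R x n) = \<bar>c\<bar> * norm (\<Sum>n<N. r n \<omega> *\<^sub>R x n)" for \<omega>
  proof -
    have "(\<Sum>n<N. r n \<omega> *\<^sub>R c *\<^sub>R x n) = c *\<^sub>R (\<Sum>n<N. r n \<omega> *\<^sub>R x n)"
      by (simp add: scaleR_sum_right mult.commute)
    then show ?thesis by simp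
  qed
  then show ?thesis
    unfolding rademacher_mean_def using borel_measurable_rademacher_integrand[OF r, of x N]
    by (subst nn_integral_cmult[symmetric]) (auto simp: power_mult_distrib ennreal_mult)
qed

section \<open>Gaussian averages of Rademacher means and labelled index sets\<close>

lemma borel_measurable_rademacher_pair:
  assumes r: "rademacher_sequence Q r" and a: "\<And>n. n < N \<Longrightarrow> a n \<in> borel_measurable M"
  shows "(\<lambda>(p, \<omega>). ennreal ((norm (\<Sum>n<N. r n \<omega> *\<^sub>R a n p *\<^sub>R x n))\<^sup>2)) \<in> borel_measurable (M \<Otimes>\<^sub>M Q)"
proof -
  have "(\<lambda>q. norm (0 + (\<Sum>n<N. (r n (snd q) * a n (fst q)) *\<^sub>R x n))) \<in> borel_measurable (M \<Otimes>\<^sub>M Q)"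
    by (intro borel_measurable_norm_lincomb borel_measurable_times
         measurable_compose[OF measurable_snd rademacher_sequence_measurable[OF r]]
         measurable_compose[OF measurable_fst a]) auto
  then show ?thesis by (simp add: split_beta')
qed

lemma borel_measurable_rademacher_mean:
  assumes r: "rademacher_sequence Q r" and a: "\<And>n. n < N \<Longrightarrow> a n \<in> borel_measurable M"
  shows "(\<lambda>p. rademacher_mean Q r N (\<lambda>n. a n p *\<^sub>R x n)) \<in> borel_measurable M"
proof -
  interpret prob_space Q using r by (simp add: rademacher_sequence_def)
  show ?thesis
    unfolding rademacher_mean_def
    using borel_measurable_nn_integral[OF borel_measurable_rademacher_pair[OF r a]] by simp
qed

text \<open>Multiplying the Gaussian variables by independent signs does not change their joint law,
  so the signs can be averaged first, for fixed Gaussian coefficients.\<close>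

lemma gauss_mean_rademacher_mean:
  assumes r: "rademacher_sequence Q r"
  shows "gauss_mean {..<N} x 0 = (\<integral>\<^sup>+t. rademacher_mean Q r N (\<lambda>n. t n *\<^sub>R x n) \<partial>PiM {..<N} (\<lambda>_. std_normal))"
proof -
  interpret Q: prob_space Q using r by (simp add: rademacher_sequence_def)
  let ?G = "PiM {..<N} (\<lambda>_. std_normal)"
  interpret G: prob_space ?G by (rule prob_space_PiM_std_normal)
  interpret GQ: pair_sigma_finite ?G Q ..
  have m: "(\<lambda>(t, \<omega>). ennreal ((norm (\<Sum>n<N. r n \<omega> *\<^sub>R t n *\<^sub>R x n))\<^sup>2)) \<in> borel_measurable (?G \<Otimes>\<^sub>M Q)"
    by (rule borel_measurable_rademacher_pair[OF r]) (simp add: measurable_PiM_std_normal_component)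
  have "(\<integral>\<^sup>+t. rademacher_mean Q r N (\<lambda>n. t n *\<^sub>R x n) \<partial>?G)
      = (\<integral>\<^sup>+\<omega>. \<integral>\<^sup>+t. ennreal ((norm (\<Sum>n<N. r n \<omega> *\<^sub>R t n *\<^sub>R x n))\<^sup>2) \<partial>?G \<partial>Q)"
    unfolding rademacher_mean_def by (rule GQ.Fubini'[symmetric, OF m])
  also have "\<dots> = (\<integral>\<^sup>+\<omega>. gauss_mean {..<N} (\<lambda>n. r n \<omega> *\<^sub>R x n) 0 \<partial>Q)"
    by (simp add: gauss_mean_def mult.commute)
  also have "\<dots> = (\<integral>\<^sup>+\<omega>. gauss_mean {..<N} x 0 \<partial>Q)"
    using rademacher_sequence_AE[OF r]
    by (intro nn_integral_cong_AE, eventually_elim) (intro gauss_mean_sign; simp)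
  also have "\<dots> = gauss_mean {..<N} x 0" by (simp add: Q.emeasure_space_1)
  finally show ?thesis ..
qed

text \<open>The integrand is a smooth upper bound for the maximum of the squares
  \<open>(t j)\<^sup>2\<close>, and 3 is the fourth moment of a standard Gaussian.\<close>

lemma nn_integral_fourth_powers:
  assumes "a > 0"
  shows "(\<integral>\<^sup>+t. ennreal (a + (\<Sum>j<m. t j ^ 4) / a) \<partial>PiM {..<m} (\<lambda>_. std_normal)) = ennreal (a + 3 * real m / a)"
proof -
  let ?G = "PiM {..<m} (\<lambda>_. std_normal)"
  interpret G: prob_space ?G by (rule prob_space_PiM_std_normal)
  have comp: "(\<lambda>t. t j) \<in> borel_measurable ?G" if "j < m" for j
    using that by (intro measurable_PiM_std_normal_component) simp
  have m4: "(\<lambda>t. ennreal (t j ^ 4)) \<in> borel_measurable ?G" if "j < m" for j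
    using comp[OF that] by measurable
  have int4: "(\<integral>\<^sup>+t. ennreal (t j ^ 4) \<partial>?G) = 3" if "j < m" for j
  proof -
    have "distr ?G std_normal (\<lambda>t. t j) = std_normal"
      using that by (intro distr_PiM_component prob_space_std_normal) auto
    then have "(\<integral>\<^sup>+a. ennreal (a ^ 4) \<partial>std_normal) = (\<integral>\<^sup>+a. ennreal (a ^ 4) \<partial>distr ?G std_normal (\<lambda>t. t j))"
      by simp
    also have "\<dots> = (\<integral>\<^sup>+t. ennreal (t j ^ 4) \<partial>?G)"
      using comp[OF that] by (subst nn_integral_distr) auto
    finally show ?thesis using nn_integral_std_normal_power_even[of 2] by (simp add: fact_numeral)
  qed
  have "(\<integral>\<^sup>+t. ennreal (a + (\<Sum>j<m. t j ^ 4) / a) \<partial>?G)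
      = (\<integral>\<^sup>+t. ennreal a + ennreal (1 / a) * (\<Sum>j<m. ennreal (t j ^ 4)) \<partial>?G)"
  proof (intro nn_integral_cong)
    fix t :: "nat \<Rightarrow> real"
    have "ennreal (a + (\<Sum>j<m. t j ^ 4) / a) = ennreal a + ennreal (1 / a * (\<Sum>j<m. t j ^ 4))"
      using assms by (subst ennreal_plus[symmetric]) (auto intro!: divide_nonneg_pos sum_nonneg)
    also have "ennreal (1 / a * (\<Sum>j<m. t j ^ 4)) = ennreal (1 / a) * (\<Sum>j<m. ennreal (t j ^ 4))"
      using assms by (subst ennreal_mult') (auto simp: sum_ennreal)
    finally show "ennreal (a + (\<Sum>j<m. t j ^ 4) / a) = ennreal a + ennreal (1 / a) * (\<Sum>j<m. ennreal (t j ^ 4))" .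
  qed
  also have "\<dots> = ennreal a + ennreal (1 / a) * (\<Sum>j<m. \<integral>\<^sup>+t. ennreal (t j ^ 4) \<partial>?G)"
    using m4 by (subst nn_integral_add) (auto simp: nn_integral_cmult nn_integral_sum G.emeasure_space_1 simp del: sum_ennreal)
  also have "(\<Sum>j<m. \<integral>\<^sup>+t. ennreal (t j ^ 4) \<partial>?G) = ennreal (3 * real m)"
    using int4 by (simp add: ennreal_mult ennreal_of_nat_eq_real_of_nat mult.commute)
  also have "ennreal a + ennreal (1 / a) * ennreal (3 * real m) = ennreal (a + 3 * real m / a)"
    using assms by (subst ennreal_mult[symmetric]) (auto simp: ennreal_plus[symmetric] simp del: ennreal_plus)
  finally show ?thesis .
qed

text \<open>For fixed signs, Gaussian cotype is applied to the class sums. All indices of a class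
  then share one Gaussian coefficient, and contraction extracts a bound for the largest square,
  whose mean is at most \<open>a + 3 * real m / a\<close>. For \<open>a\<close> of order
  \<open>sqrt m\<close> the \<open>m\<close> classes together cost only order
  \<open>sqrt m\<close>.\<close>

lemma sum_rademacher_mean_labels_le:
  fixes x :: "nat \<Rightarrow> 'x::real_normed_vector" and l :: "nat \<Rightarrow> nat"
  assumes r: "rademacher_sequence Q r" and "a > 0"
    and D: "\<And>N (x :: nat \<Rightarrow> 'x). ennreal (\<Sum>n<N. (norm (x n))\<^sup>2) \<le> ennreal D * gauss_mean {..<N} x 0"
  shows "(\<Sum>j<m. rademacher_mean Q r N (\<lambda>n. if l n = j then x n else 0))
    \<le> ennreal D * (ennreal (a + 3 * real m / a) * rademacher_mean Q r N x)"
proof -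
  interpret Q: prob_space Q using r by (simp add: rademacher_sequence_def)
  let ?G = "PiM {..<m} (\<lambda>_. std_normal)"
  interpret G: prob_space ?G by (rule prob_space_PiM_std_normal)
  interpret GQ: pair_sigma_finite ?G Q ..
  let ?y = "\<lambda>\<omega> j. \<Sum>n<N. r n \<omega> *\<^sub>R (if l n = j then x n else 0)"
  let ?c = "\<lambda>n t. if l n < m then t (l n) else 0"
  have c_meas: "?c n \<in> borel_measurable ?G" for n
    by (cases "l n < m") (auto intro: measurable_PiM_std_normal_component)
  have swap: "(\<Sum>j<m. t j *\<^sub>R ?y \<omega> j) = (\<Sum>n<N. r n \<omega> *\<^sub>R ?c n t *\<^sub>R x n)" for t :: "nat \<Rightarrow> real" and \<omega>
  proof -
    have "(\<Sum>j<m. t j *\<^sub>R ?y \<omega> j) = (\<Sum>n<N. \<Sum>j<m. t j *\<^sub>R r n \<omega> *\<^sub>R (if l n = j then x n else 0))"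
      by (simp only: scaleR_sum_right sum.swap[of _ "{..<m}"])
    also have "\<dots> = (\<Sum>n<N. r n \<omega> *\<^sub>R ?c n t *\<^sub>R x n)"
    proof (intro sum.cong refl)
      fix n
      have "(\<Sum>j<m. t j *\<^sub>R r n \<omega> *\<^sub>R (if l n = j then x n else 0))
          = (\<Sum>j<m. if l n = j then (t j * r n \<omega>) *\<^sub>R x n else 0)"
        by (intro sum.cong) auto
      then show "(\<Sum>j<m. t j *\<^sub>R r n \<omega> *\<^sub>R (if l n = j then x n else 0)) = r n \<omega> *\<^sub>R ?c n t *\<^sub>R x n"
        by (simp add: mult.commute)
    qed
    finally show ?thesis .
  qed
  have pair: "(\<lambda>(t, \<omega>). ennreal ((norm (\<Sum>n<N. r n \<omega> *\<^sub>R ?c n t *\<^sub>R x n))\<^sup>2)) \<in> borel_measurable (?G \<Otimes>\<^sub>M Q)"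
    by (rule borel_measurable_rademacher_pair[OF r c_meas])
  have "(\<Sum>j<m. rademacher_mean Q r N (\<lambda>n. if l n = j then x n else 0))
      = (\<integral>\<^sup>+\<omega>. (\<Sum>j<m. ennreal ((norm (?y \<omega> j))\<^sup>2)) \<partial>Q)"
    unfolding rademacher_mean_def
    by (intro nn_integral_sum[symmetric] measurable_compose[OF _ measurable_ennreal] borel_measurable_power
        borel_measurable_rademacher_integrand[OF r])
  also have "\<dots> \<le> (\<integral>\<^sup>+\<omega>. ennreal D * (\<integral>\<^sup>+t. ennreal ((norm (\<Sum>n<N. r n \<omega> *\<^sub>R ?c n t *\<^sub>R x n))\<^sup>2) \<partial>?G) \<partial>Q)"
  proof (intro nn_integral_mono)
    fix \<omega>
    have "(\<Sum>j<m. ennreal ((norm (?y \<omega> j))\<^sup>2)) = ennreal (\<Sum>j<m. (norm (?y \<omega> j))\<^sup>2)"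
      by (rule sum_ennreal) simp
    also have "\<dots> \<le> ennreal D * gauss_mean {..<m} (?y \<omega>) 0" by (rule D)
    finally show "(\<Sum>j<m. ennreal ((norm (?y \<omega> j))\<^sup>2))
        \<le> ennreal D * (\<integral>\<^sup>+t. ennreal ((norm (\<Sum>n<N. r n \<omega> *\<^sub>R ?c n t *\<^sub>R x n))\<^sup>2) \<partial>?G)"
      by (simp only: gauss_mean_def swap add_0_left)
  qed
  also have "\<dots> = ennreal D * (\<integral>\<^sup>+\<omega>. \<integral>\<^sup>+t. ennreal ((norm (\<Sum>n<N. r n \<omega> *\<^sub>R ?c n t *\<^sub>R x n))\<^sup>2) \<partial>?G \<partial>Q)"
    using G.borel_measurable_nn_integral_fst[OF measurable_pair_swap[OF pair]] by (intro nn_integral_cmult) simp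
  also have "(\<integral>\<^sup>+\<omega>. \<integral>\<^sup>+t. ennreal ((norm (\<Sum>n<N. r n \<omega> *\<^sub>R ?c n t *\<^sub>R x n))\<^sup>2) \<partial>?G \<partial>Q)
      = (\<integral>\<^sup>+t. rademacher_mean Q r N (\<lambda>n. ?c n t *\<^sub>R x n) \<partial>?G)"
    unfolding rademacher_mean_def by (rule GQ.Fubini'[OF pair])
  also have "\<dots> \<le> (\<integral>\<^sup>+t. ennreal (a + (\<Sum>j<m. t j ^ 4) / a) * rademacher_mean Q r N x \<partial>?G)"
  proof (intro nn_integral_mono)
    fix t :: "nat \<Rightarrow> real"
    define b where "b = a + (\<Sum>j<m. t j ^ 4) / a"
    have b0: "b \<ge> 0" using \<open>a > 0\<close> by (auto simp: b_def intro!: add_nonneg_nonneg divide_nonneg_pos sum_nonneg)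
    have "\<bar>?c n t\<bar> \<le> \<bar>sqrt b\<bar>" for n
    proof (cases "l n < m")
      case True
      let ?s = "t (l n)"
      have "?s ^ 4 \<le> (\<Sum>j<m. t j ^ 4)" using True by (intro member_le_sum) auto
      then have "a + ?s ^ 4 / a \<le> b" using \<open>a > 0\<close> by (simp add: b_def divide_right_mono)
      \<comment> \<open>a bound for the maximum of the squares by a sum of fourth powers\<close>
      moreover have "?s\<^sup>2 \<le> a + ?s ^ 4 / a"
      proof -
        have "0 \<le> (a - ?s\<^sup>2)\<^sup>2 + a * ?s\<^sup>2" using \<open>a > 0\<close> by simp
        also have "\<dots> = a * a + ?s ^ 4 - a * ?s\<^sup>2" by algebra
        finally have "a * ?s\<^sup>2 \<le> a * a + ?s ^ 4" by simp
        then show ?thesis using \<open>a > 0\<close> by (simp add: field_simps)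
      qed
      ultimately have "?s\<^sup>2 \<le> b" by linarith
      then have "sqrt (?s\<^sup>2) \<le> sqrt b" by (rule real_sqrt_le_mono)
      then show ?thesis using True b0 by simp
    qed simp
    then have "rademacher_mean Q r N (\<lambda>n. ?c n t *\<^sub>R x n) \<le> rademacher_mean Q r N (\<lambda>n. sqrt b *\<^sub>R x n)"
      by (intro rademacher_mean_contraction[OF r])
    also have "\<dots> = ennreal b * rademacher_mean Q r N x"
      unfolding rademacher_mean_scale[OF r] using b0 by simp
    finally show "rademacher_mean Q r N (\<lambda>n. ?c n t *\<^sub>R x n) \<le> ennreal (a + (\<Sum>j<m. t j ^ 4) / a) * rademacher_mean Q r N x"
      by (simp only: b_def)
  qed
  also have "\<dots> = ennreal (a + 3 * real m / a) * rademacher_mean Q r N x"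
  proof -
    have "(\<lambda>t. \<Sum>j<m. t j ^ 4) \<in> borel_measurable ?G"
      by (intro borel_measurable_sum borel_measurable_power measurable_PiM_std_normal_component) simp
    then have "(\<lambda>t. ennreal (a + (\<Sum>j<m. t j ^ 4) / a)) \<in> borel_measurable ?G" by measurable
    then show ?thesis by (simp only: nn_integral_multc nn_integral_fourth_powers[OF \<open>a > 0\<close>])
  qed
  finally show ?thesis by (simp add: mult_left_mono)
qed

text \<open>Both laws are Bernoulli with the same parameter. The target \<open>std_normal\<close>
  stands for the Borel sigma-algebra; with this choice the integrand defined on the Gaussian product
  can be integrated against either law.\<close>

lemma distr_indicator_eq:
  fixes \<nu>1 \<nu>2 :: "real measure"
  assumes "prob_space \<nu>1" "prob_space \<nu>2" and S: "sets \<nu>1 = sets borel" "sets \<nu>2 = sets borel"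
    and A: "A1 \<in> sets borel" "A2 \<in> sets borel" and eq: "measure \<nu>1 A1 = measure \<nu>2 A2"
  shows "distr \<nu>1 std_normal (indicator A1) = distr \<nu>2 std_normal (indicator A2)"
proof (rule measure_eqI)
  have law: "emeasure (distr \<nu> std_normal (indicator A)) B =
      ennreal (indicator B 1 * measure \<nu> A + indicator B 0 * (1 - measure \<nu> A))"
    if "prob_space \<nu>" "sets \<nu> = sets borel" "A \<in> sets borel" "B \<in> sets borel" for \<nu> :: "real measure" and A B
  proof -
    interpret prob_space \<nu> by fact
    have A: "A \<in> sets \<nu>" using that by simp
    have sp: "space \<nu> = UNIV" using that(2) sets_eq_imp_space_eq[of \<nu> borel] by simp
    have f: "indicator A \<in> borel_measurable \<nu>" using A by simp
    have "emeasure (distr \<nu> std_normal (indicator A)) B = emeasure \<nu> (indicator A -` B \<inter> space \<nu>)"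
      using f that(4) by (subst emeasure_distr) auto
    also have "indicator A -` B \<inter> space \<nu> = (if (1::real) \<in> B then A else {}) \<union> (if (0::real) \<in> B then space \<nu> - A else {})"
    proof (rule set_eqI)
      fix x
      show "x \<in> indicator A -` B \<inter> space \<nu> \<longleftrightarrow>
          x \<in> (if (1::real) \<in> B then A else {}) \<union> (if (0::real) \<in> B then space \<nu> - A else {})"
        by (cases "x \<in> A") (auto simp: sp)
    qed
    also have "emeasure \<nu> \<dots> = ennreal (measure \<nu> ((if (1::real) \<in> B then A else {}) \<union> (if (0::real) \<in> B then space \<nu> - A else {})))"
      by (rule emeasure_eq_measure)
    also have "measure \<nu> ((if (1::real) \<in> B then A else {}) \<union> (if (0::real) \<in> B then space \<nu> - A else {})) =
        measure \<nu> (if (1::real) \<in> B then A else {}) + measure \<nu> (if (0::real) \<in> B then space \<nu> - A else {})"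
      using A by (intro finite_measure_Union) auto
    also have "\<dots> = indicator B 1 * measure \<nu> A + indicator B 0 * (1 - measure \<nu> A)"
      using prob_compl[OF A] by (auto simp: indicator_def)
    finally show ?thesis .
  qed
  fix B assume "B \<in> sets (distr \<nu>1 std_normal (indicator A1))"
  then have "B \<in> sets borel" by simp
  then show "emeasure (distr \<nu>1 std_normal (indicator A1)) B = emeasure (distr \<nu>2 std_normal (indicator A2)) B"
    using law[OF assms(1) S(1) A(1)] law[OF assms(2) S(2) A(2)] eq by simp
qed simp

lemma nn_integral_PiM_indicator:
  fixes \<nu> :: "real measure" and \<Phi> :: "('i \<Rightarrow> real) \<Rightarrow> ennreal"
  assumes "prob_space \<nu>" and S: "sets \<nu> = sets borel" and A: "A \<in> sets borel" and "finite I"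
    and \<Phi>: "\<Phi> \<in> borel_measurable (PiM I (\<lambda>_. std_normal))"
  shows "(\<integral>\<^sup>+t. \<Phi> (\<lambda>i\<in>I. indicator A (t i)) \<partial>PiM I (\<lambda>_. \<nu>))
    = (\<integral>\<^sup>+t. \<Phi> t \<partial>PiM I (\<lambda>_. distr \<nu> std_normal (indicator A)))"
proof -
  have ind: "indicator A \<in> measurable \<nu> std_normal"
    using A S by (simp add: measurable_cong_sets[OF S])
  have "compose I (indicator A) \<in> measurable (PiM I (\<lambda>_. \<nu>)) (PiM I (\<lambda>_. std_normal))"
    unfolding compose_def
  proof (rule measurable_restrict)
    fix i assume "i \<in> I"
    then have "(\<lambda>t. t i) \<in> measurable (PiM I (\<lambda>_. \<nu>)) \<nu>" by (rule measurable_component_singleton)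
    then show "(\<lambda>t. indicator A (t i)) \<in> measurable (PiM I (\<lambda>_. \<nu>)) std_normal"
      by (rule measurable_compose[OF _ ind])
  qed
  then have "(\<integral>\<^sup>+t. \<Phi> t \<partial>distr (PiM I (\<lambda>_. \<nu>)) (PiM I (\<lambda>_. std_normal)) (compose I (indicator A)))
      = (\<integral>\<^sup>+t. \<Phi> (compose I (indicator A) t) \<partial>PiM I (\<lambda>_. \<nu>))"
    by (rule nn_integral_distr) (use \<Phi> in simp)
  moreover have "distr (PiM I (\<lambda>_. \<nu>)) (PiM I (\<lambda>_. std_normal)) (compose I (indicator A))
      = PiM I (\<lambda>_. distr \<nu> std_normal (indicator A))"
    by (rule distr_PiM_finite_prob_space'[OF assms(4)]) (use assms(1) prob_space_std_normal ind in auto)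
  ultimately show ?thesis by (simp add: compose_def)
qed

text \<open>Markov's inequality for the eighth moment, which is 105. The threshold is doubled
  because \<open>2 ^ 8 = 256\<close> then absorbs this constant.\<close>

lemma std_normal_tail:
  assumes "k > 0"
  shows "measure std_normal {t. \<bar>t\<bar> > 2 * real k} \<le> 1 / real k ^ 8"
proof -
  let ?A = "{t :: real. \<bar>t\<bar> > 2 * real k}"
  have A: "?A \<in> sets std_normal" by simp
  have "emeasure std_normal ?A = (\<integral>\<^sup>+t. indicator ?A t \<partial>std_normal)" using A by simp
  also have "\<dots> \<le> (\<integral>\<^sup>+t. ennreal (1 / (2 * real k) ^ 8) * ennreal (t ^ 8) \<partial>std_normal)"
  proof (intro nn_integral_mono)
    fix t :: real
    show "indicator ?A t \<le> ennreal (1 / (2 * real k) ^ 8) * ennreal (t ^ 8)"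
    proof (cases "t \<in> ?A")
      case True
      then have "(2 * real k) ^ 8 \<le> \<bar>t\<bar> ^ 8" by (intro power_mono) auto
      also have "\<bar>t\<bar> ^ 8 = t ^ 8" by (rule power_even_abs) simp
      finally have "1 \<le> 1 / (2 * real k) ^ 8 * t ^ 8" using assms by (simp add: field_simps)
      then have "ennreal 1 \<le> ennreal (1 / (2 * real k) ^ 8 * t ^ 8)" by (rule ennreal_leI)
      also have "\<dots> = ennreal (1 / (2 * real k) ^ 8) * ennreal (t ^ 8)" by (rule ennreal_mult') simp
      finally show ?thesis using True by simp
    qed simp
  qed
  also have "\<dots> = ennreal (1 / (2 * real k) ^ 8) * ennreal 105"
    using nn_integral_std_normal_power_even[of 4] by (subst nn_integral_cmult) (auto simp: fact_numeral)
  also have "\<dots> = ennreal (1 / (2 * real k) ^ 8 * 105)" by (rule ennreal_mult'[symmetric]) simp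
  also have "\<dots> \<le> ennreal (1 / real k ^ 8)"
    using assms by (intro ennreal_leI) (simp add: power_mult_distrib field_simps)
  finally show ?thesis by (simp add: std_normal.emeasure_eq_measure)
qed

abbreviation unit_uniform :: "real measure" where
  "unit_uniform \<equiv> uniform_measure lborel {0..<1}"

lemma prob_space_unit_uniform: "prob_space unit_uniform"
  by (rule prob_space_uniform_measure) auto

lemma measure_unit_uniform_slice:
  assumes "0 \<le> p" "real (Suc j) * p \<le> 1"
  shows "measure unit_uniform {real j * p..<real (Suc j) * p} = p"
proof -
  have "0 \<le> real j * p" using assms by simp
  then have "{0..<1} \<inter> {real j * p..<real (Suc j) * p} = {real j * p..<real (Suc j) * p}"
    using assms(2) by auto
  then have "measure unit_uniform {real j * p..<real (Suc j) * p} = measure lborel {real j * p..<real (Suc j) * p}"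
    by (subst measure_uniform_measure) auto
  also have "\<dots> = p" using assms(1) by (simp add: algebra_simps)
  finally show ?thesis .
qed

lemma slice_label:
  fixes p u :: real
  assumes "0 \<le> p"
  shows "\<exists>l. \<forall>j<m. l = j \<longleftrightarrow> u \<in> {real j * p..<real (Suc j) * p}"
proof (cases "\<exists>i<m. u \<in> {real i * p..<real (Suc i) * p}")
  case True
  then obtain i where i: "i < m" "u \<in> {real i * p..<real (Suc i) * p}" by auto
  have uniq: "i = j" if "u \<in> {real j * p..<real (Suc j) * p}" for j
  proof (rule ccontr)
    assume "i \<noteq> j"
    then have "real (Suc i) \<le> real j \<or> real (Suc j) \<le> real i" by linarith
    then have "real (Suc i) * p \<le> real j * p \<or> real (Suc j) * p \<le> real i * p"
      using assms by (auto intro: mult_right_mono simp del: of_nat_Suc)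
    then show False using i that by auto
  qed
  show ?thesis
  proof (intro exI[of _ i] allI impI iffI)
    fix j assume "i = j"
    then show "u \<in> {real j * p..<real (Suc j) * p}" using i(2) by (simp only:)
  qed (rule uniq)
next
  case False
  show ?thesis
  \<comment> \<open>\<open>m\<close> is a label beyond those of the slices, for a point that lies in
    none of them.\<close>
  proof (intro exI[of _ m] allI impI)
    fix j assume "j < m"
    then show "(m = j) = (u \<in> {real j * p..<real (Suc j) * p})" using False by blast
  qed
qed

section \<open>Decomposition of Gaussian sums into layers\<close>

definition layer_mean :: "'v measure \<Rightarrow> (nat \<Rightarrow> 'v \<Rightarrow> real) \<Rightarrow> nat \<Rightarrow> (nat \<Rightarrow> 'x::real_normed_vector) \<Rightarrow> real \<Rightarrow> ennreal" where
  "layer_mean Q r N x \<tau> =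
     (\<integral>\<^sup>+t. rademacher_mean Q r N (\<lambda>n. indicator {t. \<bar>t\<bar> > \<tau>} (t n) *\<^sub>R x n) \<partial>PiM {..<N} (\<lambda>_. std_normal))"

lemma layer_mean_le_rademacher_mean:
  assumes r: "rademacher_sequence Q r"
  shows "layer_mean Q r N x \<tau> \<le> rademacher_mean Q r N x"
proof -
  interpret G: prob_space "PiM {..<N} (\<lambda>_. std_normal)" by (rule prob_space_PiM_std_normal)
  have "layer_mean Q r N x \<tau> \<le> (\<integral>\<^sup>+t. rademacher_mean Q r N x \<partial>PiM {..<N} (\<lambda>_. std_normal))"
    unfolding layer_mean_def
    by (intro nn_integral_mono rademacher_mean_contraction_1[OF r]) (auto simp: indicator_def)
  then show ?thesis by (simp add: G.emeasure_space_1)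
qed

text \<open>The random set of indices with \<open>\<bar>t n\<bar> > 2 k\<close> has the same law as each of the \<open>k ^ 8\<close> classes
  of a random labelling of the indices, and the classes share the bound for their sum.\<close>

lemma layer_mean_le:
  fixes x :: "nat \<Rightarrow> 'x::real_normed_vector"
  assumes r: "rademacher_sequence Q r" and "k > 0" "D \<ge> 0"
    and D: "\<And>N (x :: nat \<Rightarrow> 'x). ennreal (\<Sum>n<N. (norm (x n))\<^sup>2) \<le> ennreal D * gauss_mean {..<N} x 0"
  shows "layer_mean Q r N x (2 * real k) \<le> ennreal (4 * D / real k ^ 4) * rademacher_mean Q r N x"
proof -
  let ?I = "{..<N}"
  let ?A = "{t :: real. \<bar>t\<bar> > 2 * real k}"
  let ?U = "PiM ?I (\<lambda>_. unit_uniform)"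
  interpret U: prob_space ?U by (rule prob_space_PiM) (rule prob_space_unit_uniform)
  define p where "p = measure std_normal ?A"
  \<comment> \<open>The tail bound gives \<open>p \<le> 1 / k ^ 8\<close>, so this many disjoint
    slices of length \<open>p\<close> fit into the unit interval.\<close>
  define m where "m = k ^ 8"
  define E where "E j = {real j * p..<real (Suc j) * p}" for j
  let ?\<Phi> = "\<lambda>t. rademacher_mean Q r N (\<lambda>n. t n *\<^sub>R x n)"
  have \<Phi>: "?\<Phi> \<in> borel_measurable (PiM ?I (\<lambda>_. std_normal))"
    by (rule borel_measurable_rademacher_mean[OF r]) (simp add: measurable_PiM_std_normal_component)
  have \<Phi>_restrict: "?\<Phi> (\<lambda>n\<in>?I. s n) = ?\<Phi> s" for s
    by (rule rademacher_mean_cong) simp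
  have p0: "0 \<le> p" by (simp add: p_def)
  have mp: "real m * p \<le> 1"
    using std_normal_tail[OF \<open>k > 0\<close>] \<open>k > 0\<close> by (simp add: p_def m_def field_simps)
  have E_sets: "E j \<in> sets borel" for j by (simp add: E_def)
  have "(\<integral>\<^sup>+u. ?\<Phi> (\<lambda>n. indicator (E j) (u n)) \<partial>?U) = layer_mean Q r N x (2 * real k)" if "j < m" for j
  proof -
    have "real (Suc j) * p \<le> real m * p" using that p0 by (intro mult_right_mono) auto
    then have "measure unit_uniform (E j) = measure std_normal ?A"
      unfolding E_def using mp p0 by (subst measure_unit_uniform_slice) (auto simp: p_def)
    then have law: "distr unit_uniform std_normal (indicator (E j)) = distr std_normal std_normal (indicator ?A)"
      by (intro distr_indicator_eq prob_space_unit_uniform prob_space_std_normal E_sets) auto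
    have "(\<integral>\<^sup>+u. ?\<Phi> (\<lambda>n. indicator (E j) (u n)) \<partial>?U) = (\<integral>\<^sup>+u. ?\<Phi> (\<lambda>n\<in>?I. indicator (E j) (u n)) \<partial>?U)"
      by (simp only: \<Phi>_restrict)
    also have "\<dots> = (\<integral>\<^sup>+t. ?\<Phi> t \<partial>PiM ?I (\<lambda>_. distr unit_uniform std_normal (indicator (E j))))"
      by (rule nn_integral_PiM_indicator[OF prob_space_unit_uniform _ E_sets _ \<Phi>]) auto
    also have "\<dots> = (\<integral>\<^sup>+t. ?\<Phi> (\<lambda>n\<in>?I. indicator ?A (t n)) \<partial>PiM ?I (\<lambda>_. std_normal))"
      unfolding law by (rule nn_integral_PiM_indicator[symmetric, OF prob_space_std_normal _ _ _ \<Phi>]) auto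
    also have "\<dots> = layer_mean Q r N x (2 * real k)"
      by (simp only: \<Phi>_restrict layer_mean_def)
    finally show ?thesis .
  qed
  then have "of_nat m * layer_mean Q r N x (2 * real k) = (\<Sum>j<m. \<integral>\<^sup>+u. ?\<Phi> (\<lambda>n. indicator (E j) (u n)) \<partial>?U)"
    by simp
  also have "\<dots> = (\<integral>\<^sup>+u. (\<Sum>j<m. ?\<Phi> (\<lambda>n. indicator (E j) (u n))) \<partial>?U)"
  proof (rule nn_integral_sum[symmetric])
    fix j
    show "(\<lambda>u. ?\<Phi> (\<lambda>n. indicator (E j) (u n))) \<in> borel_measurable ?U"
    proof (rule borel_measurable_rademacher_mean[OF r])
      fix n assume "n < N"
      then have "(\<lambda>u. u n) \<in> measurable ?U unit_uniform" by (intro measurable_component_singleton) simp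
      moreover have "indicator (E j) \<in> borel_measurable unit_uniform" using E_sets by simp
      ultimately show "(\<lambda>u. indicator (E j) (u n) :: real) \<in> borel_measurable ?U" by (rule measurable_compose)
    qed
  qed
  \<comment> \<open>The parameter \<open>k ^ 4\<close> is the square root of \<open>m\<close> and
    balances the two terms, which add up to \<open>4 * real k ^ 4\<close>. Division by
    \<open>m\<close> then leaves a decay of order \<open>k ^ 4\<close> in the denominator.\<close>
  also have "\<dots> \<le> (\<integral>\<^sup>+u. ennreal D * (ennreal (real k ^ 4 + 3 * real m / real k ^ 4) * rademacher_mean Q r N x) \<partial>?U)"
  proof (intro nn_integral_mono)
    fix u :: "nat \<Rightarrow> real"
    have "\<exists>l. \<forall>n. \<forall>j<m. l n = j \<longleftrightarrow> u n \<in> E j"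
      unfolding E_def using slice_label[OF p0] by (intro choice allI) blast
    then obtain l where l: "\<And>n j. j < m \<Longrightarrow> l n = j \<longleftrightarrow> u n \<in> E j" by blast
    have "(\<Sum>j<m. ?\<Phi> (\<lambda>n. indicator (E j) (u n))) = (\<Sum>j<m. rademacher_mean Q r N (\<lambda>n. if l n = j then x n else 0))"
      using l by (intro sum.cong refl rademacher_mean_cong) (auto simp: indicator_def)
    also have "\<dots> \<le> ennreal D * (ennreal (real k ^ 4 + 3 * real m / real k ^ 4) * rademacher_mean Q r N x)"
      by (rule sum_rademacher_mean_labels_le[OF r _ D]) (use \<open>k > 0\<close> in simp)
    finally show "(\<Sum>j<m. ?\<Phi> (\<lambda>n. indicator (E j) (u n)))
      \<le> ennreal D * (ennreal (real k ^ 4 + 3 * real m / real k ^ 4) * rademacher_mean Q r N x)" .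
  qed
  also have "\<dots> = ennreal D * (ennreal (real k ^ 4 + 3 * real m / real k ^ 4) * rademacher_mean Q r N x)"
    by (simp add: U.emeasure_space_1)
  finally have le: "of_nat m * layer_mean Q r N x (2 * real k)
    \<le> ennreal D * (ennreal (real k ^ 4 + 3 * real m / real k ^ 4) * rademacher_mean Q r N x)" .
  define R where "R = enn2real (rademacher_mean Q r N x)"
  have R: "rademacher_mean Q r N x = ennreal R" "R \<ge> 0"
    using rademacher_mean_finite[OF r, of N x] by (auto simp: R_def)
  have "layer_mean Q r N x (2 * real k) < \<infinity>"
    using layer_mean_le_rademacher_mean[OF r] rademacher_mean_finite[OF r] by (rule le_less_trans)
  then obtain Lr where Lr: "layer_mean Q r N x (2 * real k) = ennreal Lr" "Lr \<ge> 0"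
    by (cases "layer_mean Q r N x (2 * real k)") auto
  define K where "K = real k ^ 4"
  have K: "K > 0" "real m = K * K" using \<open>k > 0\<close> by (simp_all add: K_def m_def power_add[symmetric])
  have m4: "real k ^ 4 + 3 * real m / real k ^ 4 = 4 * K"
    using K by (simp add: K_def[symmetric])
  have "ennreal (real m * Lr) \<le> ennreal (D * (4 * K * R))"
    using le unfolding R(1) Lr(1) m4 using \<open>D \<ge> 0\<close> R(2) Lr(2) K(1)
    by (simp add: ennreal_mult ennreal_of_nat_eq_real_of_nat)
  then have "K * (K * Lr) \<le> K * (4 * D * R)"
    using \<open>D \<ge> 0\<close> R(2) K by (subst (asm) ennreal_le_iff) (auto simp: algebra_simps)
  then have "K * Lr \<le> 4 * D * R" using K(1) by simp
  then have "Lr \<le> 4 * D / real k ^ 4 * R" using K(1) by (simp add: K_def[symmetric] field_simps)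
  then show ?thesis unfolding R(1) Lr(1) using \<open>D \<ge> 0\<close> R(2)
    by (simp add: ennreal_mult'[symmetric] ennreal_leI)
qed

lemma le_sum_layers:
  fixes s :: real
  assumes "s \<le> 2 * real K"
  shows "s \<le> (\<Sum>k<K. 2 * indicator {t. t > 2 * real k} s)"
  using assms
proof (induction K)
  case (Suc K)
  show ?case
  proof (cases "s \<le> 2 * real K")
    case True
    then have "s \<le> (\<Sum>k<K. 2 * indicator {t. t > 2 * real k} s)" by (rule Suc.IH)
    also have "\<dots> \<le> (\<Sum>k<Suc K. 2 * indicator {t. t > 2 * real k} s)" by simp
    finally show ?thesis .
  next
    case False
    have "(\<Sum>k<Suc K. 2 * indicator {t. t > 2 * real k} s) = (\<Sum>k<Suc K. 2 :: real)"
    proof (intro sum.cong refl)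
      fix k assume "k \<in> {..<Suc K}"
      then have "real k \<le> real K" by simp
      then have "2 * real k < s" using False by linarith
      then show "2 * indicator {t. t > 2 * real k} s = (2 :: real)" by simp
    qed
    then show ?thesis using Suc.prems by simp
  qed
qed simp

lemma suminf_inverse_squares: "(\<Sum>k. ennreal (1 / (real k + 1)\<^sup>2)) = ennreal (pi\<^sup>2 / 6)"
proof -
  have s: "(\<lambda>k. 1 / (real k + 1)\<^sup>2) sums (pi\<^sup>2 / 6)"
    using inverse_squares_sums by (simp add: add.commute)
  have "(\<Sum>k. ennreal (1 / (real k + 1)\<^sup>2)) = ennreal (\<Sum>k. 1 / (real k + 1)\<^sup>2)"
    using s by (intro suminf_ennreal2) (auto simp: sums_iff)
  then show ?thesis by (simp only: sums_unique[OF s, symmetric])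
qed

text \<open>Each coefficient is dominated by a sum of layers of height 2, and contraction replaces
  it by that sum; for fixed \<open>t\<close> only finitely many layers occur. Cauchy-Schwarz with
  the weights \<open>1 / (real k + 1)\<^sup>2\<close> gives \<pi>^2/6 in front, and the squared
  height times the inverse weight gives \<open>4 * (real k + 1)\<^sup>2\<close>.\<close>

lemma rademacher_mean_le_layers:
  fixes x :: "nat \<Rightarrow> 'x::real_normed_vector" and t :: "nat \<Rightarrow> real"
  assumes r: "rademacher_sequence Q r"
  shows "rademacher_mean Q r N (\<lambda>n. t n *\<^sub>R x n) \<le> ennreal (pi\<^sup>2 / 6) *
    (\<Sum>k. ennreal (4 * (real k + 1)\<^sup>2) * rademacher_mean Q r N (\<lambda>n. indicator {t. \<bar>t\<bar> > 2 * real k} (t n) *\<^sub>R x n))"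
proof -
  let ?i = "\<lambda>k n. indicator {t :: real. \<bar>t\<bar> > 2 * real k} (t n) :: real"
  let ?Z = "\<lambda>k \<omega>. \<Sum>n<N. r n \<omega> *\<^sub>R ?i k n *\<^sub>R x n"
  obtain K :: nat where K: "(\<Sum>n<N. \<bar>t n\<bar>) \<le> real K" using real_arch_simple by blast
  define c where "c n = (\<Sum>k<K. 2 * ?i k n)" for n
  have tc: "\<bar>t n\<bar> \<le> \<bar>c n\<bar>" if "n < N" for n
  proof -
    have "\<bar>t n\<bar> \<le> (\<Sum>n<N. \<bar>t n\<bar>)" using that by (intro member_le_sum) auto
    then have "\<bar>t n\<bar> \<le> 2 * real K" using K by linarith
    then have "\<bar>t n\<bar> \<le> (\<Sum>k<K. 2 * indicator {s. s > 2 * real k} \<bar>t n\<bar>)" by (rule le_sum_layers)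
    also have "\<dots> = c n" unfolding c_def by (intro sum.cong) (auto simp: indicator_def)
    finally show ?thesis by simp
  qed
  have m: "(\<lambda>\<omega>. ennreal ((norm (?Z k \<omega>))\<^sup>2)) \<in> borel_measurable Q" for k
    by (intro measurable_compose[OF _ measurable_ennreal] borel_measurable_power borel_measurable_rademacher_integrand[OF r])
  have m': "(\<lambda>\<omega>. ennreal (4 * (real k + 1)\<^sup>2) * ennreal ((norm (?Z k \<omega>))\<^sup>2)) \<in> borel_measurable Q" for k
    by (rule borel_measurable_times_ennreal[OF borel_measurable_const m])
  have "rademacher_mean Q r N (\<lambda>n. t n *\<^sub>R x n) \<le> rademacher_mean Q r N (\<lambda>n. c n *\<^sub>R x n)"
    by (rule rademacher_mean_contraction[OF r tc])
  also have "\<dots> \<le> (\<integral>\<^sup>+\<omega>. ennreal (pi\<^sup>2 / 6) * (\<Sum>k. ennreal (4 * (real k + 1)\<^sup>2) * ennreal ((norm (?Z k \<omega>))\<^sup>2)) \<partial>Q)"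
    unfolding rademacher_mean_def
  proof (intro nn_integral_mono)
    fix \<omega>
    define z where "z k = (if k < K then 2 *\<^sub>R ?Z k \<omega> else 0)" for k
    have "(\<Sum>n<N. r n \<omega> *\<^sub>R c n *\<^sub>R x n) = (\<Sum>k<K. 2 *\<^sub>R ?Z k \<omega>)"
      unfolding c_def scaleR_sum_left scaleR_sum_right
      by (subst sum.swap) (simp add: mult.commute mult.left_commute)
    also have "\<dots> = (\<Sum>k<K. z k)" by (simp add: z_def)
    finally have "z sums (\<Sum>n<N. r n \<omega> *\<^sub>R c n *\<^sub>R x n)"
      using sums_finite[of "{..<K}" z] by (simp add: z_def)
    then have "(ennreal (norm (\<Sum>n<N. r n \<omega> *\<^sub>R c n *\<^sub>R x n)))\<^sup>2 \<le> (\<Sum>k. ennreal \<bar>norm (z k)\<bar>)\<^sup>2"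
      unfolding abs_norm_cancel by (intro power_mono ennreal_norm_suminf_le zero_le)
    also have "\<dots> \<le> (\<Sum>k. ennreal (1 / (real k + 1)\<^sup>2)) * (\<Sum>k. ennreal ((norm (z k))\<^sup>2 / (1 / (real k + 1)\<^sup>2)))"
    proof (rule weighted_Cauchy_Schwarz_suminf)
      fix k
      have "real k + 1 \<noteq> 0" by (metis of_nat_neq_0 of_nat_Suc add.commute)
      then show "0 < 1 / (real k + 1)\<^sup>2" by simp
    qed
    also have "\<dots> \<le> ennreal (pi\<^sup>2 / 6) * (\<Sum>k. ennreal (4 * (real k + 1)\<^sup>2) * ennreal ((norm (?Z k \<omega>))\<^sup>2))"
      unfolding suminf_inverse_squares
    proof (intro mult_left_mono suminf_le)
      fix k
      have "(norm (z k))\<^sup>2 \<le> 4 * (norm (?Z k \<omega>))\<^sup>2"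
        by (simp add: z_def power_mult_distrib)
      then have "(norm (z k))\<^sup>2 / (1 / (real k + 1)\<^sup>2) \<le> 4 * (real k + 1)\<^sup>2 * (norm (?Z k \<omega>))\<^sup>2"
        using mult_right_mono[of "(norm (z k))\<^sup>2" "4 * (norm (?Z k \<omega>))\<^sup>2" "(real k + 1)\<^sup>2"] by (simp add: mult_ac)
      then show "ennreal ((norm (z k))\<^sup>2 / (1 / (real k + 1)\<^sup>2)) \<le> ennreal (4 * (real k + 1)\<^sup>2) * ennreal ((norm (?Z k \<omega>))\<^sup>2)"
        by (subst ennreal_mult'[symmetric]) (auto intro: ennreal_leI)
    qed auto
    finally show "ennreal ((norm (\<Sum>n<N. r n \<omega> *\<^sub>R c n *\<^sub>R x n))\<^sup>2)
        \<le> ennreal (pi\<^sup>2 / 6) * (\<Sum>k. ennreal (4 * (real k + 1)\<^sup>2) * ennreal ((norm (?Z k \<omega>))\<^sup>2))"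
      by (simp only: ennreal_power norm_ge_zero)
  qed
  also have "\<dots> = ennreal (pi\<^sup>2 / 6) * (\<Sum>k. \<integral>\<^sup>+\<omega>. ennreal (4 * (real k + 1)\<^sup>2) * ennreal ((norm (?Z k \<omega>))\<^sup>2) \<partial>Q)"
    by (simp only: nn_integral_cmult[OF borel_measurable_suminf_order[OF m']] nn_integral_suminf[OF m'])
  also have "\<dots> = ennreal (pi\<^sup>2 / 6) * (\<Sum>k. ennreal (4 * (real k + 1)\<^sup>2) * rademacher_mean Q r N (\<lambda>n. ?i k n *\<^sub>R x n))"
    by (simp only: nn_integral_cmult[OF m] rademacher_mean_def)
  finally show ?thesis .
qed

text \<open>The layer means decay with the fourth power of \<open>k\<close>, so after multiplication
  by \<open>(real k + 1)\<^sup>2\<close> a convergent series remains; this explains the eighth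
  moment in the tail bound. In the constant, \<open>64 * D\<close> is \<open>4 * D\<close> times
  \<open>2 ^ 4\<close> from \<open>k + 1 \<le> 2 * k\<close>, the 1 covers \<open>k = 0\<close>, and
  the two factors \<pi>^2/6 come from Cauchy-Schwarz and from the remaining series.\<close>

lemma gauss_mean_le_rademacher_mean:
  fixes x :: "nat \<Rightarrow> 'x::real_normed_vector"
  assumes r: "rademacher_sequence Q r" and "D \<ge> 0"
    and D: "\<And>N (x :: nat \<Rightarrow> 'x). ennreal (\<Sum>n<N. (norm (x n))\<^sup>2) \<le> ennreal D * gauss_mean {..<N} x 0"
  shows "gauss_mean {..<N} x 0 \<le> ennreal (pi\<^sup>2 / 6 * (4 * (1 + 64 * D)) * (pi\<^sup>2 / 6)) * rademacher_mean Q r N x"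
proof -
  let ?G = "PiM {..<N} (\<lambda>_. std_normal)"
  let ?R = "rademacher_mean Q r N x"
  let ?i = "\<lambda>k t n. indicator {t :: real. \<bar>t\<bar> > 2 * real k} (t n) :: real"
  let ?\<kappa> = "1 + 64 * D"
  have m: "(\<lambda>t. rademacher_mean Q r N (\<lambda>n. ?i k t n *\<^sub>R x n)) \<in> borel_measurable ?G" for k
  proof (rule borel_measurable_rademacher_mean[OF r])
    fix n assume "n < N"
    then have "(\<lambda>t. t n) \<in> borel_measurable ?G" by (intro measurable_PiM_std_normal_component) simp
    moreover have "indicator {t :: real. \<bar>t\<bar> > 2 * real k} \<in> borel_measurable borel" by measurable
    ultimately show "(\<lambda>t. ?i k t n) \<in> borel_measurable ?G" by (rule measurable_compose)
  qed
  have m': "(\<lambda>t. ennreal (4 * (real k + 1)\<^sup>2) * rademacher_mean Q r N (\<lambda>n. ?i k t n *\<^sub>R x n)) \<in> borel_measurable ?G" for k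
    by (rule borel_measurable_times_ennreal[OF borel_measurable_const m])
  have layer: "ennreal (4 * (real k + 1)\<^sup>2) * layer_mean Q r N x (2 * real k) \<le> ennreal (4 * ?\<kappa>) * ?R * ennreal (1 / (real k + 1)\<^sup>2)" for k
  proof -
    have pos: "real k + 1 > 0" by simp
    have "layer_mean Q r N x (2 * real k) \<le> ennreal (?\<kappa> / (real k + 1) ^ 4) * ?R"
    proof (cases "k = 0")
      case True
      have "layer_mean Q r N x (2 * real k) \<le> ennreal 1 * ?R" using layer_mean_le_rademacher_mean[OF r] by simp
      also have "\<dots> \<le> ennreal (?\<kappa> / (real k + 1) ^ 4) * ?R"
        using True \<open>D \<ge> 0\<close> by (intro mult_right_mono ennreal_leI) auto
      finally show ?thesis .
    next
      case False
      then have k: "real k \<ge> 1" by simp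
      have "(real k + 1) ^ 4 \<le> (2 * real k) ^ 4" using k by (intro power_mono) auto
      then have "4 * D * (real k + 1) ^ 4 \<le> 4 * D * (2 * real k) ^ 4" using \<open>D \<ge> 0\<close> by (intro mult_left_mono) auto
      also have "\<dots> = 64 * D * real k ^ 4" by (simp add: power_mult_distrib)
      also have "\<dots> \<le> ?\<kappa> * real k ^ 4" by (intro mult_right_mono) auto
      finally have "4 * D / real k ^ 4 \<le> ?\<kappa> / (real k + 1) ^ 4"
        using k pos by (simp add: divide_simps mult_ac)
      have "layer_mean Q r N x (2 * real k) \<le> ennreal (4 * D / real k ^ 4) * ?R"
        using False by (intro layer_mean_le[OF r _ \<open>D \<ge> 0\<close> D]) simp
      also have "\<dots> \<le> ennreal (?\<kappa> / (real k + 1) ^ 4) * ?R"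
        by (intro mult_right_mono ennreal_leI \<open>4 * D / real k ^ 4 \<le> ?\<kappa> / (real k + 1) ^ 4\<close>) simp
      finally show ?thesis .
    qed
    then have "ennreal (4 * (real k + 1)\<^sup>2) * layer_mean Q r N x (2 * real k)
        \<le> ennreal (4 * (real k + 1)\<^sup>2) * (ennreal (?\<kappa> / (real k + 1) ^ 4) * ?R)"
      by (rule mult_left_mono) simp
    also have "\<dots> = ennreal (4 * (real k + 1)\<^sup>2 * (?\<kappa> / (real k + 1) ^ 4)) * ?R"
      using \<open>D \<ge> 0\<close> by (subst ennreal_mult) (auto simp: mult.assoc)
    also have "4 * (real k + 1)\<^sup>2 * (?\<kappa> / (real k + 1) ^ 4) = 4 * ?\<kappa> * (1 / (real k + 1)\<^sup>2)"
    proof -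
      have frac: "4 * q * (?\<kappa> / (q * q)) = 4 * ?\<kappa> * (1 / q)" if "q \<noteq> 0" for q :: real
        using that by (simp add: field_simps)
      have p4: "(real k + 1) ^ 4 = (real k + 1)\<^sup>2 * (real k + 1)\<^sup>2" by (simp add: power_add[symmetric])
      have "(real k + 1)\<^sup>2 \<noteq> 0" using pos by simp
      then show ?thesis unfolding p4 by (rule frac)
    qed
    also have "ennreal (4 * ?\<kappa> * (1 / (real k + 1)\<^sup>2)) * ?R = ennreal (4 * ?\<kappa>) * ?R * ennreal (1 / (real k + 1)\<^sup>2)"
      using \<open>D \<ge> 0\<close> by (subst ennreal_mult) (auto simp: mult_ac)
    finally show ?thesis .
  qed
  have "gauss_mean {..<N} x 0 = (\<integral>\<^sup>+t. rademacher_mean Q r N (\<lambda>n. t n *\<^sub>R x n) \<partial>?G)"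
    by (rule gauss_mean_rademacher_mean[OF r])
  also have "\<dots> \<le> (\<integral>\<^sup>+t. ennreal (pi\<^sup>2 / 6) * (\<Sum>k. ennreal (4 * (real k + 1)\<^sup>2) * rademacher_mean Q r N (\<lambda>n. ?i k t n *\<^sub>R x n)) \<partial>?G)"
    by (intro nn_integral_mono rademacher_mean_le_layers[OF r])
  also have "\<dots> = ennreal (pi\<^sup>2 / 6) * (\<Sum>k. \<integral>\<^sup>+t. ennreal (4 * (real k + 1)\<^sup>2) * rademacher_mean Q r N (\<lambda>n. ?i k t n *\<^sub>R x n) \<partial>?G)"
    by (simp only: nn_integral_cmult[OF borel_measurable_suminf_order[OF m']] nn_integral_suminf[OF m'])
  also have "\<dots> = ennreal (pi\<^sup>2 / 6) * (\<Sum>k. ennreal (4 * (real k + 1)\<^sup>2) * layer_mean Q r N x (2 * real k))"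
    by (simp only: nn_integral_cmult[OF m] layer_mean_def)
  also have "\<dots> \<le> ennreal (pi\<^sup>2 / 6) * (\<Sum>k. ennreal (4 * ?\<kappa>) * ?R * ennreal (1 / (real k + 1)\<^sup>2))"
    by (intro mult_left_mono suminf_le layer) auto
  also have "\<dots> = ennreal (pi\<^sup>2 / 6) * (ennreal (4 * ?\<kappa>) * ?R * ennreal (pi\<^sup>2 / 6))"
    by (simp only: ennreal_suminf_cmult suminf_inverse_squares)
  also have "\<dots> = ennreal (pi\<^sup>2 / 6 * (4 * ?\<kappa>) * (pi\<^sup>2 / 6)) * ?R"
  proof -
    have gen: "ennreal a * (ennreal b * R * ennreal a) = ennreal (a * b * a) * R" if "a \<ge> 0" "b \<ge> 0" for a b R
      using that by (simp add: ennreal_mult mult_ac)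
    show ?thesis by (rule gen) (use \<open>D \<ge> 0\<close> in auto)
  qed
  finally show ?thesis .
qed

lemma cotype2_of_gauss_cotype:
  assumes r: "rademacher_sequence Q r" and "D \<ge> 0"
    and D: "\<And>N (x :: nat \<Rightarrow> 'x::real_normed_vector). ennreal (\<Sum>n<N. (norm (x n))\<^sup>2) \<le> ennreal D * gauss_mean {..<N} x 0"
  shows "cotype2 Q r TYPE('x)"
proof -
  define K where "K = pi\<^sup>2 / 6 * (4 * (1 + 64 * D)) * (pi\<^sup>2 / 6)"
  have K: "K \<ge> 0" using \<open>D \<ge> 0\<close> by (simp add: K_def)
  have "ennreal (\<Sum>n<N. (norm (x n))\<^sup>2) \<le> ennreal ((sqrt (D * K))\<^sup>2) * rademacher_mean Q r N x" for N and x :: "nat \<Rightarrow> 'x"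
  proof -
    have "ennreal (\<Sum>n<N. (norm (x n))\<^sup>2) \<le> ennreal D * gauss_mean {..<N} x 0" by (rule D)
    also have "\<dots> \<le> ennreal D * (ennreal K * rademacher_mean Q r N x)"
      unfolding K_def by (intro mult_left_mono gauss_mean_le_rademacher_mean[OF r \<open>D \<ge> 0\<close> D]) simp
    also have "\<dots> = ennreal ((sqrt (D * K))\<^sup>2) * rademacher_mean Q r N x"
      using \<open>D \<ge> 0\<close> K by (simp add: ennreal_mult mult.assoc)
    finally show ?thesis .
  qed
  then have "cotype2_constant Q r TYPE('x) (sqrt (D * K))"
    unfolding cotype2_constant_iff[OF r] using \<open>D \<ge> 0\<close> K by simp
  then show ?thesis unfolding cotype2_def by blast
qed

theorem corollary2p6:
  fixes M :: "'s measure"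
    and P :: "'w measure" and \<gamma> :: "nat \<Rightarrow> 'w \<Rightarrow> real"
    and Q :: "'v measure" and r :: "nat \<Rightarrow> 'v \<Rightarrow> real"
  assumes "prob_space M"
    and "gaussian_sequence P \<gamma>"
    and "rademacher_sequence Q r"
  shows "(cotype2 Q r TYPE('x::banach) \<longrightarrow>
           (\<forall>F :: 's set \<Rightarrow> 'x. vector_measure M F \<and> bounded_gamma_variation P \<gamma> M F \<and>
               (infinite_dim_L2 M \<or> vanishes_on_null_sets M F) \<longrightarrow>
             (\<exists>\<phi> \<in> bochner_L2 M. represents M \<phi> F \<and>
               (\<forall>C. cotype2_constant Q r TYPE('x) C \<longrightarrow>
                  ennreal (bochner_L2_norm M \<phi>) \<le> ennreal C * gamma_variation P \<gamma> M F))))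
       \<and> (infinite_dim_L2 M \<longrightarrow>
           (cotype2 Q r TYPE('x) \<longleftrightarrow>
             (\<forall>F :: 's set \<Rightarrow> 'x. vector_measure M F \<and> bounded_gamma_variation P \<gamma> M F \<longrightarrow>
               (\<exists>\<phi> \<in> bochner_L2 M. represents M \<phi> F))))"
proof -
  interpret M: prob_space M by fact
  have rep: "\<exists>\<phi>\<in>bochner_L2 M. represents M \<phi> F \<and>
      (\<forall>C. cotype2_constant Q r TYPE('x) C \<longrightarrow> ennreal (bochner_L2_norm M \<phi>) \<le> ennreal C * gamma_variation P \<gamma> M F)"
    if cot: "cotype2 Q r TYPE('x)" and F: "vector_measure M F" "bounded_gamma_variation P \<gamma> M F"
      "infinite_dim_L2 M \<or> vanishes_on_null_sets M F" for F :: "'s set \<Rightarrow> 'x"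
  proof (rule M.cotype2_representation[OF assms(2,3) cot F(1,2)])
    show "vanishes_on_null_sets M F"
      using F(3) M.vanishes_on_null_sets_of_infinite_dim[OF assms(2) F(1,2)] by blast
  qed
  have "cotype2 Q r TYPE('x)"
    if inf: "infinite_dim_L2 M" and
      dens: "\<And>F :: 's set \<Rightarrow> 'x. vector_measure M F \<Longrightarrow> bounded_gamma_variation P \<gamma> M F \<Longrightarrow>
        \<exists>\<phi>\<in>bochner_L2 M. represents M \<phi> F"
  proof -
    obtain D where "D > 0"
      "\<forall>N (x :: nat \<Rightarrow> 'x). ennreal (\<Sum>n<N. (norm (x n))\<^sup>2) \<le> ennreal D * gauss_mean {..<N} x 0"
      using M.gauss_cotype_of_representation[OF assms(2) inf dens] by blast
    then show ?thesis by (intro cotype2_of_gauss_cotype[OF assms(3), of D]) auto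
  qed
  with rep show ?thesis by blast
qed

end
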